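(* Let $L>0$, $\nu,\kappa>0$, $\alpha,\beta\in\mathbb R$, $\gamma\ge0$. Let $u_0\in H^1(0,L)$ and $a,b\in H^1_{\mathrm{loc}}(\mathbb R_+)$ satisfy the compatibility condition $u_0(0)=a(0)$. Suppose that $p\in(0,2]$ if $\beta\ge0$ and $p\in(0,\frac45)$ if $\beta<0$. If $u\in C_t([0,T];H^1_x(0,L))$ is a local solution of the initial-boundary value problem $$\begin{aligned}&u_t-(\nu+i\alpha)u_{xx}-\gamma u+(\kappa+i\beta)|u|^pu=0,\quad x\in(0,L),\ t>0,\\ &u(x,0)=u_0(x),\qquad u(0,t)=a(t),\quad u_x(L,t)=b(t),\end{aligned}$$ then $u$ is also a global-in-time solution, i.e. it extends to a solution in $C_t([0,T'];H^1_x(0,L))$ for every $T'>0$.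
   Context: Functions are complex-valued. $H^1_{\mathrm{loc}}(\mathbb R_+)$ denotes functions belonging to $H^1(0,T')$ for every $T'>0$. A local solution is a solution of the problem on some interval $[0,T]$, $T>0$, understood in the mild sense: $u$ coincides with the solution of the linear problem $u_t-(\nu+i\alpha)u_{xx}-\gamma u=\mathfrak f$, $u(x,0)=u_0$, $u(0,t)=a$, $u_x(L,t)=b$ with forcing $\mathfrak f=-(\kappa+i\beta)|u|^pu$. *)

theory Defs
  imports "HOL-Analysis.Analysis"
begin

section \<open>Sobolev spaces on a bounded interval\<close>

definition test_function :: "real \<Rightarrow> real \<Rightarrow> (real \<Rightarrow> real) \<Rightarrow> bool" where
  "test_function c d \<phi> \<longleftrightarrow>
     (\<forall>k x. (deriv ^^ k) \<phi> differentiable (at x)) \<and>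
     (\<exists>c' d'. c < c' \<and> d' < d \<and> (\<forall>x. \<phi> x \<noteq> 0 \<longrightarrow> x \<in> {c'..d'}))"

definition square_integrable :: "real \<Rightarrow> real \<Rightarrow> (real \<Rightarrow> complex) \<Rightarrow> bool" where
  "square_integrable c d f \<longleftrightarrow>
     f \<in> borel_measurable (lebesgue_on {c..d}) \<and>
     integrable (lebesgue_on {c..d}) (\<lambda>x. (cmod (f x))\<^sup>2)"

text \<open>\<open>g\<close> is the distributional derivative of \<open>f\<close> on \<open>(c,d)\<close>, both being in \<open>L\<^sup>2(c,d)\<close>.
  Real test functions suffice, by linearity.\<close>

definition weak_derivative ::
    "real \<Rightarrow> real \<Rightarrow> (real \<Rightarrow> complex) \<Rightarrow> (real \<Rightarrow> complex) \<Rightarrow> bool" where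
  "weak_derivative c d f g \<longleftrightarrow>
     square_integrable c d f \<and> square_integrable c d g \<and>
     (\<forall>\<phi>. test_function c d \<phi> \<longrightarrow>
        (LINT x|lebesgue_on {c..d}. deriv \<phi> x *\<^sub>R f x) =
        - (LINT x|lebesgue_on {c..d}. \<phi> x *\<^sub>R g x))"

text \<open>An \<open>H\<^sup>1\<close> class has a unique representative that is continuous on \<open>[c,d]\<close>; elements of
  \<open>H1 c d\<close> are that representative, so that boundary values are point evaluations. Values outside
  \<open>[c,d]\<close> are irrelevant.\<close>

definition H1 :: "real \<Rightarrow> real \<Rightarrow> (real \<Rightarrow> complex) set" where
  "H1 c d = {f. continuous_on {c..d} f \<and> (\<exists>g. weak_derivative c d f g)}"

text \<open>The choice of \<open>g\<close> is immaterial, as weak derivatives are unique almost everywhere.\<close>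

definition H1_norm :: "real \<Rightarrow> real \<Rightarrow> (real \<Rightarrow> complex) \<Rightarrow> real" where
  "H1_norm c d f =
     (let g = (SOME g. weak_derivative c d f g) in
        sqrt ((LINT x|lebesgue_on {c..d}. (cmod (f x))\<^sup>2) +
              (LINT x|lebesgue_on {c..d}. (cmod (g x))\<^sup>2)))"

definition H1_loc :: "(real \<Rightarrow> complex) set" where
  "H1_loc = {f. \<forall>T>0. f \<in> H1 0 T}"

text \<open>Functions of time and space are written \<open>u t x\<close>. The following is \<open>C([0,T]; H\<^sup>1(0,L))\<close>.\<close>

definition C_H1 :: "real \<Rightarrow> real \<Rightarrow> (real \<Rightarrow> real \<Rightarrow> complex) set" where
  "C_H1 T L =
     {u. (\<forall>t\<in>{0..T}. u t \<in> H1 0 L) \<and>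
         (\<forall>t\<in>{0..T}. ((\<lambda>s. H1_norm 0 L (\<lambda>x. u s x - u t x)) \<longlongrightarrow> 0) (at t within {0..T}))}"

section \<open>Mild solutions\<close>

text \<open>Mild solution in \<open>C([0,T]; H\<^sup>1(0,L))\<close> of the linear problem
  \<open>u\<^sub>t - (\<nu> + i\<alpha>) u\<^sub>x\<^sub>x - \<gamma> u = F\<close>, \<open>u(x,0) = u0(x)\<close>, \<open>u(0,t) = a(t)\<close>, \<open>u\<^sub>x(L,t) = b(t)\<close>.
  For an evolution equation \<open>v' = A v + F\<close>, where \<open>A\<close> generates a strongly continuous semigroup,
  \<open>v\<close> is a mild solution if
  \<open>\<integral>\<^sub>0\<^sup>t v \<in> D(A)\<close> and \<open>v(t) = v(0) + A (\<integral>\<^sub>0\<^sup>t v) + \<integral>\<^sub>0\<^sup>t F\<close>,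
  which is equivalent to the variation of constants formula. With inhomogeneous boundary data, the
  membership in \<open>D(A)\<close> becomes: \<open>U = \<integral>\<^sub>0\<^sup>t u\<close> is in \<open>H\<^sup>2(0,L)\<close>, with the boundary values
  \<open>\<integral>\<^sub>0\<^sup>t a\<close> of \<open>U\<close> at \<open>0\<close> and \<open>\<integral>\<^sub>0\<^sup>t b\<close> of \<open>U\<^sub>x\<close> at \<open>L\<close>. As \<open>u\<close> is continuous in time with values
  in \<open>H\<^sup>1(0,L)\<close>, the Dirichlet condition can be (and is) imposed on \<open>u\<close> itself. Below, \<open>V\<close> and \<open>W\<close>
  are \<open>U\<^sub>x\<close> and \<open>U\<^sub>x\<^sub>x\<close>.\<close>

definition linear_mild_solution ::
    "real \<Rightarrow> real \<Rightarrow> real \<Rightarrow> real \<Rightarrow> (real \<Rightarrow> complex) \<Rightarrow> (real \<Rightarrow> complex) \<Rightarrow> (real \<Rightarrow> complex) \<Rightarrow>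
     (real \<Rightarrow> real \<Rightarrow> complex) \<Rightarrow> real \<Rightarrow> (real \<Rightarrow> real \<Rightarrow> complex) \<Rightarrow> bool" where
  "linear_mild_solution L \<nu> \<alpha> \<gamma> u0 a b F T u \<longleftrightarrow>
     u \<in> C_H1 T L \<and>
     (\<forall>x\<in>{0..L}. u 0 x = u0 x) \<and>
     (\<forall>t\<in>{0..T}. u t 0 = a t) \<and>
     (\<forall>t\<in>{0..T}.
        let U = (\<lambda>x. LINT s|lebesgue_on {0..t}. u s x) in
        \<exists>V W. weak_derivative 0 L U V \<and> weak_derivative 0 L V W \<and> V \<in> H1 0 L \<and>
          V L = (LINT s|lebesgue_on {0..t}. b s) \<and>
          (AE x in lebesgue_on {0..L}.
             u t x - u0 x - (of_real \<nu> + \<i> * of_real \<alpha>) * W x - of_real \<gamma> * U x =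
             (LINT s|lebesgue_on {0..t}. F s x)))"

definition CGL_solution ::
    "real \<Rightarrow> real \<Rightarrow> real \<Rightarrow> real \<Rightarrow> real \<Rightarrow> real \<Rightarrow> real \<Rightarrow>
     (real \<Rightarrow> complex) \<Rightarrow> (real \<Rightarrow> complex) \<Rightarrow> (real \<Rightarrow> complex) \<Rightarrow>
     real \<Rightarrow> (real \<Rightarrow> real \<Rightarrow> complex) \<Rightarrow> bool" where
  "CGL_solution L \<nu> \<alpha> \<kappa> \<beta> \<gamma> p u0 a b T u \<longleftrightarrow>
     linear_mild_solution L \<nu> \<alpha> \<gamma> u0 a b
       (\<lambda>t x. - (of_real \<kappa> + \<i> * of_real \<beta>) * of_real (cmod (u t x) powr p) * u t x) T u"

end

theory Submission
  imports Defs "HOL-Real_Asymp.Real_Asymp"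
begin

text \<open>
  It suffices to extend a solution from \<open>[0,T]\<close> to \<open>[0,T+1]\<close>, and since mild solutions can be
  concatenated, to solve the problem on a unit time interval from \<open>H\<^sup>1\<close> initial data and boundary
  data that are Hoelder continuous of exponent \<open>1/2\<close>. Write \<open>u = z + q\<close>, where \<open>z\<close> carries the
  initial and boundary data and \<open>q\<close> vanishes initially and satisfies the homogeneous boundary
  conditions, and expand in the sine functions of frequencies \<open>(n + 1/2)\<pi>/L\<close>: the equation becomes a
  family of scalar equations with rates \<open>(\<nu> + i\<alpha>)\<mu>\<^sub>n\<close>. Truncating the factor \<open>|u|\<^sup>p\<close> at a level \<open>r\<close>
  makes the nonlinearity globally Lipschitz, and Picard iteration converges on the whole unit interval.

  The truncation is removed by a bound independent of \<open>r\<close>. Testing with \<open>q\<close>, the damping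
  controls the coupling with the bounded function \<open>z\<close>, which bounds \<open>q\<close> in \<open>L\<^sup>\<infinity>L\<^sup>2\<close> and in
  \<open>L\<^sup>2H\<^sup>1\<close>. Parabolic smoothing bounds \<open>q\<close> in \<open>L\<^sup>\<infinity>H\<^sup>1\<close> by the space-time \<open>L\<^sup>2\<close> norm of the
  nonlinearity, hence, as \<open>p \<le> 2\<close>, by that of \<open>1 + |q|\<^sup>3\<close>, and by Agmon's inequality
  \<open>\<integral>|q|\<^sup>6 \<le> C \<parallel>q\<parallel>\<^sup>4 \<parallel>q\<^sub>x\<parallel>\<^sup>2\<close> is integrable in time.
\<close>

section \<open>Smooth cutoff functions\<close>

text \<open>No uniqueness theorem or blow-up criterion is involved: the given solution is restarted
  at \<open>u T\<close>, and the new one lives for a time 1 that does not depend on the data, so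
  finitely many restarts reach any time. The obstacle is low regularity: the time derivative of the
  lift would contain a' and b', so neither u nor the lift is tested against itself. Only the Duhamel
  part q is, and coefficient by coefficient: each mode is differentiable in time and satisfies a
  scalar identity, and these identities are summed afterwards by uniform convergence. The boundary
  data enter through a Duhamel integral of a', which integration by parts rewrites in terms of
  \<open>a\<close> alone; the Hoelder exponent 1/2 is just what makes \<open>mu n\<close> times the
  squared boundary layer bounded uniformly in n. The truncation acts on the modulus only and keeps
  the sign of the damping, so the bound can be fixed first and the level r chosen above it, where
  the truncated and the original equation coincide.\<close>

definition smooth_fn :: "(real \<Rightarrow> real) \<Rightarrow> bool" where
  "smooth_fn f \<longleftrightarrow> (\<forall>k x. (deriv ^^ k) f differentiable (at x))"

text \<open>By induction every iterated derivative stays in a class that is closed under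
  differentiation. Exhibiting such a class replaces formulas for the k-th derivative in all
  smoothness proofs below.\<close>

lemma smooth_fn_coinduct:
  assumes "P f" and step: "\<And>g. P g \<Longrightarrow> \<exists>g'. (\<forall>x. (g has_real_derivative g' x) (at x)) \<and> P g'"
  shows "smooth_fn f"
proof -
  have step': "P (deriv g)" "g differentiable (at x)" if g: "P g" for g x
  proof -
    obtain g' where g': "\<And>x. (g has_real_derivative g' x) (at x)" "P g'" using step[OF g] by auto
    have "deriv g = g'" using g'(1) by (auto intro: DERIV_imp_deriv)
    then show "P (deriv g)" using g'(2) by simp
    show "g differentiable (at x)" using g'(1) real_differentiable_def by blast
  qed
  have "P ((deriv ^^ k) f)" for k
    by (induction k) (auto simp: assms(1) step'(1))
  then show ?thesis unfolding smooth_fn_def using step'(2) by blast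
qed

lemma smooth_fn_deriv: "smooth_fn f \<Longrightarrow> smooth_fn (deriv f)"
  unfolding smooth_fn_def by (metis comp_apply funpow_Suc_right)

lemma smooth_fn_DERIV: "smooth_fn f \<Longrightarrow> (f has_real_derivative deriv f x) (at x)"
  unfolding smooth_fn_def
  by (metis DERIV_imp_deriv funpow_0 real_differentiable_def)

lemma smooth_fn_primitive:
  assumes "\<And>x. (f has_real_derivative g x) (at x)" "smooth_fn g"
  shows "smooth_fn f"
proof (rule smooth_fn_coinduct[where P="\<lambda>h. h = f \<or> smooth_fn h"])
  fix h assume "h = f \<or> smooth_fn h"
  then show "\<exists>g'. (\<forall>x. (h has_real_derivative g' x) (at x)) \<and> (g' = f \<or> smooth_fn g')"
    using assms smooth_fn_DERIV smooth_fn_deriv by blast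
qed simp

lemma smooth_fn_affine:
  assumes "smooth_fn f"
  shows "smooth_fn (\<lambda>x. s * f (r * x + q))"
\<comment> \<open>The factor \<open>s\<close> is part of the class because the chain rule turns it
  into \<open>s * r\<close>.\<close>
proof (rule smooth_fn_coinduct[where P="\<lambda>h. \<exists>s g. smooth_fn g \<and> h = (\<lambda>x. s * g (r * x + q))"])
  fix h assume "\<exists>s g. smooth_fn g \<and> h = (\<lambda>x. s * g (r * x + q))"
  then obtain s g where g: "smooth_fn g" "h = (\<lambda>x. s * g (r * x + q))" by blast
  have "(h has_real_derivative (s * r) * deriv g (r * x + q)) (at x)" for x
    unfolding g(2)
    by (rule derivative_eq_intros DERIV_chain2[OF smooth_fn_DERIV[OF g(1)]] | simp)+
  then show "\<exists>g'. (\<forall>x. (h has_real_derivative g' x) (at x)) \<and> (\<exists>s g. smooth_fn g \<and> g' = (\<lambda>x. s * g (r * x + q)))"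
    using smooth_fn_deriv[OF g(1)] by (intro exI[of _ "\<lambda>x. (s * r) * deriv g (r * x + q)"]) blast
qed (use assms in blast)

lemma smooth_fn_diff:
  assumes "smooth_fn f" "smooth_fn g"
  shows "smooth_fn (\<lambda>x. f x - g x)"
proof (rule smooth_fn_coinduct[where P="\<lambda>h. \<exists>f g. smooth_fn f \<and> smooth_fn g \<and> h = (\<lambda>x. f x - g x)"])
  fix h :: "real \<Rightarrow> real" assume "\<exists>f g. smooth_fn f \<and> smooth_fn g \<and> h = (\<lambda>x. f x - g x)"
  then obtain f g where g: "smooth_fn f" "smooth_fn g" "h = (\<lambda>x. f x - g x)" by blast
  have "(h has_real_derivative deriv f x - deriv g x) (at x)" for x
    unfolding g(3) by (intro derivative_intros smooth_fn_DERIV g)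
  then show "\<exists>g'. (\<forall>x. (h has_real_derivative g' x) (at x)) \<and> (\<exists>f g. smooth_fn f \<and> smooth_fn g \<and> g' = (\<lambda>x. f x - g x))"
    using smooth_fn_deriv g by (intro exI[of _ "\<lambda>x. deriv f x - deriv g x"]) blast
qed (use assms in blast)

lemma smooth_fn_zero: "smooth_fn (\<lambda>x. 0)"
  by (rule smooth_fn_coinduct[where P="\<lambda>h. h = (\<lambda>x. 0)"]) (auto intro: exI[of _ "\<lambda>x. 0"])

lemma smooth_fn_add: 
  assumes "smooth_fn f" "smooth_fn g"
  shows "smooth_fn (\<lambda>x. f x + g x)"
proof -
  have "smooth_fn (\<lambda>x. (-1) * g (1 * x + 0))" by (intro smooth_fn_affine assms)
  from smooth_fn_diff[OF assms(1) this] show ?thesis by simp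
qed

text \<open>Needed for a cutoff times a cosine, the test function of \<open>weak_ibp_cos\<close>.
  Multiples of the cosine alone are not closed under differentiation; combinations with the sine
  are.\<close>

lemma smooth_fn_mult_trig:
  assumes "smooth_fn f" "smooth_fn g"
  shows "smooth_fn (\<lambda>x. f x * cos (k * x) + g x * sin (k * x))"
proof (rule smooth_fn_coinduct[where
      P="\<lambda>h. \<exists>f g. smooth_fn f \<and> smooth_fn g \<and> h = (\<lambda>x. f x * cos (k * x) + g x * sin (k * x))"])
  fix h :: "real \<Rightarrow> real"
  assume "\<exists>f g. smooth_fn f \<and> smooth_fn g \<and> h = (\<lambda>x. f x * cos (k * x) + g x * sin (k * x))"
  then obtain f g where g: "smooth_fn f" "smooth_fn g" "h = (\<lambda>x. f x * cos (k * x) + g x * sin (k * x))"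
    by blast
  \<comment> \<open>The arguments \<open>1 * x + 0\<close> make these summands instances of
    \<open>smooth_fn_affine\<close>.\<close>
  let ?f = "\<lambda>x. deriv f x + k * g (1 * x + 0)" and ?g = "\<lambda>x. deriv g x - k * f (1 * x + 0)"
  have "(h has_real_derivative ?f x * cos (k * x) + ?g x * sin (k * x)) (at x)" for x
    unfolding g(3)
    by (rule derivative_eq_intros smooth_fn_DERIV g refl)+ (simp add: algebra_simps)
  moreover have "smooth_fn ?f" "smooth_fn ?g"
    by (intro smooth_fn_add smooth_fn_diff smooth_fn_deriv smooth_fn_affine g)+
  ultimately show "\<exists>g'. (\<forall>x. (h has_real_derivative g' x) (at x)) \<and>
     (\<exists>f g. smooth_fn f \<and> smooth_fn g \<and> g' = (\<lambda>x. f x * cos (k * x) + g x * sin (k * x)))"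
    by (intro exI[of _ "\<lambda>x. ?f x * cos (k * x) + ?g x * sin (k * x)"]) blast
qed (use assms in blast)

text \<open>With w = (x - 1) * (2 - x), these functions form a class that contains the bump exp
  (-1/w) and is closed under differentiation, as \<open>smooth_fn_coinduct\<close> demands.\<close>

definition bump_part :: "real poly \<Rightarrow> nat \<Rightarrow> real \<Rightarrow> real" where
  "bump_part q n x = (if 1 < x \<and> x < 2 
     then poly q x / ((x - 1) * (2 - x)) ^ n * exp (- 1 / ((x - 1) * (2 - x))) else 0)"

text \<open>Inside the interval this is the quotient rule. At its endpoints and outside, the
  exponential beats every power of w, so the function is quadratically small near such a point and
  the derivative is 0.\<close>

lemma bump_part_DERIV:
  "\<exists>q'. \<forall>x. (bump_part q n has_real_derivative bump_part q' (n + 2) x) (at x)"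
proof -
  define W :: "real poly" where "W = [:-2, 3, -1:]"
  \<comment> \<open>The numerator over \<open>W ^ (n + 2)\<close>: its three terms differentiate
    \<open>q\<close>, the power \<open>W ^ n\<close> in the denominator, and the exponent -1/W,
    whose derivative is W'/W^2.\<close>
  define q' where "q' = pderiv q * W\<^sup>2 - smult (real n) (q * pderiv W * W) + q * pderiv W"
  have W: "poly W x = (x - 1) * (2 - x)" for x by (simp add: W_def algebra_simps)
  have "(bump_part q n has_real_derivative bump_part q' (n + 2) x) (at x)" for x
  proof (cases "1 < x \<and> x < 2")
    case True
    let ?h = "\<lambda>x. poly q x / (poly W x) ^ n * exp (- 1 / poly W x)"
    have Wp: "poly W x > 0" using True by (simp add: W)
    have "(?h has_real_derivative 
        ((poly (pderiv q) x * poly W x ^ n - poly q x * (real n * (poly W x ^ (n - 1) * poly (pderiv W) x))) 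
           / (poly W x ^ n * poly W x ^ n)) * exp (- 1 / poly W x)
        + exp (- 1 / poly W x) * (poly (pderiv W) x / (poly W x * poly W x)) * (poly q x / (poly W x) ^ n)) (at x)"
      using Wp by (auto intro!: derivative_eq_intros simp: divide_simps) (simp add: algebra_simps)
    also have "((poly (pderiv q) x * poly W x ^ n - poly q x * (real n * (poly W x ^ (n - 1) * poly (pderiv W) x))) 
           / (poly W x ^ n * poly W x ^ n)) * exp (- 1 / poly W x)
        + exp (- 1 / poly W x) * (poly (pderiv W) x / (poly W x * poly W x)) * (poly q x / (poly W x) ^ n)
        = poly q' x / poly W x ^ (n + 2) * exp (- 1 / poly W x)"
    \<comment> \<open>The power rule produced \<open>n - 1\<close>, which is truncated at n =
      0.\<close>
    proof (cases n)
      case 0 then show ?thesis using Wp by (simp add: q'_def field_simps power2_eq_square)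
    next
      case (Suc m)
      then show ?thesis using Wp by (simp add: q'_def field_simps power2_eq_square)
    qed
    also have "\<dots> = bump_part q' (n + 2) x" using True by (simp add: bump_part_def W)
    finally have "(?h has_real_derivative bump_part q' (n + 2) x) (at x)" .
    then show ?thesis
      by (rule has_field_derivative_transform_within_open[where S="{1<..<2}"])
        (use True in \<open>auto simp: bump_part_def W\<close>)
  next
    case False
    obtain B where B': "\<forall>y\<in>{1..2}. \<bar>poly q y\<bar> \<le> B"
      using compact_imp_bounded[OF compact_continuous_image[of "{1..2}" "poly q"]]
      by (auto simp: bounded_iff poly_isCont continuous_at_imp_continuous_on)
    then have B: "\<bar>poly q y\<bar> \<le> B" if "y \<in> {1..2}" for y using that by blast
    have "B \<ge> 0" using B[of 1] by auto
    \<comment> \<open>The power m = n + 2 in the bound on the exponential cancels the pole of order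
      n and leaves a square.\<close>
    define C where "C = B * fact (n + 2)"
    have bd: "\<bar>bump_part q n y\<bar> \<le> C * (y - x)\<^sup>2" for y
    proof (cases "1 < y \<and> y < 2")
      case y: True
      define w where "w = (y - 1) * (2 - y)"
      have w: "w > 0" using y by (simp add: w_def)
      \<comment> \<open>As \<open>x\<close> lies outside (1,2), one factor of \<open>w\<close> is at
        most the distance of \<open>y\<close> from \<open>x\<close>, and the other is at most
        1.\<close>
      have wx: "w \<le> \<bar>y - x\<bar>"
      proof (cases "x \<le> 1")
        case True
        have "w \<le> (y - 1) * 1" unfolding w_def using y by (intro mult_left_mono) auto
        then show ?thesis using True y by simp
      next
        case Fx: False
        then have "x \<ge> 2" using False by simp
        have "w \<le> 1 * (2 - y)" unfolding w_def using y by (intro mult_right_mono) auto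
        then show ?thesis using \<open>x \<ge> 2\<close> y by simp
      qed
      \<comment> \<open>A single term of the exponential series of 1/w is a lower bound for exp
        (1/w).\<close>
      have ex: "exp (- 1 / w) \<le> fact m * w ^ m" for m
      proof -
        have "(\<Sum>k\<in>{m}. (1 / w) ^ k /\<^sub>R fact k) \<le> (\<Sum>k. (1 / w) ^ k /\<^sub>R fact k)"
          by (rule sum_le_suminf) (use w summable_exp_generic[of "1/w"] in auto)
        then have "(1 / w) ^ m / fact m \<le> exp (1 / w)" by (simp add: exp_def divide_inverse mult.commute)
        then have "1 \<le> fact m * w ^ m * exp (1 / w)" using w by (simp add: field_simps)
        then show ?thesis using w by (simp add: exp_minus divide_simps)
      qed
      have "\<bar>poly q y\<bar> / w ^ n * exp (- 1 / w) \<le> B / w ^ n * (fact (n + 2) * w ^ (n + 2))"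
        using B[of y] y w \<open>B \<ge> 0\<close> ex[of "n + 2"] by (intro mult_mono divide_right_mono) auto
      also have "\<dots> = C * w\<^sup>2" using w by (simp add: C_def power_add power2_eq_square field_simps)
      also have "\<dots> \<le> C * (y - x)\<^sup>2"
        using wx w \<open>B \<ge> 0\<close> abs_le_square_iff[of w "y - x"] by (intro mult_left_mono) (auto simp: C_def)
      finally show ?thesis using y w
        by (simp add: bump_part_def abs_mult flip: w_def)
    qed (use \<open>B \<ge> 0\<close> in \<open>auto simp: bump_part_def C_def\<close>)
    have "((\<lambda>y. (bump_part q n y - bump_part q n x) / (y - x)) \<longlongrightarrow> 0) (at x)"
    proof (rule Lim_null_comparison)
      show "\<forall>\<^sub>F y in at x. norm ((bump_part q n y - bump_part q n x) / (y - x)) \<le> C * \<bar>y - x\<bar>"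
      proof (rule eventually_at_filter[THEN iffD2], rule always_eventually, intro allI impI)
        fix y assume "y \<noteq> x"
        have "bump_part q n x = 0" using False by (auto simp: bump_part_def)
        then show "norm ((bump_part q n y - bump_part q n x) / (y - x)) \<le> C * \<bar>y - x\<bar>"
          using bd[of y] \<open>y \<noteq> x\<close> by (simp add: abs_divide divide_le_eq power2_eq_square mult.assoc)
      qed
      have "((\<lambda>y. C * \<bar>y - x\<bar>) \<longlongrightarrow> C * \<bar>x - x\<bar>) (at x)" by (intro tendsto_intros)
      then show "((\<lambda>y. C * \<bar>y - x\<bar>) \<longlongrightarrow> 0) (at x)" by simp
    qed
    moreover have "bump_part q' (n + 2) x = 0" using False by (auto simp: bump_part_def)
    ultimately show ?thesis by (simp add: has_field_derivative_iff)
  qed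
  then show ?thesis by blast
qed

lemma smooth_bump_part: "smooth_fn (bump_part q n)"
proof (rule smooth_fn_coinduct[where P="\<lambda>h. \<exists>q n. h = bump_part q n"])
  fix g assume "\<exists>q n. g = bump_part q n"
  then show "\<exists>g'. (\<forall>x. (g has_real_derivative g' x) (at x)) \<and> (\<exists>q n. g' = bump_part q n)"
    using bump_part_DERIV by metis
qed blast

lemma smooth_fn_continuous_on: "smooth_fn f \<Longrightarrow> continuous_on S f"
  by (meson DERIV_isCont continuous_at_imp_continuous_on smooth_fn_DERIV)

text \<open>\<open>\<theta>\<close> is the normalised primitive of the bump. Its derivative
  \<open>\<rho>\<close> is nonnegative, has total mass one and lives in (1,2), so its rescalings are
  approximate identities.\<close>

lemma smooth_step_exists:
  obtains \<theta> \<rho> :: "real \<Rightarrow> real" where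
    "smooth_fn \<theta>" "\<And>x. (\<theta> has_real_derivative \<rho> x) (at x)" "\<And>x. \<rho> x \<ge> 0"
    "\<And>x. x \<le> 1 \<Longrightarrow> \<theta> x = 0" "\<And>x. x \<ge> 2 \<Longrightarrow> \<theta> x = 1" "\<And>x. 0 \<le> \<theta> x \<and> \<theta> x \<le> 1"
    "\<And>x. \<rho> x \<noteq> 0 \<Longrightarrow> 1 < x \<and> x < 2" "continuous_on UNIV \<rho>"
proof -
  define r where "r = bump_part 1 0"
  have sr: "smooth_fn r" by (simp add: r_def smooth_bump_part)
  have rc: "continuous_on S r" for S using sr by (rule smooth_fn_continuous_on)
  have rpos: "r x > 0" if "1 < x" "x < 2" for x using that by (simp add: r_def bump_part_def)
  have r0: "r x = 0" if "\<not> (1 < x \<and> x < 2)" for x using that by (auto simp: r_def bump_part_def)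
  have rge: "r x \<ge> 0" for x using rpos[of x] r0[of x] by force
  \<comment> \<open>For negative \<open>x\<close> the interval is empty and the integral is 0, in
    accordance with \<open>r\<close> vanishing up to 1.\<close>
  define R where "R x = integral {0..x} r" for x
  have R0: "R x = 0" if "x \<le> 1" for x
  proof -
    have "integral {0..x} r = integral {0..x} (\<lambda>x. 0)"
      by (rule integral_cong) (use that r0 in auto)
    then show ?thesis by (simp add: R_def)
  qed
  have RD: "(R has_real_derivative r x) (at x)" for x
  proof (cases "x < 1")
    case True
    have "((\<lambda>x. 0) has_real_derivative r x) (at x)" using True r0[of x] by simp
    then show ?thesis
      by (rule has_field_derivative_transform_within_open[where S="{..<1}"]) (use True R0 in auto)
  next
    case False
    have "(R has_real_derivative r x) (at x within {0..x+1})"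
      unfolding R_def[abs_def] using False by (intro integral_has_real_derivative rc) auto
    then show ?thesis using False at_within_Icc_at[of 0 x "x+1"] by simp
  qed
  have R2: "R x = R 2" if "x \<ge> 2" for x
  proof (cases "x = 2")
    case False
    then have "2 < x" using that by simp
    then obtain z where "z > 2" "z < x" "R x - R 2 = (x - 2) * r z"
      using MVT2[of 2 x R r] RD by auto
    then show ?thesis using r0[of z] by simp
  qed auto
  have mono: "R x \<le> R y" if "x \<le> y" for x y
    by (rule DERIV_nonneg_imp_nondecreasing[OF that]) (use RD rge in blast)
  have "R 2 > 0"
  proof -
    have "R (5/4) < R (7/4)"
      by (rule DERIV_pos_imp_increasing_open[of _ _ R]) (use RD rpos in \<open>force intro: DERIV_isCont continuous_at_imp_continuous_on\<close>)+
    moreover have "R (5/4) \<ge> 0" using mono[of 1 "5/4"] R0[of 1] by simp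
    moreover have "R (7/4) \<le> R 2" by (intro mono) simp
    ultimately show ?thesis by simp
  qed
  define \<theta> where "\<theta> = (\<lambda>x. R x / R 2)"
  define \<rho> where "\<rho> = (\<lambda>x. r x / R 2)"
  have D: "(\<theta> has_real_derivative \<rho> x) (at x)" for x
    unfolding \<theta>_def \<rho>_def by (intro DERIV_cdivide RD)
  have "smooth_fn \<rho>" using smooth_fn_affine[OF sr, of "1/R 2" 1 0] by (simp add: \<rho>_def)
  have Rb: "0 \<le> R x \<and> R x \<le> R 2" for x
    using mono[of 1 x] R0[of x] R0[of 1] mono[of x 2] R2[of x] \<open>R 2 > 0\<close> by (cases "x \<le> 1"; cases "x \<le> 2") auto
  show thesis
  proof (rule that[of \<theta> \<rho>])
    show "smooth_fn \<theta>" by (rule smooth_fn_primitive[OF D \<open>smooth_fn \<rho>\<close>])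
    show "continuous_on UNIV \<rho>" by (rule smooth_fn_continuous_on[OF \<open>smooth_fn \<rho>\<close>])
    show "1 < x \<and> x < 2" if "\<rho> x \<noteq> 0" for x using r0[of x] that by (auto simp: \<rho>_def)
    show "\<theta> x = 1" if "x \<ge> 2" for x using R2[OF that] \<open>R 2 > 0\<close> by (simp add: \<theta>_def)
    show "\<theta> x = 0" if "x \<le> 1" for x using R0[OF that] by (simp add: \<theta>_def)
    show "0 \<le> \<theta> x \<and> \<theta> x \<le> 1" for x 
      using Rb[of x] \<open>R 2 > 0\<close> by (simp add: \<theta>_def)
    show "\<rho> x \<ge> 0" for x using rge[of x] \<open>R 2 > 0\<close> by (simp add: \<rho>_def)
  qed (rule D)
qed

section \<open>Weak derivatives\<close>

lemma norm_add_sq_le: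
  fixes a b :: "'a::real_normed_vector"
  shows "(norm (a + b))\<^sup>2 \<le> 2 * (norm a)\<^sup>2 + 2 * (norm b)\<^sup>2"
proof -
  have "(norm (a + b))\<^sup>2 \<le> (norm a + norm b)\<^sup>2" by (intro power_mono norm_triangle_ineq) auto
  also have "\<dots> \<le> 2 * (norm a)\<^sup>2 + 2 * (norm b)\<^sup>2"
    using zero_le_power2[of "norm a - norm b"] by (simp add: power2_diff power2_sum)
  finally show ?thesis .
qed

lemma norm_diff_sq_le:
  fixes a b :: "'a::real_normed_vector"
  shows "(norm (a - b))\<^sup>2 \<le> 2 * (norm a)\<^sup>2 + 2 * (norm b)\<^sup>2"
  using norm_add_sq_le[of a "- b"] by simp

lemma integral_add_continuous:
  fixes f g :: "real \<Rightarrow> 'a::banach"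
  assumes "continuous_on {a..b} f" "continuous_on {a..b} g"
  shows "integral {a..b} (\<lambda>x. f x + g x) = integral {a..b} f + integral {a..b} g"
  by (intro Henstock_Kurzweil_Integration.integral_add integrable_continuous_real assms)

lemma integral_diff_continuous:
  fixes f g :: "real \<Rightarrow> 'a::banach"
  assumes "continuous_on {a..b} f" "continuous_on {a..b} g"
  shows "integral {a..b} (\<lambda>x. f x - g x) = integral {a..b} f - integral {a..b} g"
  by (intro Henstock_Kurzweil_Integration.integral_diff integrable_continuous_real assms)

lemma lint_continuous:
  fixes f :: "real \<Rightarrow> 'a::euclidean_space"
  assumes "continuous_on {a..b} f"
  shows "(LINT x|lebesgue_on {a..b}. f x) = integral {a..b} f"
  using assms by (simp add: lebesgue_integral_eq_integral continuous_imp_integrable_real)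

lemma approx_identity:
  fixes F :: "real \<Rightarrow> complex" and h :: "nat \<Rightarrow> real \<Rightarrow> real"
  assumes F: "continuous_on {c..d} F" and x0: "x0 \<in> {c..d}"
    and h: "\<forall>\<^sub>F j in sequentially. continuous_on {c..d} (h j) \<and> integral {c..d} (h j) = 1 \<and>
         (\<forall>x\<in>{c..d}. h j x \<ge> 0 \<and> (h j x \<noteq> 0 \<longrightarrow> \<bar>x - x0\<bar> \<le> 2 / real j))"
  shows "(\<lambda>j. integral {c..d} (\<lambda>x. h j x *\<^sub>R F x)) \<longlonglongrightarrow> F x0"
proof (rule tendstoI)
  fix e :: real assume "e > 0"
  then obtain \<delta> where \<delta>: "\<delta> > 0" "\<And>x. x \<in> {c..d} \<Longrightarrow> dist x x0 < \<delta> \<Longrightarrow> dist (F x) (F x0) < e / 2"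
    using F x0 unfolding continuous_on_iff by (meson half_gt_zero)
  have "(\<lambda>j. 2 / real j) \<longlonglongrightarrow> 0" by real_asymp
  then have "\<forall>\<^sub>F j in sequentially. 2 / real j < \<delta>" using \<delta>(1) by (rule order_tendstoD)
  with h show "\<forall>\<^sub>F j in sequentially. dist (integral {c..d} (\<lambda>x. h j x *\<^sub>R F x)) (F x0) < e"
  proof eventually_elim
    case (elim j)
    then have hc: "continuous_on {c..d} (h j)" and h1: "integral {c..d} (h j) = 1"
      and hs: "\<And>x. x \<in> {c..d} \<Longrightarrow> h j x \<ge> 0" "\<And>x. x \<in> {c..d} \<Longrightarrow> h j x \<noteq> 0 \<Longrightarrow> \<bar>x - x0\<bar> \<le> 2 / real j"
      by auto
    have "integral {c..d} (\<lambda>x. h j x *\<^sub>R F x) - F x0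
        = integral {c..d} (\<lambda>x. h j x *\<^sub>R F x) - integral {c..d} (\<lambda>x. h j x *\<^sub>R F x0)"
      using integral_unique[OF has_integral_scaleR_left[OF integrable_integral[OF integrable_continuous_real[OF hc]], of "F x0"]] h1
      by simp
    also have "\<dots> = integral {c..d} (\<lambda>x. h j x *\<^sub>R F x - h j x *\<^sub>R F x0)"
      by (intro integral_diff[symmetric] integrable_continuous_real continuous_intros hc F)
    also have "norm \<dots> \<le> integral {c..d} (\<lambda>x. h j x * (e / 2))"
    proof (rule integral_norm_bound_integral)
      show "(\<lambda>x. h j x *\<^sub>R F x - h j x *\<^sub>R F x0) integrable_on {c..d}"
        "(\<lambda>x. h j x * (e / 2)) integrable_on {c..d}"
        by (intro integrable_continuous_real continuous_intros hc F)+
      fix x assume x: "x \<in> {c..d}"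
      show "norm (h j x *\<^sub>R F x - h j x *\<^sub>R F x0) \<le> h j x * (e / 2)"
      proof (cases "h j x = 0")
        case False
        then have "norm (F x - F x0) \<le> e / 2" using hs(2)[OF x] elim \<delta>(2)[OF x] by (simp add: dist_real_def dist_norm)
        from mult_left_mono[OF this hs(1)[OF x]] show ?thesis using hs(1)[OF x]
          by (simp add: scaleR_diff_right[symmetric])
      qed simp
    qed
    also have "\<dots> = e / 2" using h1 by simp
    finally show ?case using \<open>e > 0\<close> by (simp add: dist_norm)
  qed
qed

section \<open>Square integrability on bounded intervals\<close>

lemma square_integrable_imp_integrable:
  assumes "square_integrable c d f"
  shows "integrable (lebesgue_on {c..d}) f"
proof (rule Bochner_Integration.integrable_bound)
  show "integrable (lebesgue_on {c..d}) (\<lambda>x. 1 + (cmod (f x))\<^sup>2)"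
    using assms continuous_imp_integrable_real[of c d "\<lambda>x. 1::real"] 
    unfolding square_integrable_def by (intro Bochner_Integration.integrable_add) auto
  show "AE x in lebesgue_on {c..d}. norm (f x) \<le> norm (1 + (cmod (f x))\<^sup>2)"
  proof (rule AE_I2)
    fix x
    have "0 \<le> (cmod (f x) - 1)\<^sup>2" by simp
    then have "2 * cmod (f x) \<le> 1 + (cmod (f x))\<^sup>2" by (simp add: power2_diff)
    then have "cmod (f x) \<le> 1 + (cmod (f x))\<^sup>2" using norm_ge_zero[of "f x"] by linarith
    then show "norm (f x) \<le> norm (1 + (cmod (f x))\<^sup>2)" by simp
  qed
qed (use assms in \<open>auto simp: square_integrable_def\<close>)

lemma square_integrable_continuous:
  assumes "continuous_on {c..d} f"
  shows "square_integrable c d f"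
  unfolding square_integrable_def
  using assms by (auto intro!: continuous_imp_integrable_real continuous_intros 
      continuous_imp_measurable_on_sets_lebesgue)

lemma integrable_bounded_scaleR:
  fixes g :: "real \<Rightarrow> complex" and \<phi> :: "real \<Rightarrow> real"
  assumes "integrable (lebesgue_on {c..d}) g" "continuous_on {c..d} \<phi>" 
  shows "integrable (lebesgue_on {c..d}) (\<lambda>x. \<phi> x *\<^sub>R g x)"
proof -
  obtain B where B: "\<forall>x\<in>{c..d}. \<bar>\<phi> x\<bar> \<le> B"
    using compact_imp_bounded[OF compact_continuous_image[OF assms(2)]] by (auto simp: bounded_iff)
  show ?thesis
  proof (rule Bochner_Integration.integrable_bound)
    show "integrable (lebesgue_on {c..d}) (\<lambda>x. B * norm (g x))" using assms(1) by auto
    show "AE x in lebesgue_on {c..d}. norm (\<phi> x *\<^sub>R g x) \<le> norm (B * norm (g x))"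
    proof (rule AE_I2)
      fix x assume "x \<in> space (lebesgue_on {c..d})"
      then have "\<bar>\<phi> x\<bar> \<le> B" "0 \<le> B" using B by (auto intro: order_trans[of 0 "\<bar>\<phi> x\<bar>" B])
      then show "norm (\<phi> x *\<^sub>R g x) \<le> norm (B * norm (g x))"
        by (simp add: abs_mult mult_right_mono)
    qed
    show "(\<lambda>x. \<phi> x *\<^sub>R g x) \<in> borel_measurable (lebesgue_on {c..d})"
      using borel_measurable_integrable[OF assms(1)] continuous_imp_measurable_on_sets_lebesgue[OF assms(2)]
      by (intro borel_measurable_scaleR) auto
  qed
qed

lemma test_function_smooth: "test_function c d \<phi> \<Longrightarrow> smooth_fn \<phi>"
  by (simp add: test_function_def smooth_fn_def)

lemma AE_neq_lebesgue_on: "AE x in lebesgue_on S. x \<noteq> (c::real)" if "S \<in> sets lebesgue"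
proof -
  have "AE x in lebesgue. x \<noteq> c"
    by (rule AE_not_in[of "{c}", simplified]) (simp add: null_sets_def)
  then show ?thesis using that by (auto simp: AE_restrict_space_iff elim: eventually_mono)
qed

lemma eventually_ge_real_mult:
  fixes C q :: real
  assumes "q > 0"
  shows "\<forall>\<^sub>F j in sequentially. C \<le> real j * q"
proof -
  have "filterlim (\<lambda>j. real j * q) at_top sequentially" using assms by real_asymp
  then show ?thesis by (simp add: filterlim_at_top)
qed

text \<open>The cosine times a cutoff is a test function. The derivative of the cutoff consists of
  two kernels of mass one at the endpoints, which yield the boundary terms in the limit; the other
  integrals converge by dominated convergence. Frequency 0 gives the fundamental theorem of
  calculus, the frequencies \<open>freq n\<close> give the coefficients of a weak
  derivative.\<close>

lemma weak_ibp_cos: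
  assumes w: "weak_derivative c d f g" and cd: "c < d" and f: "continuous_on {c..d} f"
  shows "(LINT x|lebesgue_on {c..d}. cos (k * x) *\<^sub>R g x) =
     cos (k * d) *\<^sub>R f d - cos (k * c) *\<^sub>R f c + (LINT x|lebesgue_on {c..d}. (k * sin (k * x)) *\<^sub>R f x)"
proof -
  obtain \<theta> \<rho> :: "real \<Rightarrow> real" where
    \<theta>: "smooth_fn \<theta>" "\<And>x. (\<theta> has_real_derivative \<rho> x) (at x)" "\<And>x. \<rho> x \<ge> 0"
    "\<And>x. x \<le> 1 \<Longrightarrow> \<theta> x = 0" "\<And>x. x \<ge> 2 \<Longrightarrow> \<theta> x = 1" "\<And>x. 0 \<le> \<theta> x \<and> \<theta> x \<le> 1"
    "\<And>x. \<rho> x \<noteq> 0 \<Longrightarrow> 1 < x \<and> x < 2" "continuous_on UNIV \<rho>"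
    by (rule smooth_step_exists) blast
  have \<rho>c [continuous_intros]: "continuous_on S (\<lambda>x. \<rho> (h x))" if "continuous_on S h" for S and h :: "real \<Rightarrow> real"
    using continuous_on_compose2[OF \<theta>(8) that] by auto
  \<comment> \<open>Rises from 0 to 1 on [c + 1/j, c + 2/j] and falls back on [d - 2/j, d - 1/j];
    the 3 places the second ramp. The factors 1 and the summed form fit
    \<open>smooth_fn_affine\<close>.\<close>
  define ch where "ch j x = 1 * \<theta> (real j * x + (- real j * c)) - 1 * \<theta> (real j * x + (3 - real j * d))" for j :: nat and x
  define r1 where "r1 j x = real j * \<rho> (real j * x + (- real j * c))" for j :: nat and x
  define r2 where "r2 j x = real j * \<rho> (real j * x + (3 - real j * d))" for j :: nat and x
  have chs: "smooth_fn (ch j)" for j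
    unfolding ch_def[abs_def] by (intro smooth_fn_diff smooth_fn_affine \<theta>)
  have chD: "(ch j has_real_derivative r1 j x - r2 j x) (at x)" for j x
    unfolding ch_def[abs_def] r1_def r2_def
    by (rule derivative_eq_intros DERIV_chain2[OF \<theta>(2)] | simp)+
  have chb: "\<bar>ch j x\<bar> \<le> 1" for j x
    using \<theta>(6)[of "real j * x + (- real j * c)"] \<theta>(6)[of "real j * x + (3 - real j * d)"] unfolding ch_def by linarith
  have chc: "continuous_on S (ch j)" for j S using smooth_fn_continuous_on[OF chs] .
  have r1c: "continuous_on S (r1 j)" and r2c: "continuous_on S (r2 j)" for j S
    unfolding r1_def[abs_def] r2_def[abs_def] by (intro continuous_intros)+
  define F where "F x = cos (k * x) *\<^sub>R f x" for x
  have Fc: "continuous_on {c..d} F" unfolding F_def by (intro continuous_intros f)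
  \<comment> \<open>From such \<open>j\<close> on the two ramps are disjoint.\<close>
  have big: "\<forall>\<^sub>F j in sequentially. 5 \<le> real j * (d - c)" using cd by (intro eventually_ge_real_mult) simp
  have I: "integral {c..d} (\<lambda>x. real j * \<rho> (real j * x + q)) = \<theta> (real j * d + q) - \<theta> (real j * c + q)" for j :: nat and q
  proof -
    have "((\<lambda>x. real j * \<rho> (real j * x + q)) has_integral \<theta> (real j * d + q) - \<theta> (real j * c + q)) {c..d}"
    proof (rule fundamental_theorem_of_calculus)
      show "((\<lambda>x. \<theta> (real j * x + q)) has_vector_derivative real j * \<rho> (real j * x + q)) (at x within {c..d})" for x
        unfolding has_real_derivative_iff_has_vector_derivative[symmetric]
        by (subst mult.commute, rule has_field_derivative_at_within, rule DERIV_chain2[OF \<theta>(2)])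
          (auto intro!: derivative_eq_intros)
    qed (use cd in simp)
    then show ?thesis by (rule integral_unique)
  qed
  have lim1: "(\<lambda>j. integral {c..d} (\<lambda>x. r1 j x *\<^sub>R F x)) \<longlonglongrightarrow> F c"
  proof (rule approx_identity[OF Fc])
    show "\<forall>\<^sub>F j in sequentially. continuous_on {c..d} (r1 j) \<and> integral {c..d} (r1 j) = 1 \<and>
         (\<forall>x\<in>{c..d}. r1 j x \<ge> 0 \<and> (r1 j x \<noteq> 0 \<longrightarrow> \<bar>x - c\<bar> \<le> 2 / real j))"
      using big
    proof eventually_elim
      case (elim j)
      then have j: "real j > 0" by (cases "j = 0") auto
      have "\<theta> (real j * d + (- real j * c)) = 1" "\<theta> (real j * c + (- real j * c)) = 0"
        using elim \<theta>(4)[of 0] by (auto intro!: \<theta>(5) simp: algebra_simps)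
      moreover have "\<bar>x - c\<bar> \<le> 2 / real j" if "r1 j x \<noteq> 0" "x \<in> {c..d}" for x
        using \<theta>(7)[of "real j * x + (- real j * c)"] that j by (auto simp: r1_def field_simps)
      ultimately show ?case using \<theta>(3) r1c I[of j "- real j * c"] j by (auto simp: r1_def[abs_def])
    qed
  qed (use cd in auto)
  have lim2: "(\<lambda>j. integral {c..d} (\<lambda>x. r2 j x *\<^sub>R F x)) \<longlonglongrightarrow> F d"
  proof (rule approx_identity[OF Fc])
    show "\<forall>\<^sub>F j in sequentially. continuous_on {c..d} (r2 j) \<and> integral {c..d} (r2 j) = 1 \<and>
         (\<forall>x\<in>{c..d}. r2 j x \<ge> 0 \<and> (r2 j x \<noteq> 0 \<longrightarrow> \<bar>x - d\<bar> \<le> 2 / real j))"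
      using big
    proof eventually_elim
      case (elim j)
      then have j: "real j > 0" by (cases "j = 0") auto
      have "\<theta> (real j * d + (3 - real j * d)) = 1" "\<theta> (real j * c + (3 - real j * d)) = 0"
        using elim by (auto intro!: \<theta>(4) \<theta>(5) simp: algebra_simps)
      moreover have "\<bar>x - d\<bar> \<le> 2 / real j" if "r2 j x \<noteq> 0" "x \<in> {c..d}" for x
        using \<theta>(7)[of "real j * x + (3 - real j * d)"] that j by (auto simp: r2_def field_simps)
      ultimately show ?case using \<theta>(3) r2c I[of j "3 - real j * d"] j by (auto simp: r2_def[abs_def])
    qed
  qed (use cd in auto)
  have pw: "(\<lambda>j. ch j x) \<longlonglongrightarrow> 1" if "c < x" "x < d" for x
  proof (rule tendsto_eventually)
    have "\<forall>\<^sub>F j in sequentially. 2 \<le> real j * (x - c)" "\<forall>\<^sub>F j in sequentially. 2 \<le> real j * (d - x)"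
      using that by (auto intro!: eventually_ge_real_mult)
    then show "\<forall>\<^sub>F j in sequentially. ch j x = 1"
    proof eventually_elim
      case (elim j)
      have "\<theta> (real j * x + (- real j * c)) = 1" "\<theta> (real j * x + (3 - real j * d)) = 0"
        using elim by (auto intro!: \<theta>(4) \<theta>(5) simp: algebra_simps)
      then show ?case by (simp add: ch_def)
    qed
  qed
  have dom: "(\<lambda>j. LINT x|lebesgue_on {c..d}. ch j x *\<^sub>R G x) \<longlonglongrightarrow> (LINT x|lebesgue_on {c..d}. G x)"
    if G: "integrable (lebesgue_on {c..d}) G" for G :: "real \<Rightarrow> complex"
  proof (rule integral_dominated_convergence)
    show "integrable (lebesgue_on {c..d}) (\<lambda>x. norm (G x))" using G by auto
    have "AE x in lebesgue_on {c..d}. x \<noteq> c" "AE x in lebesgue_on {c..d}. x \<noteq> d"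
      by (auto intro: AE_neq_lebesgue_on)
    then show "AE x in lebesgue_on {c..d}. (\<lambda>j. ch j x *\<^sub>R G x) \<longlonglongrightarrow> G x"
    proof (rule AE_mp[OF AE_conjI], intro AE_I2 impI)
      fix x assume "x \<in> space (lebesgue_on {c..d})" "x \<noteq> c \<and> x \<noteq> d"
      then have "(\<lambda>j. ch j x) \<longlonglongrightarrow> 1" by (intro pw) auto
      then have "(\<lambda>j. ch j x *\<^sub>R G x) \<longlonglongrightarrow> 1 *\<^sub>R G x" by (intro tendsto_intros)
      then show "(\<lambda>j. ch j x *\<^sub>R G x) \<longlonglongrightarrow> G x" by simp
    qed
    show "AE x in lebesgue_on {c..d}. norm (ch j x *\<^sub>R G x) \<le> norm (G x)" for j
      using chb[of j] by (auto intro!: AE_I2 simp: mult_left_le_one_le)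
    show "(\<lambda>x. ch j x *\<^sub>R G x) \<in> borel_measurable (lebesgue_on {c..d})" for j
      by (rule borel_measurable_integrable, rule integrable_bounded_scaleR[OF G chc])
  qed (use G in auto)
  have gi: "integrable (lebesgue_on {c..d}) g"
    using w square_integrable_imp_integrable by (auto simp: weak_derivative_def)
  define S where "S x = (k * sin (k * x)) *\<^sub>R f x" for x
  have Sc: "continuous_on {c..d} S" unfolding S_def by (intro continuous_intros f)
  have eq: "\<forall>\<^sub>F j in sequentially. integral {c..d} (\<lambda>x. r1 j x *\<^sub>R F x) - integral {c..d} (\<lambda>x. r2 j x *\<^sub>R F x)
      - (LINT x|lebesgue_on {c..d}. ch j x *\<^sub>R S x) = - (LINT x|lebesgue_on {c..d}. ch j x *\<^sub>R (cos (k * x) *\<^sub>R g x))"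
    using big
  proof eventually_elim
    case (elim j)
    then have j: "real j > 0" by (cases "j = 0") auto
    define \<phi> where "\<phi> x = ch j x * cos (k * x)" for x
    have "smooth_fn \<phi>" using smooth_fn_mult_trig[OF chs[of j] smooth_fn_zero, of k] unfolding \<phi>_def[abs_def] by simp
    have D: "deriv \<phi> x = (r1 j x - r2 j x) * cos (k * x) - ch j x * (k * sin (k * x))" for x
      unfolding \<phi>_def by (rule DERIV_imp_deriv) (rule derivative_eq_intros chD refl | simp)+
    have supp: "x \<in> {c + 1 / real j..d - 1 / real j}" if "\<phi> x \<noteq> 0" for x
    proof -
      have "ch j x \<noteq> 0" using that by (auto simp: \<phi>_def)
      have False if "x < c + 1 / real j"
      proof -
        have "real j * x + (- real j * c) \<le> 1" using that j by (simp add: field_simps)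
        moreover then have "real j * x + (3 - real j * d) \<le> 1" using elim by (simp add: algebra_simps)
        ultimately show False using \<open>ch j x \<noteq> 0\<close> by (simp add: ch_def \<theta>(4))
      qed
      moreover have False if "x > d - 1 / real j"
      proof -
        have "real j * x + (3 - real j * d) \<ge> 2" using that j by (simp add: field_simps)
        moreover then have "real j * x + (- real j * c) \<ge> 2" using elim by (simp add: algebra_simps)
        ultimately show False using \<open>ch j x \<noteq> 0\<close> by (simp add: ch_def \<theta>(5))
      qed
      ultimately show ?thesis by fastforce
    qed
    have "test_function c d \<phi>"
      unfolding test_function_def
    proof (intro conjI)
      show "\<forall>k x. (deriv ^^ k) \<phi> differentiable (at x)" using \<open>smooth_fn \<phi>\<close> by (simp add: smooth_fn_def)
      show "\<exists>c' d'. c < c' \<and> d' < d \<and> (\<forall>x. \<phi> x \<noteq> 0 \<longrightarrow> x \<in> {c'..d'})"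
        using supp j by (intro exI[of _ "c + 1 / real j"] exI[of _ "d - 1 / real j"]) auto
    qed
    then have "(LINT x|lebesgue_on {c..d}. deriv \<phi> x *\<^sub>R f x) = - (LINT x|lebesgue_on {c..d}. \<phi> x *\<^sub>R g x)"
      using w by (simp add: weak_derivative_def)
    also have "(LINT x|lebesgue_on {c..d}. deriv \<phi> x *\<^sub>R f x)
       = (LINT x|lebesgue_on {c..d}. r1 j x *\<^sub>R F x - r2 j x *\<^sub>R F x - ch j x *\<^sub>R S x)"
      by (rule Bochner_Integration.integral_cong) (auto simp: D F_def S_def algebra_simps)
    also have "\<dots> = (LINT x|lebesgue_on {c..d}. r1 j x *\<^sub>R F x - r2 j x *\<^sub>R F x) - (LINT x|lebesgue_on {c..d}. ch j x *\<^sub>R S x)"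
      by (intro Bochner_Integration.integral_diff continuous_imp_integrable_real continuous_intros r1c r2c chc Sc Fc)
    also have "(LINT x|lebesgue_on {c..d}. r1 j x *\<^sub>R F x - r2 j x *\<^sub>R F x) =
       integral {c..d} (\<lambda>x. r1 j x *\<^sub>R F x - r2 j x *\<^sub>R F x)"
      by (intro lint_continuous continuous_intros r1c r2c chc Sc Fc)
    also have "\<dots> = integral {c..d} (\<lambda>x. r1 j x *\<^sub>R F x) - integral {c..d} (\<lambda>x. r2 j x *\<^sub>R F x)"
      by (intro integral_diff_continuous continuous_intros r1c r2c chc Sc Fc)
    finally show ?case by (simp add: \<phi>_def)
  qed
  have "(\<lambda>j. integral {c..d} (\<lambda>x. r1 j x *\<^sub>R F x) - integral {c..d} (\<lambda>x. r2 j x *\<^sub>R F x)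
      - (LINT x|lebesgue_on {c..d}. ch j x *\<^sub>R S x)) \<longlonglongrightarrow> F c - F d - (LINT x|lebesgue_on {c..d}. S x)"
    by (intro tendsto_intros lim1 lim2 dom continuous_imp_integrable_real Sc)
  moreover have "(\<lambda>j. - (LINT x|lebesgue_on {c..d}. ch j x *\<^sub>R (cos (k * x) *\<^sub>R g x)))
      \<longlonglongrightarrow> - (LINT x|lebesgue_on {c..d}. cos (k * x) *\<^sub>R g x)"
    by (intro tendsto_intros dom integrable_bounded_scaleR gi continuous_intros)
  ultimately have "F c - F d - (LINT x|lebesgue_on {c..d}. S x) = - (LINT x|lebesgue_on {c..d}. cos (k * x) *\<^sub>R g x)"
    using tendsto_cong[OF eq] LIMSEQ_unique by blast
  then show ?thesis by (simp add: F_def S_def[abs_def] algebra_simps minus_equation_iff)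
qed

section \<open>Restriction to subintervals, fundamental theorem, uniqueness\<close>

lemma weak_derivative_integrable:
  assumes "weak_derivative c d f g"
  shows "square_integrable c d f" "square_integrable c d g"
    "integrable (lebesgue_on {c..d}) f" "integrable (lebesgue_on {c..d}) g"
  using assms square_integrable_imp_integrable by (auto simp: weak_derivative_def)

lemma integrable_lebesgue_on_mono:
  fixes f :: "real \<Rightarrow> 'a::{banach, second_countable_topology}"
  assumes "integrable (lebesgue_on {c..d}) f" "c \<le> c'" "d' \<le> d"
  shows "integrable (lebesgue_on {c'..d'}) f"
proof -
  have "set_integrable lebesgue {c..d} f"
    using assms(1) by (simp add: set_integrable_def integrable_restrict_space)
  then have "set_integrable lebesgue {c'..d'} f"
    by (rule set_integrable_subset) (use assms in auto)
  then show ?thesis by (simp add: set_integrable_def integrable_restrict_space)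
qed

lemma square_integrable_mono:
  assumes "square_integrable c d f" "c \<le> c'" "d' \<le> d"
  shows "square_integrable c' d' f"
  unfolding square_integrable_def
proof
  show "f \<in> borel_measurable (lebesgue_on {c'..d'})"
    by (rule measurable_restrict_mono[of _ _ "{c..d}"]) (use assms in \<open>auto simp: square_integrable_def\<close>)
  show "integrable (lebesgue_on {c'..d'}) (\<lambda>x. (cmod (f x))\<^sup>2)"
    by (rule integrable_lebesgue_on_mono) (use assms in \<open>auto simp: square_integrable_def\<close>)
qed

lemma lint_eq_on_subset:
  fixes f g :: "real \<Rightarrow> 'a::{banach, second_countable_topology}"
  assumes "{c'..d'} \<subseteq> {c..d}" "\<And>x. x \<in> {c'..d'} \<Longrightarrow> f x = g x" "\<And>x. x \<in> {c..d} \<Longrightarrow> x \<notin> {c'..d'} \<Longrightarrow> f x = 0"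
  shows "(LINT x|lebesgue_on {c..d}. f x) = (LINT x|lebesgue_on {c'..d'}. g x)"
proof -
  have "(LINT x|lebesgue_on {c..d}. f x) = (LINT x|lebesgue. indicator {c..d} x *\<^sub>R f x)"
    by (rule integral_restrict_space) simp
  also have "\<dots> = (LINT x|lebesgue. indicator {c'..d'} x *\<^sub>R g x)"
    by (rule Bochner_Integration.integral_cong) (use assms in \<open>auto simp: indicator_def split: if_splits\<close>)
  also have "\<dots> = (LINT x|lebesgue_on {c'..d'}. g x)"
    by (rule integral_restrict_space[symmetric]) simp
  finally show ?thesis .
qed

text \<open>A test function of the smaller interval is one of the larger, and it vanishes together
  with its derivative on the difference, so the integrals agree.\<close>

lemma weak_derivative_mono:
  assumes w: "weak_derivative c d f g" and "c \<le> c'" "d' \<le> d"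
  shows "weak_derivative c' d' f g"
  unfolding weak_derivative_def
proof (intro conjI allI impI)
  show "square_integrable c' d' f" "square_integrable c' d' g"
    using assms square_integrable_mono by (auto simp: weak_derivative_def)
  fix \<phi> assume \<phi>: "test_function c' d' \<phi>"
  then obtain c1 d1 where c1: "c' < c1" "d1 < d'" "\<And>x. \<phi> x \<noteq> 0 \<Longrightarrow> x \<in> {c1..d1}"
    by (auto simp: test_function_def)
  have "c < c1" "d1 < d" using c1 assms by auto
  then have "test_function c d \<phi>" using \<phi> c1(3) unfolding test_function_def by blast
  then have eq: "(LINT x|lebesgue_on {c..d}. deriv \<phi> x *\<^sub>R f x) = - (LINT x|lebesgue_on {c..d}. \<phi> x *\<^sub>R g x)"
    using w by (simp add: weak_derivative_def)
  have d0: "deriv \<phi> x = 0" if "x \<notin> {c'..d'}" for x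
  proof (rule DERIV_imp_deriv)
    have "((\<lambda>x. 0) has_real_derivative 0) (at x)" by simp
    then show "(\<phi> has_real_derivative 0) (at x)"
      by (rule has_field_derivative_transform_within_open[where S="- {c1..d1}"]) (use that c1 in force)+
  qed
  show "(LINT x|lebesgue_on {c'..d'}. deriv \<phi> x *\<^sub>R f x) = - (LINT x|lebesgue_on {c'..d'}. \<phi> x *\<^sub>R g x)"
  proof (cases "{c'..d'} \<subseteq> {c..d}")
    case True
    have "(LINT x|lebesgue_on {c..d}. deriv \<phi> x *\<^sub>R f x) = (LINT x|lebesgue_on {c'..d'}. deriv \<phi> x *\<^sub>R f x)"
      by (rule lint_eq_on_subset[OF True]) (use d0 in auto)
    moreover have "(LINT x|lebesgue_on {c..d}. \<phi> x *\<^sub>R g x) = (LINT x|lebesgue_on {c'..d'}. \<phi> x *\<^sub>R g x)"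
      by (rule lint_eq_on_subset[OF True]) (use c1 in force)+
    ultimately show ?thesis using eq by simp
  qed (use assms in auto)
qed

text \<open>Restrict to \<open>{x..y}\<close> and take frequency 0 in \<open>weak_ibp_cos\<close>.
  The case x = y is separate because that lemma needs a proper interval.\<close>

lemma weak_ftc:
  assumes w: "weak_derivative c d f g" and f: "continuous_on {c..d} f"
    and xy: "c \<le> x" "x \<le> y" "y \<le> d"
  shows "f y - f x = (LINT s|lebesgue_on {x..y}. g s)"
proof (cases "x = y")
  case False
  have "weak_derivative x y f g" by (rule weak_derivative_mono[OF w]) (use xy in auto)
  moreover have "continuous_on {x..y} f" by (rule continuous_on_subset[OF f]) (use xy in auto)
  ultimately show ?thesis using weak_ibp_cos[of x y f g 0] False xy by simp
next
  case True
  have "(LINT s|lebesgue_on {y..y}. g s) = (LINT s|lebesgue. indicator {y..y} s *\<^sub>R g s)"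
    by (rule integral_restrict_space) simp
  also have "\<dots> = 0"
  proof (rule integral_eq_zero_AE)
    have "AE s in lebesgue. s \<noteq> y"
      by (rule AE_not_in[of "{y}", simplified]) (simp add: null_sets_def)
    then show "AE s in lebesgue. indicator {y..y} s *\<^sub>R g s = 0"
      by (rule eventually_mono) auto
  qed
  finally show ?thesis using True by simp
qed

text \<open>By \<open>weak_ftc\<close> both candidates have the same integral over every
  subinterval. The difference, extended by 0, then has vanishing integral over all intervals and is
  0 almost everywhere by Lebesgue differentiation.\<close>

lemma weak_derivative_unique:
  assumes w: "weak_derivative c d f g" "weak_derivative c d f g'" and f: "continuous_on {c..d} f"
  shows "AE x in lebesgue_on {c..d}. g x = g' x"
proof -
  define h where "h x = (if x \<in> {c..d} then g x - g' x else 0)" for x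
  have int: "integrable (lebesgue_on {c..d}) g" "integrable (lebesgue_on {c..d}) g'"
    using w weak_derivative_integrable by blast+
  have sub: "g integrable_on {u..v} \<and> g' integrable_on {u..v} \<and> integral {u..v} g = integral {u..v} g'"
    if "c \<le> u" "v \<le> d" for u v
  proof -
    have i: "integrable (lebesgue_on {u..v}) g" "integrable (lebesgue_on {u..v}) g'"
      using int that integrable_lebesgue_on_mono by blast+
    have e: "(LINT s|lebesgue_on {u..v}. g s) = (LINT s|lebesgue_on {u..v}. g' s)"
      if "u \<le> v" using weak_ftc[OF w(1) f, of u v] weak_ftc[OF w(2) f, of u v] that \<open>c \<le> u\<close> \<open>v \<le> d\<close> by simp
    have "integral {u..v} g = integral {u..v} g'"
      using e i by (cases "u \<le> v") (auto simp: lebesgue_integral_eq_integral)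
    then show ?thesis using i by (auto intro: integrable_on_lebesgue_on)
  qed
  have hi: "(h has_integral 0) {u..v}" for u v
  proof -
    have "((\<lambda>x. g x - g' x) has_integral integral {max c u..min d v} g - integral {max c u..min d v} g') {max c u..min d v}"
      using sub[of "max c u" "min d v"] by (intro has_integral_diff integrable_integral) auto
    then have "((\<lambda>x. g x - g' x) has_integral 0) ({u..v} \<inter> {c..d})"
      using sub[of "max c u" "min d v"] by (simp add: Int_atLeastAtMost max.commute min.commute)
    then show ?thesis unfolding h_def[abs_def] has_integral_restrict_Int by (simp add: Int_commute)
  qed
  then have "h integrable_on cbox u v" for u v by (auto simp: integrable_on_def)
  then obtain N where N: "negligible N"
    "\<And>x e. \<lbrakk>x \<notin> N; 0 < e\<rbrakk> \<Longrightarrow> \<exists>r>0. \<forall>t. 0 < t \<and> t < r \<longrightarrow>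
        norm (integral (cbox x (x + t *\<^sub>R One)) h /\<^sub>R t ^ DIM(real) - h x) < e"
    using integrable_ccontinuous_explicit[of h] by metis
  have h0: "h x = 0" if xN: "x \<notin> N" for x
  proof (rule ccontr)
    assume "h x \<noteq> 0"
    then obtain r where "r > 0" "\<And>t. 0 < t \<Longrightarrow> t < r \<Longrightarrow> 
       norm (integral (cbox x (x + t *\<^sub>R One)) h /\<^sub>R t ^ DIM(real) - h x) < norm (h x)"
      using N(2)[OF xN, of "norm (h x)"] by auto
    from this(2)[of "r/2"] this(1) show False by (simp add: integral_unique[OF hi])
  qed
  have "AE x in lebesgue. x \<notin> N" by (rule AE_not_in) (use N(1) negligible_iff_null_sets in blast)
  then have "AE x in lebesgue. x \<in> {c..d} \<longrightarrow> g x = g' x"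
    by (rule eventually_mono) (use h0 in \<open>force simp: h_def\<close>)
  then show ?thesis by (simp add: AE_restrict_space_iff)
qed

section \<open>Algebra and locality of weak derivatives\<close>

lemma weak_derivative_mult:
  assumes "weak_derivative c d f g"
  shows "weak_derivative c d (\<lambda>x. r * f x) (\<lambda>x. r * g x)"
  using assms unfolding weak_derivative_def square_integrable_def
  by (auto simp: norm_mult power_mult_distrib mult_scaleR_right[symmetric] simp del: mult_scaleR_right)

lemma square_integrable_add:
  assumes "square_integrable c d f" "square_integrable c d g"
  shows "square_integrable c d (\<lambda>x. f x + g x)"
  unfolding square_integrable_def
proof
  show m: "(\<lambda>x. f x + g x) \<in> borel_measurable (lebesgue_on {c..d})"
    using assms by (auto simp: square_integrable_def)
  show "integrable (lebesgue_on {c..d}) (\<lambda>x. (cmod (f x + g x))\<^sup>2)"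
  proof (rule Bochner_Integration.integrable_bound)
    show "integrable (lebesgue_on {c..d}) (\<lambda>x. 2 * (cmod (f x))\<^sup>2 + 2 * (cmod (g x))\<^sup>2)"
      using assms by (auto simp: square_integrable_def)
    show "AE x in lebesgue_on {c..d}. norm ((cmod (f x + g x))\<^sup>2) \<le> norm (2 * (cmod (f x))\<^sup>2 + 2 * (cmod (g x))\<^sup>2)"
      using norm_add_sq_le by (intro AE_I2) simp
    show "(\<lambda>x. (cmod (f x + g x))\<^sup>2) \<in> borel_measurable (lebesgue_on {c..d})" using m by auto
  qed
qed

lemma weak_derivative_add:
  assumes w: "weak_derivative c d f g" "weak_derivative c d f' g'"
  shows "weak_derivative c d (\<lambda>x. f x + f' x) (\<lambda>x. g x + g' x)"
  unfolding weak_derivative_def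
proof (intro conjI allI impI)
  show "square_integrable c d (\<lambda>x. f x + f' x)" "square_integrable c d (\<lambda>x. g x + g' x)"
    using w by (auto simp: weak_derivative_def intro: square_integrable_add)
  fix \<phi> assume \<phi>: "test_function c d \<phi>"
  have "smooth_fn \<phi>" using \<phi> by (rule test_function_smooth)
  then have c: "continuous_on {c..d} \<phi>" "continuous_on {c..d} (deriv \<phi>)"
    by (auto intro: smooth_fn_continuous_on smooth_fn_deriv)
  note i = weak_derivative_integrable(3,4)[OF w(1)] weak_derivative_integrable(3,4)[OF w(2)]
  note i' = integrable_bounded_scaleR[OF _ c(1)] integrable_bounded_scaleR[OF _ c(2)]
  show "(LINT x|lebesgue_on {c..d}. deriv \<phi> x *\<^sub>R (f x + f' x)) = - (LINT x|lebesgue_on {c..d}. \<phi> x *\<^sub>R (g x + g' x))"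
    using w \<phi> by (simp add: weak_derivative_def scaleR_add_right i i')
qed

lemma weak_derivative_diff:
  assumes "weak_derivative c d f g" "weak_derivative c d f' g'"
  shows "weak_derivative c d (\<lambda>x. f x - f' x) (\<lambda>x. g x - g' x)"
  using weak_derivative_add[OF assms(1) weak_derivative_mult[OF assms(2), of "-1"]] by simp

lemma square_integrable_cong:
  assumes "\<And>x. x \<in> {c..d} \<Longrightarrow> f x = f' x"
  shows "square_integrable c d f \<longleftrightarrow> square_integrable c d f'"
  unfolding square_integrable_def
  by (intro arg_cong2[where f="(\<and>)"] measurable_cong Bochner_Integration.integrable_cong) (use assms in auto)

lemma weak_derivative_cong:
  assumes "\<And>x. x \<in> {c..d} \<Longrightarrow> f x = f' x" "\<And>x. x \<in> {c..d} \<Longrightarrow> g x = g' x"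
  shows "weak_derivative c d f g \<longleftrightarrow> weak_derivative c d f' g'"
proof -
  have "(LINT x|lebesgue_on {c..d}. \<phi> x *\<^sub>R f x) = (LINT x|lebesgue_on {c..d}. \<phi> x *\<^sub>R f' x)"
    "(LINT x|lebesgue_on {c..d}. \<phi> x *\<^sub>R g x) = (LINT x|lebesgue_on {c..d}. \<phi> x *\<^sub>R g' x)" for \<phi> :: "real \<Rightarrow> real"
    by (rule Bochner_Integration.integral_cong; use assms in auto)+
  then show ?thesis unfolding weak_derivative_def
    using square_integrable_cong[OF assms(1)] square_integrable_cong[OF assms(2)] by simp
qed

lemma H1_cong:
  assumes "\<And>x. x \<in> {c..d} \<Longrightarrow> f x = f' x"
  shows "f \<in> H1 c d \<longleftrightarrow> f' \<in> H1 c d"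
proof -
  have "continuous_on {c..d} f \<longleftrightarrow> continuous_on {c..d} f'" using assms by (intro continuous_on_cong) auto
  then show ?thesis using weak_derivative_cong[OF assms refl] unfolding H1_def by auto
qed

lemma H1_add: "f \<in> H1 c d \<Longrightarrow> g \<in> H1 c d \<Longrightarrow> (\<lambda>x. f x + g x) \<in> H1 c d"
  unfolding H1_def using weak_derivative_add by (blast intro: continuous_on_add)

lemma H1_diff: "f \<in> H1 c d \<Longrightarrow> g \<in> H1 c d \<Longrightarrow> (\<lambda>x. f x - g x) \<in> H1 c d"
  unfolding H1_def using weak_derivative_diff by (blast intro: continuous_on_diff)

lemma weak_derivative_C1:
  assumes f: "\<And>x. x \<in> {c..d} \<Longrightarrow> (f has_vector_derivative g x) (at x within {c..d})"
    and g: "continuous_on {c..d} g"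
  shows "weak_derivative c d f g"
  unfolding weak_derivative_def
proof (intro conjI allI impI)
  have fc: "continuous_on {c..d} f"
    using f by (meson continuous_on_eq_continuous_within has_vector_derivative_continuous)
  then show "square_integrable c d f" "square_integrable c d g"
    using g by (auto intro: square_integrable_continuous)
  fix \<phi> assume \<phi>: "test_function c d \<phi>"
  then have s: "smooth_fn \<phi>" by (rule test_function_smooth)
  then have c: "continuous_on {c..d} \<phi>" "continuous_on {c..d} (deriv \<phi>)"
    by (auto intro: smooth_fn_continuous_on smooth_fn_deriv)
  show "(LINT x|lebesgue_on {c..d}. deriv \<phi> x *\<^sub>R f x) = - (LINT x|lebesgue_on {c..d}. \<phi> x *\<^sub>R g x)"
  proof (cases "c \<le> d")
    case True
    have "((\<lambda>x. deriv \<phi> x *\<^sub>R f x + \<phi> x *\<^sub>R g x) has_integral \<phi> d *\<^sub>R f d - \<phi> c *\<^sub>R f c) {c..d}"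
    proof (rule fundamental_theorem_of_calculus[OF True])
      fix x assume "x \<in> {c..d}"
      have "(\<phi> has_vector_derivative deriv \<phi> x) (at x within {c..d})"
        using smooth_fn_DERIV[OF s, of x] has_real_derivative_iff_has_vector_derivative has_vector_derivative_at_within by blast
      from has_vector_derivative_scaleR[OF this[folded has_real_derivative_iff_has_vector_derivative] f[OF \<open>x \<in> {c..d}\<close>]]
      show "((\<lambda>x. \<phi> x *\<^sub>R f x) has_vector_derivative deriv \<phi> x *\<^sub>R f x + \<phi> x *\<^sub>R g x) (at x within {c..d})"
        by (simp add: add.commute)
    qed
    moreover have "\<phi> c = 0" "\<phi> d = 0" using \<phi> by (force simp: test_function_def)+
    ultimately have "integral {c..d} (\<lambda>x. deriv \<phi> x *\<^sub>R f x + \<phi> x *\<^sub>R g x) = 0" by (simp add: integral_unique)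
    moreover have "integral {c..d} (\<lambda>x. deriv \<phi> x *\<^sub>R f x + \<phi> x *\<^sub>R g x) 
       = integral {c..d} (\<lambda>x. deriv \<phi> x *\<^sub>R f x) + integral {c..d} (\<lambda>x. \<phi> x *\<^sub>R g x)"
      by (intro integral_add_continuous continuous_intros c fc g)
    moreover have "(LINT x|lebesgue_on {c..d}. deriv \<phi> x *\<^sub>R f x) = integral {c..d} (\<lambda>x. deriv \<phi> x *\<^sub>R f x)"
      "(LINT x|lebesgue_on {c..d}. \<phi> x *\<^sub>R g x) = integral {c..d} (\<lambda>x. \<phi> x *\<^sub>R g x)"
      by (intro lint_continuous continuous_intros c fc g)+
    ultimately show ?thesis by (simp add: eq_neg_iff_add_eq_0)
  next
    case False
    then show ?thesis by (simp add: lint_continuous)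
  qed
qed

section \<open>The norm of H1, Hoelder continuity and the Sobolev embedding\<close>

lemma H1_norm_eq:
  assumes w: "weak_derivative c d f g" and f: "continuous_on {c..d} f"
  shows "H1_norm c d f = sqrt ((LINT x|lebesgue_on {c..d}. (cmod (f x))\<^sup>2) + (LINT x|lebesgue_on {c..d}. (cmod (g x))\<^sup>2))"
proof -
  define g' where "g' = (SOME g. weak_derivative c d f g)"
  have w': "weak_derivative c d f g'" unfolding g'_def by (rule someI[of _ g]) (rule w)
  \<comment> \<open>The derivative picked by \<open>SOME\<close> agrees almost everywhere with
    \<open>g\<close>, so any weak derivative computes the norm.\<close>
  have "AE x in lebesgue_on {c..d}. g' x = g x" by (rule weak_derivative_unique[OF w' w f])
  then have "(LINT x|lebesgue_on {c..d}. (cmod (g' x))\<^sup>2) = (LINT x|lebesgue_on {c..d}. (cmod (g x))\<^sup>2)"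
    using w w' by (intro integral_cong_AE) (auto simp: weak_derivative_def square_integrable_def)
  then show ?thesis by (simp add: H1_norm_def g'_def[symmetric] Let_def)
qed

lemma H1_norm_nonneg: "0 \<le> H1_norm c d f"
  unfolding H1_norm_def Let_def by (intro real_sqrt_ge_zero add_nonneg_nonneg Bochner_Integration.integral_nonneg) auto

lemma measure_lebesgue_on_Icc: "c \<le> d \<Longrightarrow> measure (lebesgue_on {c..d}) {c..d} = d - (c::real)"
  by (simp add: measure_restrict_space)

text \<open>Cauchy-Schwarz against the constant 1, read off from the nonnegative variance of
  \<open>cmod (g x)\<close> about its mean \<open>m\<close>.\<close>

lemma lint_norm_le:
  assumes g: "square_integrable c d g" and cd: "c < d"
  shows "(LINT x|lebesgue_on {c..d}. cmod (g x))\<^sup>2 \<le> (d - c) * (LINT x|lebesgue_on {c..d}. (cmod (g x))\<^sup>2)"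
proof -
  define A where "A = (LINT x|lebesgue_on {c..d}. cmod (g x))"
  define B where "B = (LINT x|lebesgue_on {c..d}. (cmod (g x))\<^sup>2)"
  define m where "m = A / (d - c)"
  have i: "integrable (lebesgue_on {c..d}) (\<lambda>x. cmod (g x))" "integrable (lebesgue_on {c..d}) (\<lambda>x. (cmod (g x))\<^sup>2)"
    "integrable (lebesgue_on {c..d}) (\<lambda>x. m\<^sup>2)"
    using g square_integrable_imp_integrable[OF g] continuous_imp_integrable_real[of c d "\<lambda>x. m\<^sup>2"] 
    by (auto simp: square_integrable_def)
  have "0 \<le> (LINT x|lebesgue_on {c..d}. (cmod (g x) - m)\<^sup>2)" by (rule Bochner_Integration.integral_nonneg) auto
  also have "\<dots> = (LINT x|lebesgue_on {c..d}. (cmod (g x))\<^sup>2 + m\<^sup>2 - (2 * m) * cmod (g x))"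
    by (rule Bochner_Integration.integral_cong) (auto simp: power2_diff)
  also have "\<dots> = B + m\<^sup>2 * (d - c) - (2 * m) * A"
    using i cd unfolding A_def B_def by (simp add: measure_lebesgue_on_Icc)
  finally have "(2 * m * A - m\<^sup>2 * (d - c)) * (d - c) \<le> B * (d - c)"
    using cd by (intro mult_right_mono) auto
  moreover have "(2 * m * A - m\<^sup>2 * (d - c)) * (d - c) = A\<^sup>2"
  proof -
    have m: "m * (d - c) = A" using cd by (simp add: m_def)
    have "(2 * m * A - m\<^sup>2 * (d - c)) * (d - c) = 2 * (m * (d - c)) * A - (m * (d - c))\<^sup>2"
      by (simp add: power2_eq_square algebra_simps)
    then show ?thesis unfolding m by (simp add: power2_eq_square)
  qed
  ultimately show ?thesis by (simp add: A_def B_def mult.commute)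
qed

lemma lint_mono_set:
  fixes g :: "real \<Rightarrow> real"
  assumes "integrable (lebesgue_on {c..d}) g" "\<And>x. g x \<ge> 0" "c \<le> x" "y \<le> d"
  shows "(LINT s|lebesgue_on {x..y}. g s) \<le> (LINT s|lebesgue_on {c..d}. g s)"
proof -
  have "(LINT s|lebesgue_on {x..y}. g s) = (LINT s|lebesgue. indicator {x..y} s *\<^sub>R g s)"
    by (rule integral_restrict_space) simp
  also have "\<dots> \<le> (LINT s|lebesgue. indicator {c..d} s *\<^sub>R g s)"
  proof (rule integral_mono)
    show "integrable lebesgue (\<lambda>s. indicator {c..d} s *\<^sub>R g s)"
      using assms(1) by (simp add: integrable_restrict_space)
    show "integrable lebesgue (\<lambda>s. indicator {x..y} s *\<^sub>R g s)"
      using integrable_lebesgue_on_mono[OF assms(1,3,4)] by (simp add: integrable_restrict_space)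
  qed (use assms in \<open>auto simp: indicator_def\<close>)
  also have "\<dots> = (LINT s|lebesgue_on {c..d}. g s)"
    by (rule integral_restrict_space[symmetric]) simp
  finally show ?thesis .
qed

text \<open>\<open>weak_ftc\<close> followed by Cauchy-Schwarz. It serves twice: for the Sobolev
  bound in space and for the Hoelder hypothesis on the boundary data in time.\<close>

lemma weak_derivative_holder:
  assumes w: "weak_derivative c d f g" and f: "continuous_on {c..d} f"
    and xy: "x \<in> {c..d}" "y \<in> {c..d}"
  shows "(cmod (f x - f y))\<^sup>2 \<le> \<bar>x - y\<bar> * (LINT s|lebesgue_on {c..d}. (cmod (g s))\<^sup>2)"
proof -
  have *: "(cmod (f x - f y))\<^sup>2 \<le> \<bar>x - y\<bar> * (LINT s|lebesgue_on {c..d}. (cmod (g s))\<^sup>2)"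
    if "x < y" "x \<in> {c..d}" "y \<in> {c..d}" for x y
  proof -
    have g: "square_integrable x y g" 
      using weak_derivative_integrable(2)[OF w] that square_integrable_mono by auto
    have "f y - f x = (LINT s|lebesgue_on {x..y}. g s)"
      using weak_ftc[OF w f] that by auto
    then have "cmod (f x - f y) \<le> (LINT s|lebesgue_on {x..y}. cmod (g s))"
      by (metis integral_norm_bound norm_minus_commute)
    then have "(cmod (f x - f y))\<^sup>2 \<le> (LINT s|lebesgue_on {x..y}. cmod (g s))\<^sup>2" by (rule power_mono) simp
    also have "\<dots> \<le> (y - x) * (LINT s|lebesgue_on {x..y}. (cmod (g s))\<^sup>2)"
      by (rule lint_norm_le[OF g that(1)])
    also have "\<dots> \<le> (y - x) * (LINT s|lebesgue_on {c..d}. (cmod (g s))\<^sup>2)"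
      using that weak_derivative_integrable(2)[OF w]
      by (intro mult_left_mono lint_mono_set) (auto simp: square_integrable_def)
    finally show ?thesis using that by simp
  qed
  show ?thesis
    using *[of x y] *[of y x] xy by (cases x y rule: linorder_cases) (auto simp: norm_minus_commute abs_minus_commute)
qed

text \<open>Bound \<open>h x\<close> by \<open>h y\<close> plus the difference, estimate the
  difference by \<open>weak_derivative_holder\<close>, and average over y.\<close>

lemma sobolev_sup:
  assumes h: "h \<in> H1 0 L" and L: "L > 0" and x: "x \<in> {0..L}"
  shows "(cmod (h x))\<^sup>2 \<le> (2 * L + 2 / L) * (H1_norm 0 L h)\<^sup>2"
proof -
  obtain g where w: "weak_derivative 0 L h g" and c: "continuous_on {0..L} h" using h by (auto simp: H1_def)
  define A where "A = (LINT x|lebesgue_on {0..L}. (cmod (h x))\<^sup>2)"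
  define B where "B = (LINT x|lebesgue_on {0..L}. (cmod (g x))\<^sup>2)"
  have AB: "A \<ge> 0" "B \<ge> 0" unfolding A_def B_def by (intro Bochner_Integration.integral_nonneg; simp)+
  have N: "(H1_norm 0 L h)\<^sup>2 = A + B" using H1_norm_eq[OF w c] AB by (simp add: A_def B_def)
  have "L * (cmod (h x))\<^sup>2 = (LINT y|lebesgue_on {0..L}. (cmod (h x))\<^sup>2)" using L by (simp add: measure_lebesgue_on_Icc)
  also have "\<dots> \<le> (LINT y|lebesgue_on {0..L}. 2 * L * B + 2 * (cmod (h y))\<^sup>2)"
  proof (rule integral_mono)
    show "integrable (lebesgue_on {0..L}) (\<lambda>y. (cmod (h x))\<^sup>2)" 
      "integrable (lebesgue_on {0..L}) (\<lambda>y. 2 * L * B + 2 * (cmod (h y))\<^sup>2)"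
      by (intro continuous_imp_integrable_real continuous_intros c)+
    fix y assume "y \<in> space (lebesgue_on {0..L})"
    then have y: "y \<in> {0..L}" by simp
    have "(cmod (h x))\<^sup>2 \<le> 2 * (cmod (h x - h y))\<^sup>2 + 2 * (cmod (h y))\<^sup>2"
      using norm_add_sq_le[of "h x - h y" "h y"] by simp
    also have "(cmod (h x - h y))\<^sup>2 \<le> \<bar>x - y\<bar> * B"
      unfolding B_def by (rule weak_derivative_holder[OF w c x y])
    also have "\<bar>x - y\<bar> * B \<le> L * B" using x y AB by (intro mult_right_mono) auto
    finally show "(cmod (h x))\<^sup>2 \<le> 2 * L * B + 2 * (cmod (h y))\<^sup>2" by simp
  qed
  also have "\<dots> = (LINT y|lebesgue_on {0..L}. 2 * L * B) + (LINT y|lebesgue_on {0..L}. 2 * (cmod (h y))\<^sup>2)"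
    by (intro Bochner_Integration.integral_add continuous_imp_integrable_real continuous_intros c)
  also have "\<dots> = 2 * L * B * L + 2 * A" using L by (simp add: measure_lebesgue_on_Icc A_def)
  finally have "L * (cmod (h x))\<^sup>2 \<le> 2 * L * B * L + 2 * A" .
  then have "(cmod (h x))\<^sup>2 \<le> 2 * L * B + 2 / L * A" using L by (simp add: field_simps)
  also have "\<dots> \<le> (2 * L + 2 / L) * (A + B)" using L AB by (simp add: field_simps)
  finally show ?thesis by (simp add: N)
qed

text \<open>Convergence in H1 is uniform by \<open>sobolev_sup\<close>. Continuity at each fixed x
  is what allows time integrals to be split when solutions are concatenated.\<close>

lemma C_H1_continuous:
  assumes u: "u \<in> C_H1 T L" and L: "L > 0" and x: "x \<in> {0..L}"
  shows "continuous_on {0..T} (\<lambda>s. u s x)"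
  unfolding continuous_on_def
proof
  fix t assume t: "t \<in> {0..T}"
  have lim: "((\<lambda>s. H1_norm 0 L (\<lambda>x. u s x - u t x)) \<longlongrightarrow> 0) (at t within {0..T})"
    using u t by (auto simp: C_H1_def)
  have "((\<lambda>s. u s x - u t x) \<longlongrightarrow> 0) (at t within {0..T})"
  proof (rule Lim_null_comparison)
    show "\<forall>\<^sub>F s in at t within {0..T}. norm (u s x - u t x) \<le> sqrt (2 * L + 2 / L) * H1_norm 0 L (\<lambda>x. u s x - u t x)"
      unfolding eventually_at_filter
    proof (rule always_eventually, intro allI impI)
      fix s assume "s \<noteq> t" "s \<in> {0..T}"
      then have "(\<lambda>x. u s x - u t x) \<in> H1 0 L" using u t by (intro H1_diff) (auto simp: C_H1_def)
      from sobolev_sup[OF this L x]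
      have "(cmod (u s x - u t x))\<^sup>2 \<le> (sqrt (2 * L + 2 / L) * H1_norm 0 L (\<lambda>x. u s x - u t x))\<^sup>2"
        using L by (simp add: power_mult_distrib)
      then show "norm (u s x - u t x) \<le> sqrt (2 * L + 2 / L) * H1_norm 0 L (\<lambda>x. u s x - u t x)"
        by (rule power2_le_imp_le) (use L H1_norm_nonneg in auto)
    qed
    have "((\<lambda>s. sqrt (2 * L + 2 / L) * H1_norm 0 L (\<lambda>x. u s x - u t x)) \<longlongrightarrow> sqrt (2 * L + 2 / L) * 0) (at t within {0..T})"
      by (intro tendsto_intros lim)
    then show "((\<lambda>s. sqrt (2 * L + 2 / L) * H1_norm 0 L (\<lambda>x. u s x - u t x)) \<longlongrightarrow> 0) (at t within {0..T})" by simp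
  qed
  then show "((\<lambda>s. u s x) \<longlongrightarrow> u t x) (at t within {0..T})" by (simp add: LIM_zero_iff)
qed

section \<open>Mean-square limits\<close>

lemma square_integrable_diff:
  assumes "square_integrable c d f" "square_integrable c d g"
  shows "square_integrable c d (\<lambda>x. f x - g x)"
proof -
  have "square_integrable c d (\<lambda>x. - g x)" using assms(2) by (simp add: square_integrable_def)
  from square_integrable_add[OF assms(1) this] show ?thesis by simp
qed

lemma tendsto_lint_scaleR_0:
  fixes q :: "nat \<Rightarrow> real \<Rightarrow> complex"
  assumes q: "\<And>N. square_integrable c d (q N)" and \<psi>: "continuous_on {c..d} \<psi>" and cd: "c < d"
    and lim: "(\<lambda>N. LINT x|lebesgue_on {c..d}. (cmod (q N x))\<^sup>2) \<longlonglongrightarrow> 0"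
  shows "(\<lambda>N. LINT x|lebesgue_on {c..d}. \<psi> x *\<^sub>R q N x) \<longlonglongrightarrow> 0"
proof -
  obtain B where B: "\<forall>x\<in>{c..d}. \<bar>\<psi> x\<bar> \<le> B"
    using compact_imp_bounded[OF compact_continuous_image[OF \<psi>]] by (auto simp: bounded_iff)
  have B0: "B \<ge> 0" using B cd by (meson abs_ge_zero atLeastAtMost_iff less_imp_le order_refl order_trans)
  have bd: "norm (LINT x|lebesgue_on {c..d}. \<psi> x *\<^sub>R q N x) \<le> B * sqrt ((d - c) * (LINT x|lebesgue_on {c..d}. (cmod (q N x))\<^sup>2))" for N
  proof -
    note i = square_integrable_imp_integrable[OF q[of N]]
    have "norm (LINT x|lebesgue_on {c..d}. \<psi> x *\<^sub>R q N x) \<le> (LINT x|lebesgue_on {c..d}. norm (\<psi> x *\<^sub>R q N x))"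
      by (rule integral_norm_bound)
    also have "\<dots> \<le> (LINT x|lebesgue_on {c..d}. B * cmod (q N x))"
    proof (rule integral_mono)
      show "integrable (lebesgue_on {c..d}) (\<lambda>x. norm (\<psi> x *\<^sub>R q N x))"
        using integrable_bounded_scaleR[OF i \<psi>] by (rule integrable_norm)
    qed (use i B in \<open>auto intro: mult_right_mono\<close>)
    also have "\<dots> = B * (LINT x|lebesgue_on {c..d}. cmod (q N x))" by simp
    also have "(LINT x|lebesgue_on {c..d}. cmod (q N x)) \<le> sqrt ((d - c) * (LINT x|lebesgue_on {c..d}. (cmod (q N x))\<^sup>2))"
      using lint_norm_le[OF q cd] by (rule real_le_rsqrt)
    finally show ?thesis using B0 by (simp add: mult_left_mono)
  qed
  have "(\<lambda>N. B * sqrt ((d - c) * (LINT x|lebesgue_on {c..d}. (cmod (q N x))\<^sup>2))) \<longlonglongrightarrow> B * sqrt ((d - c) * 0)"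
    by (intro tendsto_intros lim)
  then have lim0: "(\<lambda>N. B * sqrt ((d - c) * (LINT x|lebesgue_on {c..d}. (cmod (q N x))\<^sup>2))) \<longlonglongrightarrow> 0" by simp
  show ?thesis by (rule Lim_null_comparison[OF always_eventually lim0]) (use bd in blast)
qed

text \<open>Against a fixed test function both sides of the defining identity are continuous for
  mean-square convergence.\<close>

lemma weak_derivative_limit:
  fixes S f :: "nat \<Rightarrow> real \<Rightarrow> complex"
  assumes cd: "c < d" and w: "\<And>N. weak_derivative c d (S N) (f N)"
    and h: "square_integrable c d h" and g: "square_integrable c d g"
    and lim: "(\<lambda>N. LINT x|lebesgue_on {c..d}. (cmod (h x - S N x))\<^sup>2) \<longlonglongrightarrow> 0"
      "(\<lambda>N. LINT x|lebesgue_on {c..d}. (cmod (g x - f N x))\<^sup>2) \<longlonglongrightarrow> 0"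
  shows "weak_derivative c d h g"
  unfolding weak_derivative_def
proof (intro conjI allI impI)
  fix \<phi> assume \<phi>: "test_function c d \<phi>"
  then have s: "smooth_fn \<phi>" by (rule test_function_smooth)
  then have c: "continuous_on {c..d} \<phi>" "continuous_on {c..d} (deriv \<phi>)"
    by (auto intro: smooth_fn_continuous_on smooth_fn_deriv)
  note SN = weak_derivative_integrable[OF w]
  have 1: "(\<lambda>N. LINT x|lebesgue_on {c..d}. deriv \<phi> x *\<^sub>R (h x - S N x)) \<longlonglongrightarrow> 0"
    by (rule tendsto_lint_scaleR_0[OF _ c(2) cd lim(1)]) (intro square_integrable_diff h SN)
  have 2: "(\<lambda>N. LINT x|lebesgue_on {c..d}. \<phi> x *\<^sub>R (g x - f N x)) \<longlonglongrightarrow> 0"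
    by (rule tendsto_lint_scaleR_0[OF _ c(1) cd lim(2)]) (intro square_integrable_diff g SN)
  have i: "integrable (lebesgue_on {c..d}) h" "integrable (lebesgue_on {c..d}) g"
    using h g square_integrable_imp_integrable by auto
  have eq: "(LINT x|lebesgue_on {c..d}. deriv \<phi> x *\<^sub>R (h x - S N x)) + (LINT x|lebesgue_on {c..d}. \<phi> x *\<^sub>R (g x - f N x))
    = (LINT x|lebesgue_on {c..d}. deriv \<phi> x *\<^sub>R h x) + (LINT x|lebesgue_on {c..d}. \<phi> x *\<^sub>R g x)" for N
    using w[of N] \<phi>
    by (simp add: scaleR_diff_right integrable_bounded_scaleR c i SN weak_derivative_def)
  have "(\<lambda>N. (LINT x|lebesgue_on {c..d}. deriv \<phi> x *\<^sub>R h x) + (LINT x|lebesgue_on {c..d}. \<phi> x *\<^sub>R g x)) \<longlonglongrightarrow> 0 + 0"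
    using tendsto_add[OF 1 2] unfolding eq .
  then show "(LINT x|lebesgue_on {c..d}. deriv \<phi> x *\<^sub>R h x) = - (LINT x|lebesgue_on {c..d}. \<phi> x *\<^sub>R g x)"
    by (simp add: LIMSEQ_const_iff eq_neg_iff_add_eq_0)
qed (use h g in auto)

text \<open>On a bounded interval the sequence is also Cauchy in L1, so a subsequence converges
  almost everywhere, and Fatou's lemma passes the estimates to the limit. The rate
  \<open>e N\<close> is retained because its value at N = 0 later bounds the norm of the
  limit.\<close>

lemma L2_complete:
  fixes f :: "nat \<Rightarrow> real \<Rightarrow> complex"
  assumes cd: "c < d" and f: "\<And>N. square_integrable c d (f N)"
    and e: "\<And>N M. N \<le> M \<Longrightarrow> (LINT x|lebesgue_on {c..d}. (cmod (f M x - f N x))\<^sup>2) \<le> e N"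
    and e0: "e \<longlonglongrightarrow> 0"
  obtains g where "square_integrable c d g" "\<And>N. (LINT x|lebesgue_on {c..d}. (cmod (g x - f N x))\<^sup>2) \<le> e N"
proof -
  define M where "M = lebesgue_on {c..d}"
  note fi = square_integrable_imp_integrable[OF f, folded M_def]
  have fm: "f N \<in> borel_measurable M" for N using f by (simp add: square_integrable_def M_def)
  have L1: "\<exists>N. \<forall>i\<ge>N. \<forall>j\<ge>N. (LINT x|M. norm (f i x - f j x)) < \<epsilon>" if "\<epsilon> > 0" for \<epsilon>
  proof -
    have "(\<lambda>N. sqrt ((d - c) * e N)) \<longlonglongrightarrow> sqrt ((d - c) * 0)" by (intro tendsto_intros e0)
    then have "\<forall>\<^sub>F N in sequentially. sqrt ((d - c) * e N) < \<epsilon>" using that by (intro order_tendstoD(2)) auto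
    then obtain N where N: "\<And>n. n \<ge> N \<Longrightarrow> sqrt ((d - c) * e n) < \<epsilon>" by (auto simp: eventually_sequentially)
    have *: "(LINT x|M. norm (f i x - f j x)) < \<epsilon>" if "j \<ge> N" "i \<ge> j" for i j
    proof -
      have "(LINT x|M. norm (f i x - f j x))\<^sup>2 \<le> (d - c) * e j"
        using lint_norm_le[OF square_integrable_diff[OF f f] cd, of i j] e[OF that(2)] cd
        unfolding M_def by (meson diff_ge_0_iff_ge less_imp_le mult_left_mono order_trans)
      then have "(LINT x|M. norm (f i x - f j x)) \<le> sqrt ((d - c) * e j)" by (rule real_le_rsqrt)
      then show ?thesis using N[OF that(1)] by simp
    qed
    have "(LINT x|M. norm (f i x - f j x)) < \<epsilon>" if "j \<ge> N" "i \<ge> N" for i j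
      using *[of i j] *[of j i] that by (cases "i \<le> j") (auto simp: norm_minus_commute)
    then show ?thesis by blast
  qed
  obtain r where r: "strict_mono r" "AE x in M. Cauchy (\<lambda>i. f (r i) x)"
    using cauchy_L1_AE_cauchy_subseq[of M f, OF fi L1] by blast
  define g where "g x = lim (\<lambda>i. f (r i) x)" for x
  have gm: "g \<in> borel_measurable M" unfolding g_def[abs_def] by (rule borel_measurable_lim_metric) (rule fm)
  have conv: "AE x in M. (\<lambda>i. f (r i) x) \<longlonglongrightarrow> g x"
    using r(2) by (rule eventually_mono) (auto simp: g_def Cauchy_convergent_iff convergent_LIMSEQ_iff)
  have nn: "(\<integral>\<^sup>+ x. ennreal ((cmod (g x - f N x))\<^sup>2) \<partial>M) \<le> ennreal (e N)" for N
  proof -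
    have "(\<integral>\<^sup>+ x. ennreal ((cmod (g x - f N x))\<^sup>2) \<partial>M) = (\<integral>\<^sup>+ x. liminf (\<lambda>i. ennreal ((cmod (f (r i) x - f N x))\<^sup>2)) \<partial>M)"
    proof (rule nn_integral_cong_AE)
      show "AE x in M. ennreal ((cmod (g x - f N x))\<^sup>2) = liminf (\<lambda>i. ennreal ((cmod (f (r i) x - f N x))\<^sup>2))"
        using conv
      proof (rule eventually_mono)
        fix x assume "(\<lambda>i. f (r i) x) \<longlonglongrightarrow> g x"
        then have "(\<lambda>i. ennreal ((cmod (f (r i) x - f N x))\<^sup>2)) \<longlonglongrightarrow> ennreal ((cmod (g x - f N x))\<^sup>2)"
          by (intro tendsto_intros tendsto_ennrealI)
        then show "ennreal ((cmod (g x - f N x))\<^sup>2) = liminf (\<lambda>i. ennreal ((cmod (f (r i) x - f N x))\<^sup>2))"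
          by (intro lim_imp_Liminf[symmetric]) auto
      qed
    qed
    also have "\<dots> \<le> liminf (\<lambda>i. \<integral>\<^sup>+ x. ennreal ((cmod (f (r i) x - f N x))\<^sup>2) \<partial>M)"
      by (rule nn_integral_liminf) (use fm in measurable)
    also have "\<dots> \<le> liminf (\<lambda>i. ennreal (e N))"
    proof (rule Liminf_mono)
      show "\<forall>\<^sub>F i in sequentially. (\<integral>\<^sup>+ x. ennreal ((cmod (f (r i) x - f N x))\<^sup>2) \<partial>M) \<le> ennreal (e N)"
        using eventually_ge_at_top[of N]
      proof eventually_elim
        case (elim i)
        then have "N \<le> r i" using seq_suble[OF r(1), of i] by simp
        have "integrable M (\<lambda>x. (cmod (f (r i) x - f N x))\<^sup>2)"
          using square_integrable_diff[OF f f] by (simp add: square_integrable_def M_def)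
        then have "(\<integral>\<^sup>+ x. ennreal ((cmod (f (r i) x - f N x))\<^sup>2) \<partial>M) = ennreal (LINT x|M. (cmod (f (r i) x - f N x))\<^sup>2)"
          by (rule nn_integral_eq_integral) auto
        then show ?case using e[OF \<open>N \<le> r i\<close>] by (simp add: M_def ennreal_leI)
      qed
    qed
    also have "\<dots> = ennreal (e N)" by (rule Liminf_const) simp
    finally show ?thesis .
  qed
  have sq: "integrable M (\<lambda>x. (cmod (g x - f N x))\<^sup>2)" for N
  proof (rule integrableI_nonneg)
    show "(\<integral>\<^sup>+ x. ennreal ((cmod (g x - f N x))\<^sup>2) \<partial>M) < \<infinity>"
      using le_less_trans[OF nn[of N] ennreal_less_top] by simp
  qed (use gm fm in auto)
  have "square_integrable c d (\<lambda>x. g x - f 0 x)"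
    using sq[of 0] gm fm unfolding square_integrable_def M_def[symmetric] by auto
  from square_integrable_add[OF this f[of 0]] have g2: "square_integrable c d g" by simp
  have "(LINT x|M. (cmod (g x - f N x))\<^sup>2) \<le> e N" for N
  proof -
    have "ennreal (LINT x|M. (cmod (g x - f N x))\<^sup>2) \<le> ennreal (e N)"
      using nn[of N] nn_integral_eq_integral[OF sq[of N]] by simp
    moreover have "e N \<ge> 0" using e[of N N] by simp
    ultimately show ?thesis by (simp add: ennreal_le_iff)
  qed
  then show thesis using g2 that unfolding M_def by blast
qed

section \<open>Orthogonal systems on an interval\<close>

lemma integral_norm_sum_orthogonal:
  fixes e :: "nat \<Rightarrow> real \<Rightarrow> real" and c :: "nat \<Rightarrow> complex"
  assumes cont: "\<And>n. continuous_on {0..L} (e n)"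
    and orth: "\<And>n m. integral {0..L} (\<lambda>x. e n x * e m x) = (if n = m then q else 0)"
    and A: "finite A"
  shows "integral {0..L} (\<lambda>x. (cmod (\<Sum>n\<in>A. e n x *\<^sub>R c n))\<^sup>2) = q * (\<Sum>n\<in>A. (cmod (c n))\<^sup>2)"
proof -
  have "(cmod (\<Sum>n\<in>A. e n x *\<^sub>R c n))\<^sup>2 = (\<Sum>n\<in>A. \<Sum>m\<in>A. Re (c n * cnj (c m)) * (e n x * e m x))" for x
  proof -
    have "(cmod (\<Sum>n\<in>A. e n x *\<^sub>R c n))\<^sup>2 = Re ((\<Sum>n\<in>A. e n x *\<^sub>R c n) * cnj (\<Sum>n\<in>A. e n x *\<^sub>R c n))"
      by (simp only: complex_mult_cnj cmod_power2 Re_complex_of_real)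
    also have "\<dots> = (\<Sum>n\<in>A. \<Sum>m\<in>A. Re (c n * cnj (c m)) * (e n x * e m x))"
      by (simp add: sum_product cnj_sum Re_sum algebra_simps scaleR_conv_of_real)
    finally show ?thesis .
  qed
  then have "integral {0..L} (\<lambda>x. (cmod (\<Sum>n\<in>A. e n x *\<^sub>R c n))\<^sup>2) =
     integral {0..L} (\<lambda>x. \<Sum>n\<in>A. \<Sum>m\<in>A. Re (c n * cnj (c m)) * (e n x * e m x))" by simp
  also have "\<dots> = (\<Sum>n\<in>A. \<Sum>m\<in>A. Re (c n * cnj (c m)) * integral {0..L} (\<lambda>x. e n x * e m x))"
    using A by (simp add: integral_sum integrable_continuous_real continuous_intros cont)
  also have "\<dots> = (\<Sum>n\<in>A. \<Sum>m\<in>A. if n = m then q * (cmod (c n))\<^sup>2 else 0)"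
    by (intro sum.cong refl) (simp add: orth cmod_power2, simp add: power2_eq_square algebra_simps)
  also have "\<dots> = q * (\<Sum>n\<in>A. (cmod (c n))\<^sup>2)" using A by (simp add: sum_distrib_left)
  finally show ?thesis .
qed

text \<open>Expand the nonnegative integral of the squared distance between \<open>g\<close> and its
  projection \<open>S\<close>. Mere square integrability of \<open>g\<close> is assumed because one
  application is to a weak derivative.\<close>

lemma bessel:
  fixes e :: "nat \<Rightarrow> real \<Rightarrow> real" and g :: "real \<Rightarrow> complex"
  assumes cont: "\<And>n. continuous_on {0..L} (e n)"
    and orth: "\<And>n m. integral {0..L} (\<lambda>x. e n x * e m x) = (if n = m then q else 0)"
    and A: "finite A" and q: "q > 0" and g: "square_integrable 0 L g"
    and c: "\<And>n. c n = (LINT x|lebesgue_on {0..L}. e n x *\<^sub>R g x) /\<^sub>R q"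
  shows "q * (\<Sum>n\<in>A. (cmod (c n))\<^sup>2) \<le> (LINT x|lebesgue_on {0..L}. (cmod (g x))\<^sup>2)"
proof -
  define S where "S x = (\<Sum>n\<in>A. e n x *\<^sub>R c n)" for x
  have Sc: "continuous_on {0..L} S" unfolding S_def by (intro continuous_intros cont)
  note gi = square_integrable_imp_integrable[OF g]
  have ei: "integrable (lebesgue_on {0..L}) (\<lambda>x. e n x *\<^sub>R g x)" for n
    by (rule integrable_bounded_scaleR[OF gi cont])
  define R where "R x = Re (cnj (S x) * g x)" for x
  have re: "R x = (\<Sum>n\<in>A. Re (cnj (c n) * (e n x *\<^sub>R g x)))" for x
    by (simp only: R_def S_def cnj_sum sum_distrib_right Re_sum) (intro sum.cong refl, simp add: algebra_simps)
  have i2: "integrable (lebesgue_on {0..L}) (\<lambda>x. R x)"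
    unfolding re using ei by (intro Bochner_Integration.integrable_sum integrable_Re integrable_mult_right) auto
  have "(LINT x|lebesgue_on {0..L}. R x) = (\<Sum>n\<in>A. LINT x|lebesgue_on {0..L}. Re (cnj (c n) * (e n x *\<^sub>R g x)))"
    unfolding re using ei by (intro Bochner_Integration.integral_sum integrable_Re integrable_mult_right) auto
  also have "\<dots> = (\<Sum>n\<in>A. Re (cnj (c n) * (LINT x|lebesgue_on {0..L}. e n x *\<^sub>R g x)))"
  proof (intro sum.cong refl)
    fix n
    have "(LINT x|lebesgue_on {0..L}. Re (cnj (c n) * (e n x *\<^sub>R g x))) = Re (LINT x|lebesgue_on {0..L}. cnj (c n) * (e n x *\<^sub>R g x))"
      using ei by (intro integral_Re integrable_mult_right) auto
    also have "(LINT x|lebesgue_on {0..L}. cnj (c n) * (e n x *\<^sub>R g x)) = cnj (c n) * (LINT x|lebesgue_on {0..L}. e n x *\<^sub>R g x)"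
      using ei by (intro Bochner_Integration.integral_mult_right) auto
    finally show "(LINT x|lebesgue_on {0..L}. Re (cnj (c n) * (e n x *\<^sub>R g x))) = Re (cnj (c n) * (LINT x|lebesgue_on {0..L}. e n x *\<^sub>R g x))" .
  qed
  also have "\<dots> = (\<Sum>n\<in>A. q * (cmod (c n))\<^sup>2)"
  proof (intro sum.cong refl)
    fix n
    have "(LINT x|lebesgue_on {0..L}. e n x *\<^sub>R g x) = q *\<^sub>R c n" using c[of n] q by simp
    then show "Re (cnj (c n) * (LINT x|lebesgue_on {0..L}. e n x *\<^sub>R g x)) = q * (cmod (c n))\<^sup>2"
      unfolding cmod_power2 by (simp add: power2_eq_square algebra_simps)
  qed
  finally have 1: "(LINT x|lebesgue_on {0..L}. R x) = q * (\<Sum>n\<in>A. (cmod (c n))\<^sup>2)"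
    by (simp add: sum_distrib_left)
  have 2: "(LINT x|lebesgue_on {0..L}. (cmod (S x))\<^sup>2) = q * (\<Sum>n\<in>A. (cmod (c n))\<^sup>2)"
    using integral_norm_sum_orthogonal[OF cont orth A, of c] 
    by (subst lint_continuous) (auto simp: S_def intro!: continuous_intros cont)
  have i3: "integrable (lebesgue_on {0..L}) (\<lambda>x. (cmod (S x))\<^sup>2)"
    by (intro continuous_imp_integrable_real continuous_intros Sc)
  have i1: "integrable (lebesgue_on {0..L}) (\<lambda>x. (cmod (g x))\<^sup>2)" using g by (simp add: square_integrable_def)
  have "0 \<le> (LINT x|lebesgue_on {0..L}. (cmod (g x - S x))\<^sup>2)" by (rule Bochner_Integration.integral_nonneg) auto
  also have "\<dots> = (LINT x|lebesgue_on {0..L}. (cmod (g x))\<^sup>2 - 2 * R x + (cmod (S x))\<^sup>2)"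
    by (rule Bochner_Integration.integral_cong[OF refl])
      (simp add: R_def cmod_power2, simp add: power2_eq_square algebra_simps)
  also have "\<dots> = (LINT x|lebesgue_on {0..L}. (cmod (g x))\<^sup>2) - 2 * (q * (\<Sum>n\<in>A. (cmod (c n))\<^sup>2)) + q * (\<Sum>n\<in>A. (cmod (c n))\<^sup>2)"
    using i1 i2 i3 by (simp add: 1 2)
  finally show ?thesis by simp
qed

text \<open>With A, B, C the mixed and the two pure integrals, the integral of (B f - A g)^2 equals
  B (C B - A^2). If B = 0, then \<open>g\<close> vanishes and so does A.\<close>

lemma integral_cauchy_schwarz:
  fixes f g :: "real \<Rightarrow> real"
  assumes f: "continuous_on {a..b} f" and g: "continuous_on {a..b} g"
  shows "(integral {a..b} (\<lambda>x. f x * g x))\<^sup>2 \<le> integral {a..b} (\<lambda>x. (f x)\<^sup>2) * integral {a..b} (\<lambda>x. (g x)\<^sup>2)"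
proof (cases "a < b")
  case True
  define A where "A = integral {a..b} (\<lambda>x. f x * g x)"
  define B where "B = integral {a..b} (\<lambda>x. (g x)\<^sup>2)"
  define C where "C = integral {a..b} (\<lambda>x. (f x)\<^sup>2)"
  have B0: "B \<ge> 0" unfolding B_def by (rule Henstock_Kurzweil_Integration.integral_nonneg) (auto intro!: integrable_continuous_real continuous_intros g)
  have "0 \<le> integral {a..b} (\<lambda>x. (B * f x - A * g x)\<^sup>2)"
    by (rule Henstock_Kurzweil_Integration.integral_nonneg) (auto intro!: integrable_continuous_real continuous_intros f g)
  also have "\<dots> = integral {a..b} (\<lambda>x. B\<^sup>2 * (f x)\<^sup>2 + A\<^sup>2 * (g x)\<^sup>2 - (2 * A * B) * (f x * g x))"
    by (rule Henstock_Kurzweil_Integration.integral_cong) (simp add: power2_eq_square algebra_simps)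
  also have "\<dots> = integral {a..b} (\<lambda>x. B\<^sup>2 * (f x)\<^sup>2 + A\<^sup>2 * (g x)\<^sup>2) - integral {a..b} (\<lambda>x. (2 * A * B) * (f x * g x))"
    by (intro integral_diff_continuous continuous_intros f g)
  also have "integral {a..b} (\<lambda>x. B\<^sup>2 * (f x)\<^sup>2 + A\<^sup>2 * (g x)\<^sup>2) = integral {a..b} (\<lambda>x. B\<^sup>2 * (f x)\<^sup>2) + integral {a..b} (\<lambda>x. A\<^sup>2 * (g x)\<^sup>2)"
    by (intro integral_add_continuous continuous_intros f g)
  also have "integral {a..b} (\<lambda>x. B\<^sup>2 * (f x)\<^sup>2) + integral {a..b} (\<lambda>x. A\<^sup>2 * (g x)\<^sup>2) - integral {a..b} (\<lambda>x. (2 * A * B) * (f x * g x)) = B * (C * B - A\<^sup>2)"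
    unfolding integral_mult_right A_def[symmetric] B_def[symmetric] C_def[symmetric]
    by (simp add: power2_eq_square algebra_simps)
  finally have *: "0 \<le> B * (C * B - A\<^sup>2)" .
  show ?thesis
  proof (cases "B = 0")
    case True
    then have "\<forall>x\<in>{a..b}. (g x)\<^sup>2 = 0"
      unfolding B_def using integral_eq_0_iff[of a b "\<lambda>x. (g x)\<^sup>2"] g \<open>a < b\<close> by (auto intro!: continuous_intros)
    then have "A = integral {a..b} (\<lambda>x. 0)" unfolding A_def by (intro Henstock_Kurzweil_Integration.integral_cong) auto
    then show ?thesis using True by (simp flip: A_def B_def)
  next
    case False
    then show ?thesis using * B0 by (simp add: zero_le_mult_iff A_def B_def C_def)
  qed
next
  case False
  then show ?thesis by (cases "a = b") auto
qed

section \<open>Fourier series for mixed boundary conditions\<close>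

locale mixed_interval =
  fixes L :: real
  assumes L_pos: "L > 0"
begin

text \<open>The sines of these frequencies vanish at 0 and have vanishing derivative at L: they are
  the eigenfunctions of minus the second derivative with the homogeneous mixed conditions, and
  \<open>mu n\<close> are the eigenvalues.\<close>

definition freq :: "nat \<Rightarrow> real" where "freq n = (real n + 1 / 2) * pi / L"
definition mu :: "nat \<Rightarrow> real" where "mu n = (freq n)\<^sup>2"

lemma freq_pos: "freq n > 0" using L_pos by (simp add: freq_def)
lemma mu_pos: "mu n > 0" using freq_pos[of n] by (simp add: mu_def)

lemma mu_ge_mu0: "mu 0 \<le> mu n"
  unfolding mu_def using L_pos by (intro power_mono) (auto simp: freq_def field_simps)

lemma freq_L: "freq n * L = real n * pi + pi / 2" using L_pos by (simp add: freq_def field_simps)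

lemma cos_freq_L: "cos (freq n * L) = 0" by (simp add: freq_L cos_add)

lemma integral_cos_zero:
  assumes "r \<noteq> 0" "sin (r * L) = 0"
  shows "integral {0..L} (\<lambda>x. cos (r * x)) = 0"
proof -
  have "((\<lambda>x. cos (r * x)) has_integral sin (r * L) / r - sin (r * 0) / r) {0..L}"
  proof (rule fundamental_theorem_of_calculus)
    show "((\<lambda>x. sin (r * x) / r) has_vector_derivative cos (r * x)) (at x within {0..L})" for x
      unfolding has_real_derivative_iff_has_vector_derivative[symmetric]
      by (rule derivative_eq_intros refl | use assms in simp)+
  qed (use L_pos in simp)
  then show ?thesis using assms by (simp add: integral_unique)
qed

lemma integral_cos_freq:
  "integral {0..L} (\<lambda>x. cos ((freq n + freq m) * x)) = 0"
  "integral {0..L} (\<lambda>x. cos ((freq n - freq m) * x)) = (if n = m then L else 0)"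
proof -
  have "(freq n + freq m) * L = real (n + m + 1) * pi" using freq_L[of n] freq_L[of m] by (simp add: algebra_simps)
  then have "sin ((freq n + freq m) * L) = 0" by (simp only: sin_npi)
  then show "integral {0..L} (\<lambda>x. cos ((freq n + freq m) * x)) = 0"
    using freq_pos[of n] freq_pos[of m] by (intro integral_cos_zero) auto
  show "integral {0..L} (\<lambda>x. cos ((freq n - freq m) * x)) = (if n = m then L else 0)"
  proof (cases "n = m")
    case False
    have "(freq n - freq m) * L = pi * of_int (int n - int m)" using freq_L[of n] freq_L[of m] by (simp add: algebra_simps)
    then have "sin ((freq n - freq m) * L) = 0" by (simp only: sin_npi_int)
    moreover have "freq n \<noteq> freq m" using False L_pos by (simp add: freq_def)
    ultimately show ?thesis using False integral_cos_zero[of "freq n - freq m"] by simp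
  qed (use L_pos in simp)
qed

lemma orthogonal_sin:
  "integral {0..L} (\<lambda>x. sin (freq n * x) * sin (freq m * x)) = (if n = m then L / 2 else 0)"
proof -
  have "integral {0..L} (\<lambda>x. sin (freq n * x) * sin (freq m * x)) =
    integral {0..L} (\<lambda>x. cos ((freq n - freq m) * x) / 2 - cos ((freq n + freq m) * x) / 2)"
    by (rule Henstock_Kurzweil_Integration.integral_cong) (simp add: left_diff_distrib distrib_right cos_diff cos_add field_simps)
  also have "\<dots> = integral {0..L} (\<lambda>x. cos ((freq n - freq m) * x) / 2) - integral {0..L} (\<lambda>x. cos ((freq n + freq m) * x) / 2)"
    by (intro integral_diff_continuous continuous_intros) auto
  finally show ?thesis by (auto simp: integral_cos_freq split: if_splits)
qed

lemma orthogonal_cos: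
  "integral {0..L} (\<lambda>x. cos (freq n * x) * cos (freq m * x)) = (if n = m then L / 2 else 0)"
proof -
  have "integral {0..L} (\<lambda>x. cos (freq n * x) * cos (freq m * x)) =
    integral {0..L} (\<lambda>x. cos ((freq n - freq m) * x) / 2 + cos ((freq n + freq m) * x) / 2)"
    by (rule Henstock_Kurzweil_Integration.integral_cong) (simp add: left_diff_distrib distrib_right cos_diff cos_add field_simps)
  also have "\<dots> = integral {0..L} (\<lambda>x. cos ((freq n - freq m) * x) / 2) + integral {0..L} (\<lambda>x. cos ((freq n + freq m) * x) / 2)"
    by (intro integral_add_continuous continuous_intros) auto
  finally show ?thesis by (auto simp: integral_cos_freq split: if_splits)
qed

lemma continuous_sin_freq [continuous_intros]: "continuous_on S (\<lambda>x. sin (freq n * x))"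
  by (intro continuous_intros)

lemma continuous_cos_freq [continuous_intros]: "continuous_on S (\<lambda>x. cos (freq n * x))"
  by (intro continuous_intros)

text \<open>Multiplication by \<open>cos (\<pi>x/L)\<close> preserves the span of the sines, so \<open>h\<close> times the first sine is
  orthogonal to all polynomials in \<open>cos (\<pi>x/L)\<close>, hence vanishes by Stone-Weierstrass.\<close>

lemma sin_complete_real:
  fixes h :: "real \<Rightarrow> real"
  assumes h: "continuous_on {0..L} h" and z: "\<And>n. integral {0..L} (\<lambda>x. sin (freq n * x) * h x) = 0"
    and x: "x \<in> {0..L}"
  shows "h x = 0"
proof -
  define C where "C x = cos (pi / L * x)" for x
  have Cc [continuous_intros]: "continuous_on S C" for S unfolding C_def by (intro continuous_intros)
  have pw: "integral {0..L} (\<lambda>x. sin (freq n * x) * C x ^ j * h x) = 0" for n j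
  proof (induction j arbitrary: n)
    case (Suc j)
    \<comment> \<open>The cosine shifts the frequency index up and down by one. Below n = 0 the
      frequency becomes - freq 0, so the lower neighbour is minus the first sine itself.\<close>
    define s where "s = (case n of 0 \<Rightarrow> - 1 | Suc m \<Rightarrow> (1::real))"
    define m where "m = (case n of 0 \<Rightarrow> 0 | Suc m \<Rightarrow> m)"
    have e: "sin (freq n * x) * C x = (sin (freq (Suc n) * x) + s * sin (freq m * x)) / 2" for x
    proof -
      have 1: "freq (Suc n) * x = freq n * x + pi / L * x" using L_pos by (simp add: freq_def field_simps)
      have 2: "s * sin (freq m * x) = sin (freq n * x - pi / L * x)"
      proof (cases n)
        case 0
        then have "sin (freq n * x - pi / L * x) = sin (- (freq 0 * x))" 
          using L_pos by (intro arg_cong[where f=sin]) (simp add: freq_def field_simps)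
        then show ?thesis using 0 by (simp only: s_def m_def nat.case sin_minus)
      next
        case (Suc k)
        then have "freq n * x - pi / L * x = freq k * x" using L_pos by (simp add: freq_def field_simps)
        then show ?thesis using Suc by (simp add: s_def m_def)
      qed
      show ?thesis unfolding 1 2 by (simp add: sin_add sin_diff C_def)
    qed
    have "integral {0..L} (\<lambda>x. sin (freq n * x) * C x ^ Suc j * h x) =
      integral {0..L} (\<lambda>x. (1/2) * (sin (freq (Suc n) * x) * C x ^ j * h x) + (s / 2) * (sin (freq m * x) * C x ^ j * h x))"
    proof (rule Henstock_Kurzweil_Integration.integral_cong)
      fix x
      have "sin (freq n * x) * C x ^ Suc j * h x = (sin (freq n * x) * C x) * C x ^ j * h x" by simp
      then show "sin (freq n * x) * C x ^ Suc j * h x = (1/2) * (sin (freq (Suc n) * x) * C x ^ j * h x) + (s / 2) * (sin (freq m * x) * C x ^ j * h x)"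
        unfolding e by (simp add: field_simps)
    qed
    also have "\<dots> = integral {0..L} (\<lambda>x. (1/2) * (sin (freq (Suc n) * x) * C x ^ j * h x)) + integral {0..L} (\<lambda>x. (s / 2) * (sin (freq m * x) * C x ^ j * h x))"
      by (intro integral_add_continuous continuous_intros h)
    finally show ?case by (simp only: integral_mult_right Suc.IH)
  qed (use z in simp)
  define H where "H x = h x * sin (freq 0 * x)" for x
  have Hc [continuous_intros]: "continuous_on {0..L} H" unfolding H_def by (intro continuous_intros h)
  have C_range: "C x \<in> {-1..1}" for x by (simp add: C_def)
  have arcC: "L * arccos (C x) / pi = x" if "x \<in> {0..L}" for x
  proof -
    have "pi / L * x \<le> pi" "0 \<le> pi / L * x" using that L_pos by (auto simp: field_simps)
    then show ?thesis using L_pos by (simp add: C_def arccos_cos)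
  qed
  have approx: "integral {0..L} (\<lambda>x. (H x)\<^sup>2) \<le> e * integral {0..L} (\<lambda>x. \<bar>H x\<bar>)" if "e > 0" for e
  proof -
    \<comment> \<open>As x runs through \<open>{0..L}\<close>, the angle of the cosine runs through
      [0,pi], where \<open>arccos\<close> inverts it; so \<open>H\<close> is a continuous function
      of \<open>C x\<close> and is uniformly close to a polynomial in it.\<close>
    define \<phi> where "\<phi> y = H (L * arccos y / pi)" for y
    have \<phi>c: "continuous_on {-1..1} \<phi>" unfolding \<phi>_def
      by (rule continuous_on_compose2[OF Hc])
        (use L_pos arccos_lbound arccos_ubound in \<open>auto intro!: continuous_intros continuous_on_arccos' simp: field_simps mult_left_mono\<close>)
    obtain p where p: "real_polynomial_function p" "\<And>y. y \<in> {-1..1} \<Longrightarrow> \<bar>\<phi> y - p y\<bar> < e"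
      by (rule Stone_Weierstrass_real_polynomial_function[OF compact_Icc \<phi>c \<open>e > 0\<close>]) blast
    then obtain a N where a: "p = (\<lambda>y. \<Sum>i\<le>(N::nat). a i * y ^ i)" 
      using real_polynomial_function_iff_sum[of p] by blast
    have pc: "continuous_on {0..L} (\<lambda>x. p (C x))" unfolding a by (intro continuous_intros)
    have ap: "\<bar>H x - p (C x)\<bar> \<le> e" if "x \<in> {0..L}" for x
      using p(2)[OF C_range[of x]] arcC[OF that] by (simp add: \<phi>_def)
    have "integral {0..L} (\<lambda>x. H x * p (C x)) = integral {0..L} (\<lambda>x. \<Sum>i\<le>N. a i * (sin (freq 0 * x) * C x ^ i * h x))"
      by (rule Henstock_Kurzweil_Integration.integral_cong) (simp add: a H_def sum_distrib_left algebra_simps)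
    also have "\<dots> = (\<Sum>i\<le>N. integral {0..L} (\<lambda>x. a i * (sin (freq 0 * x) * C x ^ i * h x)))"
      by (intro Henstock_Kurzweil_Integration.integral_sum integrable_continuous_real continuous_intros h) simp
    also have "\<dots> = 0" by (simp only: integral_mult_right pw) simp
    finally have p0: "integral {0..L} (\<lambda>x. H x * p (C x)) = 0" .
    have "integral {0..L} (\<lambda>x. (H x)\<^sup>2) = integral {0..L} (\<lambda>x. (H x)\<^sup>2) - integral {0..L} (\<lambda>x. H x * p (C x))" by (simp add: p0)
    also have "\<dots> = integral {0..L} (\<lambda>x. (H x)\<^sup>2 - H x * p (C x))"
      by (intro integral_diff_continuous[symmetric] continuous_intros pc)
    also have "\<dots> \<le> integral {0..L} (\<lambda>x. e * \<bar>H x\<bar>)"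
    proof (rule integral_le)
      show "(\<lambda>x. (H x)\<^sup>2 - H x * p (C x)) integrable_on {0..L}" "(\<lambda>x. e * \<bar>H x\<bar>) integrable_on {0..L}"
        by (intro integrable_continuous_real continuous_intros pc)+
      fix x assume "x \<in> {0..L}"
      have "(H x)\<^sup>2 - H x * p (C x) = H x * (H x - p (C x))" by (simp add: power2_eq_square algebra_simps)
      also have "\<dots> \<le> \<bar>H x\<bar> * \<bar>H x - p (C x)\<bar>" by (metis abs_ge_self abs_mult)
      also have "\<dots> \<le> \<bar>H x\<bar> * e" using ap[OF \<open>x \<in> {0..L}\<close>] by (intro mult_left_mono) auto
      finally show "(H x)\<^sup>2 - H x * p (C x) \<le> e * \<bar>H x\<bar>" by (simp add: mult.commute)
    qed
    finally show ?thesis by simp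
  qed
  have "integral {0..L} (\<lambda>x. (H x)\<^sup>2) \<le> 0"
  proof (rule tendsto_lowerbound[where F="at_right 0"])
    have "((\<lambda>e. e * integral {0..L} (\<lambda>x. \<bar>H x\<bar>)) \<longlongrightarrow> 0 * integral {0..L} (\<lambda>x. \<bar>H x\<bar>)) (at_right 0)" by (intro tendsto_intros)
    then show "((\<lambda>e. e * integral {0..L} (\<lambda>x. \<bar>H x\<bar>)) \<longlongrightarrow> 0) (at_right 0)" by simp
    show "\<forall>\<^sub>F e in at_right 0. integral {0..L} (\<lambda>x. (H x)\<^sup>2) \<le> e * integral {0..L} (\<lambda>x. \<bar>H x\<bar>)"
      using approx by (simp add: eventually_at_right_less eventually_at_filter)
  qed simp
  moreover have "integral {0..L} (\<lambda>x. (H x)\<^sup>2) \<ge> 0"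
    by (rule Henstock_Kurzweil_Integration.integral_nonneg) (auto intro!: integrable_continuous_real continuous_intros)
  ultimately have "\<forall>x\<in>{0..L}. (H x)\<^sup>2 = 0"
    using integral_eq_0_iff[of 0 L "\<lambda>x. (H x)\<^sup>2"] L_pos by (auto intro!: continuous_intros)
  then have H0: "h x * sin (freq 0 * x) = 0" if "x \<in> {0..L}" for x using that by (auto simp: H_def)
  \<comment> \<open>The first sine is positive on (0,L] because freq 0 * L = pi/2; the point 0 is
    reached by continuity.\<close>
  have h0: "h x = 0" if x: "x \<in> {0<..L}" for x
  proof -
    have "freq 0 * x \<le> freq 0 * L" using x freq_pos[of 0] by (intro mult_left_mono) auto
    moreover have "freq 0 * L = pi / 2" using freq_L[of 0] by simp
    ultimately have "freq 0 * x < pi" using pi_gt_zero by linarith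
    then have "sin (freq 0 * x) > 0" using x freq_pos[of 0] by (intro sin_gt_zero) auto
    then show ?thesis using H0[of x] x by auto
  qed
  show "h x = 0"
    by (rule continuous_constant_on_closure[of "{0<..L}" h 0 x]) (use h h0 x L_pos in auto)
qed

lemma sin_complete:
  fixes h :: "real \<Rightarrow> complex"
  assumes h: "continuous_on {0..L} h" and z: "\<And>n. integral {0..L} (\<lambda>x. sin (freq n * x) *\<^sub>R h x) = 0"
    and x: "x \<in> {0..L}"
  shows "h x = 0"
proof -
  have i: "(\<lambda>x. sin (freq n * x) *\<^sub>R h x) integrable_on {0..L}" for n
    by (intro integrable_continuous_real continuous_intros h)
  have "integral {0..L} (\<lambda>x. sin (freq n * x) * Re (h x)) = 0" for n
    using integral_linear[OF i bounded_linear_Re] z[of n] by (simp add: o_def)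
  then have "Re (h x) = 0" by (intro sin_complete_real[where h="\<lambda>x. Re (h x)"] continuous_intros h x)
  moreover have "integral {0..L} (\<lambda>x. sin (freq n * x) * Im (h x)) = 0" for n
    using integral_linear[OF i bounded_linear_Im] z[of n] by (simp add: o_def)
  then have "Im (h x) = 0" by (intro sin_complete_real[where h="\<lambda>x. Im (h x)"] continuous_intros h x)
  ultimately show ?thesis by (simp add: complex_eq_iff)
qed

end

section \<open>Sine series of finite energy\<close>

context mixed_interval
begin

definition sin_series :: "(nat \<Rightarrow> complex) \<Rightarrow> real \<Rightarrow> complex" where
  "sin_series c x = (\<Sum>n. sin (freq n * x) *\<^sub>R c n)"

text \<open>Up to the factor L/2, the squared L2 norm of the space derivative of
  \<open>sin_series c\<close>.\<close>

definition energy :: "(nat \<Rightarrow> complex) \<Rightarrow> real" where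
  "energy c = (\<Sum>n. mu n * (cmod (c n))\<^sup>2)"

definition finite_energy :: "(nat \<Rightarrow> complex) \<Rightarrow> bool" where
  "finite_energy c \<longleftrightarrow> summable (\<lambda>n. mu n * (cmod (c n))\<^sup>2)"

lemma summable_inverse_mu: "summable (\<lambda>n. 1 / mu n)"
proof (rule summable_comparison_test)
  have "summable (\<lambda>n. 1 / (real (Suc n))\<^sup>2)"
    using inverse_squares_sums by (auto simp: sums_iff)
  then show "summable (\<lambda>n. (4 * L\<^sup>2 / pi\<^sup>2) * (1 / (real (Suc n))\<^sup>2))" by (rule summable_mult)
  have "norm (1 / mu n) \<le> (4 * L\<^sup>2 / pi\<^sup>2) * (1 / (real (Suc n))\<^sup>2)" for n
  proof -
    have "real (Suc n) / 2 * pi / L \<le> freq n" unfolding freq_def using L_pos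
      by (intro divide_right_mono mult_right_mono) auto
    then have "(real (Suc n) / 2 * pi / L)\<^sup>2 \<le> mu n" unfolding mu_def using L_pos by (intro power_mono) auto
    moreover have "(real (Suc n) / 2 * pi / L)\<^sup>2 > 0" using L_pos by (intro zero_less_power) auto
    ultimately have "1 / mu n \<le> 1 / (real (Suc n) / 2 * pi / L)\<^sup>2" by (intro divide_left_mono mult_pos_pos mu_pos) auto
    also have "\<dots> = (4 * L\<^sup>2 / pi\<^sup>2) * (1 / (real (Suc n))\<^sup>2)" using L_pos by (simp add: power_divide power_mult_distrib)
    finally show ?thesis using mu_pos[of n] by simp
  qed
  then show "\<exists>N. \<forall>n\<ge>N. norm (1 / mu n) \<le> (4 * L\<^sup>2 / pi\<^sup>2) * (1 / (real (Suc n))\<^sup>2)" by blast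
qed

text \<open>The arithmetic-geometric mean inequality for 1 / freq n and freq n * r. As 1 / mu n is
  summable, a summable bound on the energy terms becomes one on the coefficients themselves, hence
  uniform convergence of the sine series.\<close>

lemma mode_le: "r \<le> (1 / mu n + mu n * r\<^sup>2) / 2"
proof -
  have "0 \<le> (1 / freq n - freq n * r)\<^sup>2" by simp
  also have "\<dots> = 1 / mu n + mu n * r\<^sup>2 - 2 * r"
    using freq_pos[of n] by (simp add: power2_diff mu_def power_mult_distrib power_divide)
  finally show ?thesis by simp
qed

lemma summable_mode_bound:
  assumes "summable m"
  shows "summable (\<lambda>n. (1 / mu n + m n) / 2)"
  by (intro summable_divide summable_add summable_inverse_mu assms)

lemma norm_mode_le:
  assumes "mu n * (cmod c)\<^sup>2 \<le> m"
  shows "norm (sin r *\<^sub>R c) \<le> (1 / mu n + m) / 2"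
proof -
  have "norm (sin r *\<^sub>R c) \<le> 1 * cmod c" unfolding norm_scaleR by (intro mult_right_mono) auto
  then show ?thesis using mode_le[of "cmod c" n] assms by simp
qed

lemma sin_series_uniform_limit:
  assumes w: "\<And>n t. t \<in> X \<Longrightarrow> mu n * (cmod (w n t))\<^sup>2 \<le> m n" and m: "summable m"
  shows "uniform_limit (X \<times> UNIV) (\<lambda>N (t, x). \<Sum>n<N. sin (freq n * x) *\<^sub>R w n t) (\<lambda>(t, x). sin_series (\<lambda>n. w n t) x) sequentially"
proof -
  have "uniform_limit (X \<times> UNIV) (\<lambda>N tx. \<Sum>n<N. sin (freq n * snd tx) *\<^sub>R w n (fst tx)) (\<lambda>tx. \<Sum>n. sin (freq n * snd tx) *\<^sub>R w n (fst tx)) sequentially"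
    by (rule Weierstrass_m_test[OF norm_mode_le summable_mode_bound[OF m]]) (use w in auto)
  then show ?thesis by (simp add: sin_series_def case_prod_beta')
qed

lemma sin_series_continuous:
  fixes X :: "real set"
  assumes w: "\<And>n t. t \<in> X \<Longrightarrow> mu n * (cmod (w n t))\<^sup>2 \<le> m n" and m: "summable m"
    and c: "\<And>n. continuous_on X (w n)"
  shows "continuous_on (X \<times> Y) (\<lambda>(t, x). sin_series (\<lambda>n. w n t) x)"
proof -
  have "continuous_on (X \<times> UNIV) (\<lambda>(t, x). sin_series (\<lambda>n. w n t) x)"
  proof (rule uniform_limit_theorem[OF always_eventually sin_series_uniform_limit[OF w m]])
    have sn: "continuous_on (X \<times> UNIV) (\<lambda>z. sin (freq n * snd z))" for n
      by (rule continuous_on_sin) (rule continuous_on_mult[OF continuous_on_const continuous_on_snd[OF continuous_on_id]])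
    have wn: "continuous_on (X \<times> UNIV) (\<lambda>z. w n (fst z))" for n
      by (rule continuous_on_compose2[OF c continuous_on_fst[OF continuous_on_id]]) auto
    show "\<forall>N. continuous_on (X \<times> UNIV) (\<lambda>(t, x). \<Sum>n<N. sin (freq n * x) *\<^sub>R w n t)"
      unfolding case_prod_beta'
      by (intro allI continuous_on_sum continuous_on_scaleR sn wn)
  qed auto
  then show ?thesis by (rule continuous_on_subset) auto
qed

lemma sin_series_continuous_on:
  assumes "finite_energy c"
  shows "continuous_on Y (sin_series c)"
proof -
  \<comment> \<open>A singleton serves as a dummy time set.\<close>
  have "continuous_on ({0::real} \<times> Y) (\<lambda>(t, x). sin_series (\<lambda>n. c n) x)"
    by (rule sin_series_continuous[where m="\<lambda>n. mu n * (cmod (c n))\<^sup>2"]) (use assms in \<open>auto simp: finite_energy_def\<close>)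
  moreover have "continuous_on Y (\<lambda>x. (0::real, x))" by (intro continuous_intros)
  ultimately have "continuous_on Y (\<lambda>x. case (0::real, x) of (t, x) \<Rightarrow> sin_series (\<lambda>n. c n) x)"
    by (rule continuous_on_compose2) auto
  then show ?thesis by simp
qed

lemma summable_sin_series:
  assumes "finite_energy c"
  shows "summable (\<lambda>n. sin (freq n * x) *\<^sub>R c n)"
  by (rule summable_comparison_test'[OF summable_mode_bound[OF assms[unfolded finite_energy_def]] norm_mode_le]) simp

lemma finite_energy_le:
  assumes "finite_energy c" "\<And>n. cmod (d n) \<le> cmod (c n)"
  shows "finite_energy d"
  unfolding finite_energy_def
proof (rule summable_comparison_test'[OF assms(1)[unfolded finite_energy_def]])
  fix n
  show "norm (mu n * (cmod (d n))\<^sup>2) \<le> mu n * (cmod (c n))\<^sup>2"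
    using mu_pos[of n] power_mono[OF assms(2)[of n] norm_ge_zero, of 2] by simp
qed

lemma finite_energyI:
  assumes "\<And>n. mu n * (cmod (c n))\<^sup>2 \<le> m n" "summable m"
  shows "finite_energy c"
  unfolding finite_energy_def
  by (rule summable_comparison_test[OF _ assms(2)]) (use assms(1) mu_pos in \<open>auto simp: less_imp_le\<close>)

lemma finite_energy_diff:
  assumes "finite_energy c" "finite_energy d"
  shows "finite_energy (\<lambda>n. c n - d n)"
proof (rule finite_energyI)
  show "summable (\<lambda>n. 2 * (mu n * (cmod (c n))\<^sup>2) + 2 * (mu n * (cmod (d n))\<^sup>2))"
    using assms by (intro summable_add summable_mult) (auto simp: finite_energy_def)
  fix n
  have "mu n * (cmod (c n - d n))\<^sup>2 \<le> mu n * (2 * (cmod (c n))\<^sup>2 + 2 * (cmod (d n))\<^sup>2)"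
    using mu_pos[of n] by (intro mult_left_mono norm_diff_sq_le) auto
  then show "mu n * (cmod (c n - d n))\<^sup>2 \<le> 2 * (mu n * (cmod (c n))\<^sup>2) + 2 * (mu n * (cmod (d n))\<^sup>2)"
    by (simp add: algebra_simps)
qed

lemma sin_series_diff:
  assumes "finite_energy c" "finite_energy d"
  shows "sin_series (\<lambda>n. c n - d n) x = sin_series c x - sin_series d x"
  unfolding sin_series_def by (subst suminf_diff) (use assms summable_sin_series in \<open>auto simp: scaleR_diff_right\<close>)

lemma sin_series_add:
  assumes "finite_energy c" "finite_energy d"
  shows "sin_series (\<lambda>n. c n + d n) x = sin_series c x + sin_series d x"
  unfolding sin_series_def by (subst suminf_add) (use assms summable_sin_series in \<open>auto simp: scaleR_add_right\<close>)

lemma summable_sq: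
  assumes "finite_energy c"
  shows "summable (\<lambda>n. (cmod (c n))\<^sup>2)"
proof (rule summable_comparison_test)
  show "summable (\<lambda>n. (1 / mu 0) * (mu n * (cmod (c n))\<^sup>2))"
    using assms by (intro summable_mult) (auto simp: finite_energy_def)
  have "(cmod (c n))\<^sup>2 \<le> (1 / mu 0) * (mu n * (cmod (c n))\<^sup>2)" for n
    using mu_pos[of 0] mult_right_mono[OF mu_ge_mu0[of n], of "(cmod (c n))\<^sup>2"] by (simp add: field_simps)
  then show "\<exists>N. \<forall>n\<ge>N. norm ((cmod (c n))\<^sup>2) \<le> (1 / mu 0) * (mu n * (cmod (c n))\<^sup>2)" by auto
qed

lemma suminf_sq_le_energy:
  assumes "finite_energy c"
  shows "(\<Sum>n. (cmod (c n))\<^sup>2) \<le> energy c / mu 0"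
proof -
  have "(\<Sum>n. (cmod (c n))\<^sup>2) \<le> (\<Sum>n. (1 / mu 0) * (mu n * (cmod (c n))\<^sup>2))"
  proof (rule suminf_le)
    show "(cmod (c n))\<^sup>2 \<le> (1 / mu 0) * (mu n * (cmod (c n))\<^sup>2)" for n
      using mu_pos[of 0] mult_right_mono[OF mu_ge_mu0[of n], of "(cmod (c n))\<^sup>2"] by (simp add: field_simps)
    show "summable (\<lambda>n. (1 / mu 0) * (mu n * (cmod (c n))\<^sup>2))"
      using assms by (intro summable_mult) (auto simp: finite_energy_def)
  qed (rule summable_sq[OF assms])
  also have "\<dots> = (1 / mu 0) * energy c" unfolding energy_def
    by (rule suminf_mult) (use assms in \<open>auto simp: finite_energy_def\<close>)
  finally show ?thesis by simp
qed

text \<open>Termwise integration under uniform convergence. For \<open>\<psi>\<close> a sine it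
  recovers the coefficients, for the conjugate of the series it is Parseval's identity, and for the
  conjugate forcing it is the work term of the energy identity.\<close>

lemma sin_series_pairing:
  assumes c: "finite_energy c" and \<psi>: "continuous_on {0..L} \<psi>"
  shows "(\<lambda>n. c n * integral {0..L} (\<lambda>x. sin (freq n * x) *\<^sub>R \<psi> x)) sums integral {0..L} (\<lambda>x. sin_series c x * \<psi> x)"
proof -
  obtain B where B: "\<forall>x\<in>{0..L}. cmod (\<psi> x) \<le> B"
    using compact_imp_bounded[OF compact_continuous_image[OF \<psi>]] by (auto simp: bounded_iff)
  have "uniform_limit {0..L} (\<lambda>N x. \<Sum>n<N. (sin (freq n * x) *\<^sub>R c n) * \<psi> x) (\<lambda>x. \<Sum>n. (sin (freq n * x) *\<^sub>R c n) * \<psi> x) sequentially"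
  proof (rule Weierstrass_m_test)
    show "summable (\<lambda>n. (1 / mu n + mu n * (cmod (c n))\<^sup>2) / 2 * B)"
      using c by (intro summable_mult2 summable_mode_bound) (auto simp: finite_energy_def)
    fix n x assume x: "x \<in> {0..L}"
    show "norm ((sin (freq n * x) *\<^sub>R c n) * \<psi> x) \<le> (1 / mu n + mu n * (cmod (c n))\<^sup>2) / 2 * B"
      unfolding norm_mult[of "sin (freq n * x) *\<^sub>R c n"]
    proof (rule mult_mono)
      show "norm (sin (freq n * x) *\<^sub>R c n) \<le> (1 / mu n + mu n * (cmod (c n))\<^sup>2) / 2" by (rule norm_mode_le) simp
      show "norm (\<psi> x) \<le> B" using B x by blast
      show "0 \<le> (1 / mu n + mu n * (cmod (c n))\<^sup>2) / 2" using mu_pos[of n] by (simp add: less_imp_le)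
    qed simp
  qed
  moreover have "(\<Sum>n. (sin (freq n * x) *\<^sub>R c n) * \<psi> x) = sin_series c x * \<psi> x" for x
    unfolding sin_series_def by (rule suminf_mult2[symmetric]) (rule summable_sin_series[OF c])
  ultimately have ul: "uniform_limit {0..L} (\<lambda>N x. \<Sum>n<N. (sin (freq n * x) *\<^sub>R c n) * \<psi> x) (\<lambda>x. sin_series c x * \<psi> x) sequentially" by simp
  obtain I J where IJ: "\<And>N. ((\<lambda>x. \<Sum>n<N. (sin (freq n * x) *\<^sub>R c n) * \<psi> x) has_integral I N) {0..L}"
    "((\<lambda>x. sin_series c x * \<psi> x) has_integral J) {0..L}" "(I \<longlongrightarrow> J) sequentially"
    by (rule uniform_limit_integral[OF ul]) (auto intro!: continuous_intros \<psi>)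
  have I: "I N = (\<Sum>n<N. c n * integral {0..L} (\<lambda>x. sin (freq n * x) *\<^sub>R \<psi> x))" for N
  proof -
    have "I N = integral {0..L} (\<lambda>x. \<Sum>n<N. (sin (freq n * x) *\<^sub>R c n) * \<psi> x)" by (rule integral_unique[OF IJ(1), symmetric])
    also have "\<dots> = (\<Sum>n<N. integral {0..L} (\<lambda>x. (sin (freq n * x) *\<^sub>R c n) * \<psi> x))"
      by (intro Henstock_Kurzweil_Integration.integral_sum integrable_continuous_real continuous_intros \<psi>) simp
    also have "\<dots> = (\<Sum>n<N. integral {0..L} (\<lambda>x. c n * (sin (freq n * x) *\<^sub>R \<psi> x)))"
      by (simp add: mult.commute)
    finally show ?thesis by (simp only: integral_mult_right)
  qed
  show ?thesis using IJ(3) integral_unique[OF IJ(2)] unfolding sums_def I[symmetric] by simp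
qed

lemma integral_sin_sin_series:
  assumes c: "finite_energy c"
  shows "integral {0..L} (\<lambda>x. sin (freq m * x) *\<^sub>R sin_series c x) = (L / 2) *\<^sub>R c m"
proof -
  have cs: "continuous_on {0..L} (\<lambda>x. complex_of_real (sin (freq m * x)))" by (intro continuous_intros)
  have o: "integral {0..L} (\<lambda>x. sin (freq n * x) *\<^sub>R complex_of_real (sin (freq m * x))) = (if n = m then of_real (L / 2) else 0)" for n
  proof -
    have "integral {0..L} (\<lambda>x. sin (freq n * x) *\<^sub>R complex_of_real (sin (freq m * x))) = integral {0..L} (\<lambda>x. complex_of_real (sin (freq n * x) * sin (freq m * x)))"
      by (simp add: scaleR_conv_of_real)
    also have "\<dots> = complex_of_real (integral {0..L} (\<lambda>x. sin (freq n * x) * sin (freq m * x)))"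
      using integral_linear[OF integrable_continuous_real bounded_linear_of_real, of 0 L "\<lambda>x. sin (freq n * x) * sin (freq m * x)"]
      by (simp add: o_def continuous_intros)
    finally show ?thesis by (simp add: orthogonal_sin)
  qed
  have "(\<lambda>n. c n * (if n = m then of_real (L / 2) else 0)) sums integral {0..L} (\<lambda>x. sin_series c x * complex_of_real (sin (freq m * x)))"
    using sin_series_pairing[OF c cs] unfolding o .
  moreover have "(\<lambda>n. c n * (if n = m then of_real (L / 2) else 0)) sums (c m * of_real (L / 2))"
    using sums_single[of m "\<lambda>n. c n * of_real (L / 2)"] by (simp add: if_distrib cong: if_cong)
  ultimately have "integral {0..L} (\<lambda>x. sin_series c x * complex_of_real (sin (freq m * x))) = c m * of_real (L / 2)" by (rule sums_unique2)
  then show ?thesis by (simp add: scaleR_conv_of_real mult.commute)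
qed

lemma sums_real_of_complex: "(\<lambda>n. complex_of_real (f n)) sums z \<Longrightarrow> f sums Re z"
  using sums_Re by fastforce

lemma parseval_sin:
  assumes c: "finite_energy c"
  shows "integral {0..L} (\<lambda>x. (cmod (sin_series c x))\<^sup>2) = L / 2 * (\<Sum>n. (cmod (c n))\<^sup>2)"
proof -
  note sc = sin_series_continuous_on[OF c]
  have cs: "continuous_on {0..L} (\<lambda>x. cnj (sin_series c x))" by (intro continuous_intros sc)
  have i: "integral {0..L} (\<lambda>x. sin (freq n * x) *\<^sub>R cnj (sin_series c x)) = cnj ((L / 2) *\<^sub>R c n)" for n
  proof -
    have "integral {0..L} (\<lambda>x. cnj (sin (freq n * x) *\<^sub>R sin_series c x)) = cnj (integral {0..L} (\<lambda>x. sin (freq n * x) *\<^sub>R sin_series c x))"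
      using integral_linear[OF integrable_continuous_real bounded_linear_cnj, of 0 L "\<lambda>x. sin (freq n * x) *\<^sub>R sin_series c x"]
      by (simp add: o_def continuous_intros sc)
    then show ?thesis by (simp add: integral_sin_sin_series[OF c])
  qed
  have "(\<lambda>n. c n * cnj ((L / 2) *\<^sub>R c n)) sums integral {0..L} (\<lambda>x. sin_series c x * cnj (sin_series c x))"
    using sin_series_pairing[OF c cs] unfolding i .
  moreover have "c n * cnj ((L / 2) *\<^sub>R c n) = complex_of_real (L / 2 * (cmod (c n))\<^sup>2)" for n
    unfolding of_real_mult complex_norm_square scaleR_conv_of_real by simp
  ultimately have "(\<lambda>n. complex_of_real (L / 2 * (cmod (c n))\<^sup>2)) sums integral {0..L} (\<lambda>x. sin_series c x * cnj (sin_series c x))"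
    by (simp only:)
  then have 1: "(\<lambda>n. L / 2 * (cmod (c n))\<^sup>2) sums Re (integral {0..L} (\<lambda>x. sin_series c x * cnj (sin_series c x)))"
    by (rule sums_real_of_complex)
  have 2: "Re (integral {0..L} (\<lambda>x. sin_series c x * cnj (sin_series c x))) = integral {0..L} (\<lambda>x. (cmod (sin_series c x))\<^sup>2)"
  proof -
    have "integral {0..L} (\<lambda>x. Re (sin_series c x * cnj (sin_series c x))) = Re (integral {0..L} (\<lambda>x. sin_series c x * cnj (sin_series c x)))"
      using integral_linear[OF integrable_continuous_real bounded_linear_Re, of 0 L "\<lambda>x. sin_series c x * cnj (sin_series c x)"]
      by (simp add: o_def continuous_intros sc)
    moreover have "Re (sin_series c x * cnj (sin_series c x)) = (cmod (sin_series c x))\<^sup>2" for x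
      by (simp only: complex_mult_cnj cmod_power2 Re_complex_of_real)
    ultimately show ?thesis by simp
  qed
  have "(\<lambda>n. L / 2 * (cmod (c n))\<^sup>2) sums (L / 2 * (\<Sum>n. (cmod (c n))\<^sup>2))"
    by (intro sums_mult summable_sums summable_sq c)
  with 1 2 show ?thesis using sums_unique2 by metis
qed

section \<open>The derivative of a sine series: Agmon's inequality and weak
  differentiability\<close>

lemma sin_sum_vector_derivative:
  "((\<lambda>x. \<Sum>n<N. sin (freq n * x) *\<^sub>R (c n :: complex)) has_vector_derivative
    (\<Sum>n<N. cos (freq n * x) *\<^sub>R (freq n *\<^sub>R c n))) (at x within Y)"
proof (rule has_vector_derivative_sum)
  fix n
  have "((\<lambda>x. sin (freq n * x)) has_real_derivative cos (freq n * x) * freq n) (at x within Y)"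
    by (rule derivative_eq_intros refl | simp)+
  from has_vector_derivative_scaleR[OF this has_vector_derivative_const[of "c n"]]
  show "((\<lambda>x. sin (freq n * x) *\<^sub>R c n) has_vector_derivative cos (freq n * x) *\<^sub>R freq n *\<^sub>R c n) (at x within Y)" by simp
qed

text \<open>As the sum \<open>S\<close> vanishes at 0, its squared modulus at x is the integral of 2
  S . S' from 0. Cauchy-Schwarz and the orthogonality of sines and of cosines finish; the two
  factors L/2 and the squared 2 combine to L^2.\<close>

lemma agmon_sum:
  assumes x: "x \<in> {0..L}"
  shows "(cmod (\<Sum>n<N. sin (freq n * x) *\<^sub>R c n)) ^ 4 \<le> L\<^sup>2 * (\<Sum>n<N. (cmod (c n))\<^sup>2) * (\<Sum>n<N. mu n * (cmod (c n))\<^sup>2)"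
proof -
  define S where "S x = (\<Sum>n<N. sin (freq n * x) *\<^sub>R c n)" for x
  define D where "D x = (\<Sum>n<N. cos (freq n * x) *\<^sub>R (freq n *\<^sub>R c n))" for x
  have Sc [continuous_intros]: "continuous_on Y S" for Y unfolding S_def by (intro continuous_intros)
  have Dc [continuous_intros]: "continuous_on Y D" for Y unfolding D_def by (intro continuous_intros)
  have SD: "(S has_vector_derivative D x) (at x within Y)" for x Y
    unfolding S_def D_def by (rule sin_sum_vector_derivative)
  have I0: "((\<lambda>x. 2 * (S x \<bullet> D x)) has_integral (S x \<bullet> S x - S 0 \<bullet> S 0)) {0..x}"
  proof (rule fundamental_theorem_of_calculus)
    show "((\<lambda>x. S x \<bullet> S x) has_vector_derivative 2 * (S y \<bullet> D y)) (at y within {0..x})" for y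
      using bounded_bilinear.has_vector_derivative[OF bounded_bilinear_inner SD SD, of y "{0..x}"] by (simp add: inner_commute)
  qed (use x in simp)
  have "S 0 = 0" by (simp add: S_def)
  then have "integral {0..x} (\<lambda>x. 2 * (S x \<bullet> D x)) = S x \<bullet> S x" using integral_unique[OF I0] by simp
  then have "(cmod (S x))\<^sup>2 = integral {0..x} (\<lambda>x. 2 * (S x \<bullet> D x))" by (simp only: power2_norm_eq_inner)
  also have "\<dots> \<le> integral {0..x} (\<lambda>x. 2 * (cmod (S x) * cmod (D x)))"
    by (intro integral_le integrable_continuous_real continuous_intros mult_left_mono) (auto simp: norm_cauchy_schwarz)
  also have "\<dots> \<le> integral {0..L} (\<lambda>x. 2 * (cmod (S x) * cmod (D x)))"
    by (intro integral_subset_le integrable_continuous_real continuous_intros) (use x in auto)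
  also have "\<dots> = 2 * integral {0..L} (\<lambda>x. cmod (S x) * cmod (D x))" by simp
  finally have "((cmod (S x))\<^sup>2)\<^sup>2 \<le> (2 * integral {0..L} (\<lambda>x. cmod (S x) * cmod (D x)))\<^sup>2" by (rule power_mono) simp
  also have "\<dots> = 4 * (integral {0..L} (\<lambda>x. cmod (S x) * cmod (D x)))\<^sup>2" by (simp add: power_mult_distrib)
  also have "\<dots> \<le> 4 * (integral {0..L} (\<lambda>x. (cmod (S x))\<^sup>2) * integral {0..L} (\<lambda>x. (cmod (D x))\<^sup>2))"
    by (intro mult_left_mono integral_cauchy_schwarz continuous_intros) auto
  also have "integral {0..L} (\<lambda>x. (cmod (S x))\<^sup>2) = L / 2 * (\<Sum>n<N. (cmod (c n))\<^sup>2)"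
    unfolding S_def by (rule integral_norm_sum_orthogonal[OF _ orthogonal_sin]) (auto intro!: continuous_intros)
  also have "integral {0..L} (\<lambda>x. (cmod (D x))\<^sup>2) = L / 2 * (\<Sum>n<N. (cmod (freq n *\<^sub>R c n))\<^sup>2)"
    unfolding D_def by (rule integral_norm_sum_orthogonal[OF _ orthogonal_cos]) (auto intro!: continuous_intros)
  also have "(\<Sum>n<N. (cmod (freq n *\<^sub>R c n))\<^sup>2) = (\<Sum>n<N. mu n * (cmod (c n))\<^sup>2)"
    by (simp add: power_mult_distrib mu_def)
  finally show ?thesis by (simp add: S_def power2_eq_square power4_eq_xxxx mult_ac)
qed

lemma agmon:
  assumes c: "finite_energy c" and x: "x \<in> {0..L}"
  shows "(cmod (sin_series c x)) ^ 4 \<le> L\<^sup>2 * (\<Sum>n. (cmod (c n))\<^sup>2) * energy c"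
proof (rule LIMSEQ_le)
  show "(\<lambda>N. (cmod (\<Sum>n<N. sin (freq n * x) *\<^sub>R c n)) ^ 4) \<longlonglongrightarrow> (cmod (sin_series c x)) ^ 4"
    unfolding sin_series_def by (intro tendsto_intros summable_LIMSEQ summable_sin_series c)
  show "(\<lambda>N. L\<^sup>2 * (\<Sum>n<N. (cmod (c n))\<^sup>2) * (\<Sum>n<N. mu n * (cmod (c n))\<^sup>2)) \<longlonglongrightarrow> L\<^sup>2 * (\<Sum>n. (cmod (c n))\<^sup>2) * energy c"
    unfolding energy_def using c
    by (intro tendsto_intros summable_LIMSEQ summable_sq) (auto simp: finite_energy_def)
qed (use agmon_sum[OF x] in blast)

text \<open>The differentiated partial sums converge only in mean square. The squared distance
  between two of them is a tail of the energy, so \<open>L2_complete\<close> provides the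
  limit.\<close>

lemma sin_series_weak_derivative:
  assumes c: "finite_energy c"
  shows "\<exists>g. weak_derivative 0 L (sin_series c) g \<and> (LINT x|lebesgue_on {0..L}. (cmod (g x))\<^sup>2) \<le> L / 2 * energy c"
proof -
  define S where "S N x = (\<Sum>n<N. sin (freq n * x) *\<^sub>R c n)" for N x
  define f where "f N x = (\<Sum>n<N. cos (freq n * x) *\<^sub>R (freq n *\<^sub>R c n))" for N x
  have Sc [continuous_intros]: "continuous_on Y (S N)" for Y N unfolding S_def by (intro continuous_intros)
  have fc [continuous_intros]: "continuous_on Y (f N)" for Y N unfolding f_def by (intro continuous_intros)
  have SD: "(S N has_vector_derivative f N x) (at x within Y)" for N x Y
    unfolding S_def f_def by (rule sin_sum_vector_derivative)
  define q where "q n = mu n * (cmod (c n))\<^sup>2" for n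
  have q: "summable q" "q n \<ge> 0" for n
    using c mu_pos[of n] by (auto simp: q_def[abs_def] finite_energy_def less_imp_le)
  define e where "e N = L / 2 * (energy c - (\<Sum>n<N. q n))" for N
  have eb: "(LINT x|lebesgue_on {0..L}. (cmod (f M x - f N x))\<^sup>2) \<le> e N" if "N \<le> M" for N M
  proof -
    have "{..<M} = {..<N} \<union> {N..<M}" using that by auto
    then have d: "f M x - f N x = (\<Sum>n\<in>{N..<M}. cos (freq n * x) *\<^sub>R (freq n *\<^sub>R c n))" for x
      unfolding f_def by (simp add: sum.union_disjoint ivl_disj_int)
    have "(LINT x|lebesgue_on {0..L}. (cmod (f M x - f N x))\<^sup>2) = integral {0..L} (\<lambda>x. (cmod (f M x - f N x))\<^sup>2)"
      by (intro lint_continuous continuous_intros)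
    also have "\<dots> = L / 2 * (\<Sum>n\<in>{N..<M}. (cmod (freq n *\<^sub>R c n))\<^sup>2)"
      unfolding d by (rule integral_norm_sum_orthogonal[OF _ orthogonal_cos]) (auto intro!: continuous_intros)
    also have "(\<Sum>n\<in>{N..<M}. (cmod (freq n *\<^sub>R c n))\<^sup>2) = (\<Sum>n\<in>{N..<M}. q n)"
      by (simp add: power_mult_distrib mu_def q_def)
    also have "\<dots> = (\<Sum>n<M. q n) - (\<Sum>n<N. q n)"
      using \<open>{..<M} = {..<N} \<union> {N..<M}\<close> by (simp add: sum.union_disjoint ivl_disj_int)
    also have "\<dots> \<le> energy c - (\<Sum>n<N. q n)"
      using sum_le_suminf[OF q(1), of "{..<M}"] q(2) by (simp add: energy_def q_def[abs_def])
    finally show ?thesis unfolding e_def using L_pos by (simp add: mult_left_mono)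
  qed
  have "(\<lambda>N. \<Sum>n<N. q n) \<longlonglongrightarrow> energy c" 
    using summable_LIMSEQ[OF q(1)] by (simp add: energy_def q_def[abs_def])
  then have "e \<longlonglongrightarrow> L / 2 * (energy c - energy c)" unfolding e_def[abs_def] by (intro tendsto_intros)
  then have e0: "e \<longlonglongrightarrow> 0" by simp
  obtain g where g: "square_integrable 0 L g" "\<And>N. (LINT x|lebesgue_on {0..L}. (cmod (g x - f N x))\<^sup>2) \<le> e N"
    by (rule L2_complete[OF L_pos _ eb e0]) (auto intro!: square_integrable_continuous continuous_intros)
  have "weak_derivative 0 L (sin_series c) g"
  proof (rule weak_derivative_limit[OF L_pos])
    show "weak_derivative 0 L (S N) (f N)" for N by (rule weak_derivative_C1[OF SD fc])
    show "square_integrable 0 L g" by (rule g(1))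
    show "square_integrable 0 L (sin_series c)" by (intro square_integrable_continuous sin_series_continuous_on c)
    show "(\<lambda>N. LINT x|lebesgue_on {0..L}. (cmod (g x - f N x))\<^sup>2) \<longlonglongrightarrow> 0"
      by (rule Lim_null_comparison[OF always_eventually e0]) (use g(2) in auto)
    have "(\<lambda>N. L / 2 * ((\<Sum>n. (cmod (c n))\<^sup>2) - (\<Sum>n<N. (cmod (c n))\<^sup>2))) \<longlonglongrightarrow> 
       L / 2 * ((\<Sum>n. (cmod (c n))\<^sup>2) - (\<Sum>n. (cmod (c n))\<^sup>2))"
      by (intro tendsto_intros summable_LIMSEQ summable_sq c)
    then have lim: "(\<lambda>N. L / 2 * ((\<Sum>n. (cmod (c n))\<^sup>2) - (\<Sum>n<N. (cmod (c n))\<^sup>2))) \<longlonglongrightarrow> 0" by simp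
    have "(LINT x|lebesgue_on {0..L}. (cmod (sin_series c x - S N x))\<^sup>2) = L / 2 * ((\<Sum>n. (cmod (c n))\<^sup>2) - (\<Sum>n<N. (cmod (c n))\<^sup>2))" for N
    proof -
      \<comment> \<open>The remainder of the series is itself a sine series, of the tail
        coefficients, so Parseval's identity applies to it.\<close>
      define d where "d n = (if n < N then 0 else c n)" for n
      have df: "finite_energy d" by (rule finite_energy_le[OF c]) (simp add: d_def)
      define b where "b n = (if n < N then c n else 0)" for n
      have bf: "finite_energy b" by (rule finite_energy_le[OF c]) (simp add: b_def)
      have "sin_series b x = S N x" for x
        unfolding sin_series_def S_def by (subst suminf_finite[of "{..<N}"]) (auto simp: b_def intro!: sum.cong)
      moreover have "d = (\<lambda>n. c n - b n)" by (auto simp: d_def b_def)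
      ultimately have "sin_series c x - S N x = sin_series d x" for x using sin_series_diff[OF c bf] by simp
      moreover have "(\<Sum>n. (cmod (d n))\<^sup>2) = (\<Sum>n. (cmod (c n))\<^sup>2) - (\<Sum>n<N. (cmod (c n))\<^sup>2)"
      proof -
        have "(\<Sum>n. (cmod (b n))\<^sup>2) = (\<Sum>n<N. (cmod (c n))\<^sup>2)"
          by (subst suminf_finite[of "{..<N}"]) (auto simp: b_def intro!: sum.cong)
        moreover have "(\<Sum>n. (cmod (d n))\<^sup>2) + (\<Sum>n. (cmod (b n))\<^sup>2) = (\<Sum>n. (cmod (c n))\<^sup>2)"
          by (subst suminf_add) (use summable_sq[OF df] summable_sq[OF bf] in \<open>auto intro!: suminf_cong simp: d_def b_def\<close>)
        ultimately show ?thesis by simp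
      qed
      ultimately show ?thesis using parseval_sin[OF df] 
        by (subst lint_continuous) (auto intro!: continuous_intros sin_series_continuous_on df)
    qed
    then show "(\<lambda>N. LINT x|lebesgue_on {0..L}. (cmod (sin_series c x - S N x))\<^sup>2) \<longlonglongrightarrow> 0" using lim by (simp only:)
  qed
  \<comment> \<open>At N = 0 the partial sum is empty and the rate \<open>e\<close> is the whole
    energy.\<close>
  moreover have "(LINT x|lebesgue_on {0..L}. (cmod (g x))\<^sup>2) \<le> L / 2 * energy c"
    using g(2)[of 0] by (simp add: f_def e_def)
  ultimately show ?thesis by blast
qed

end

section \<open>Scalar linear equations\<close>

text \<open>The solution of y' + r y = f with y 0 = 0.\<close>

definition duhamel :: "complex \<Rightarrow> (real \<Rightarrow> complex) \<Rightarrow> real \<Rightarrow> complex" where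
  "duhamel r f t = exp (- (r * of_real t)) * integral {0..t} (\<lambda>s. exp (r * of_real s) * f s)"

lemma exp_rate_vector_derivative:
  fixes r :: complex
  shows "((\<lambda>t. exp (r * of_real t)) has_vector_derivative r * exp (r * of_real t)) (at t within S)"
proof -
  have "((\<lambda>z. exp (r * z)) has_field_derivative r * exp (r * of_real t)) (at (of_real t))"
    by (rule derivative_eq_intros refl | simp)+
  then show ?thesis by (rule has_vector_derivative_real_field)
qed

lemma continuous_exp_rate [continuous_intros]: "continuous_on S (\<lambda>t. exp (r * complex_of_real t))"
  by (intro continuous_intros)

lemma duhamel_vector_derivative:
  assumes f: "continuous_on {0..T} f" and t: "t \<in> {0..T}"
  shows "(duhamel r f has_vector_derivative f t - r * duhamel r f t) (at t within {0..T})"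
proof -
  have "((\<lambda>t. integral {0..t} (\<lambda>s. exp (r * of_real s) * f s)) has_vector_derivative exp (r * of_real t) * f t) (at t within {0..T})"
    by (rule integral_has_vector_derivative[OF _ t]) (intro continuous_intros f)
  from has_vector_derivative_mult[OF exp_rate_vector_derivative[of "-r"] this]
  have "(duhamel r f has_vector_derivative
     exp (- (r * of_real t)) * (exp (r * of_real t) * f t) + (- r) * exp (- (r * of_real t)) * integral {0..t} (\<lambda>s. exp (r * of_real s) * f s)) (at t within {0..T})"
    by (simp add: duhamel_def[abs_def])
  moreover have "exp (- (r * of_real t)) * (exp (r * of_real t) * f t) + (- r) * exp (- (r * of_real t)) * integral {0..t} (\<lambda>s. exp (r * of_real s) * f s)
      = f t - r * duhamel r f t"
  proof -
    have "exp (- (r * of_real t)) * exp (r * of_real t) = 1" by (metis exp_minus_inverse mult.commute)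
    then show ?thesis by (simp add: duhamel_def mult.assoc[symmetric])
  qed
  ultimately show ?thesis by simp
qed

lemma duhamel_continuous:
  assumes "continuous_on {0..T} f"
  shows "continuous_on {0..T} (duhamel r f)"
  using duhamel_vector_derivative[OF assms]
  by (meson continuous_on_eq_continuous_within has_vector_derivative_continuous)

lemma duhamel_0: "duhamel r f 0 = 0" by (simp add: duhamel_def)

lemma duhamel_integral:
  assumes f: "continuous_on {0..T} f" and t: "t \<in> {0..T}"
  shows "duhamel r f t = integral {0..t} f - r * integral {0..t} (duhamel r f)"
proof -
  have ft: "continuous_on {0..t} f" by (rule continuous_on_subset[OF f]) (use t in auto)
  have "((\<lambda>s. f s - r * duhamel r f s) has_integral duhamel r f t - duhamel r f 0) {0..t}"
    by (rule fundamental_theorem_of_calculus) (use t duhamel_vector_derivative[OF ft] in auto)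
  then have "duhamel r f t = integral {0..t} (\<lambda>s. f s - r * duhamel r f s)" by (simp add: integral_unique duhamel_0)
  also have "\<dots> = integral {0..t} f - integral {0..t} (\<lambda>s. r * duhamel r f s)"
    by (intro integral_diff_continuous continuous_intros ft duhamel_continuous)
  finally show ?thesis by simp
qed

text \<open>For y = \<open>duhamel r f\<close>, the derivative of |y|^2 is 2 Re (y cnj f) - 2 Re r
  |y|^2; integrate. Summed over the modes, this becomes the energy identity for q.\<close>

lemma duhamel_energy:
  assumes f: "continuous_on {0..T} f" and t: "t \<in> {0..T}"
  shows "(cmod (duhamel r f t))\<^sup>2 + 2 * Re r * integral {0..t} (\<lambda>s. (cmod (duhamel r f s))\<^sup>2)
       = 2 * integral {0..t} (\<lambda>s. Re (duhamel r f s * cnj (f s)))"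
proof -
  have ft: "continuous_on {0..t} f" by (rule continuous_on_subset[OF f]) (use t in auto)
  note dc = duhamel_continuous[OF ft]
  have "((\<lambda>s. 2 * Re (duhamel r f s * cnj (f s)) - 2 * Re r * (cmod (duhamel r f s))\<^sup>2) has_integral
      duhamel r f t \<bullet> duhamel r f t - duhamel r f 0 \<bullet> duhamel r f 0) {0..t}"
  proof (rule fundamental_theorem_of_calculus)
    fix s assume s: "s \<in> {0..t}"
    have "((\<lambda>s. duhamel r f s \<bullet> duhamel r f s) has_vector_derivative
       duhamel r f s \<bullet> (f s - r * duhamel r f s) + (f s - r * duhamel r f s) \<bullet> duhamel r f s) (at s within {0..t})"
      by (rule bounded_bilinear.has_vector_derivative[OF bounded_bilinear_inner duhamel_vector_derivative[OF ft s] duhamel_vector_derivative[OF ft s]])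
    moreover have "duhamel r f s \<bullet> (f s - r * duhamel r f s) + (f s - r * duhamel r f s) \<bullet> duhamel r f s
       = 2 * Re (duhamel r f s * cnj (f s)) - 2 * Re r * (cmod (duhamel r f s))\<^sup>2"
      unfolding cmod_power2 inner_complex_def by (simp add: power2_eq_square algebra_simps)
    ultimately show "((\<lambda>s. duhamel r f s \<bullet> duhamel r f s) has_vector_derivative
       2 * Re (duhamel r f s * cnj (f s)) - 2 * Re r * (cmod (duhamel r f s))\<^sup>2) (at s within {0..t})" by simp
  qed (use t in simp)
  then have "(cmod (duhamel r f t))\<^sup>2 = integral {0..t} (\<lambda>s. 2 * Re (duhamel r f s * cnj (f s)) - 2 * Re r * (cmod (duhamel r f s))\<^sup>2)"
    unfolding power2_norm_eq_inner by (simp add: integral_unique duhamel_0)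
  also have "\<dots> = integral {0..t} (\<lambda>s. 2 * Re (duhamel r f s * cnj (f s))) - integral {0..t} (\<lambda>s. 2 * Re r * (cmod (duhamel r f s))\<^sup>2)"
    by (intro integral_diff_continuous continuous_intros ft dc)
  finally show ?thesis by (simp only: integral_mult_right)
qed

lemma young_weighted:
  fixes d x y :: real
  assumes "d > 0"
  shows "2 * (x * y) \<le> 2 * d * x\<^sup>2 + y\<^sup>2 / (2 * d)"
proof -
  have "0 \<le> (2 * d * x - y)\<^sup>2" by simp
  then have "2 * (x * y) * (2 * d) \<le> 2 * d * x\<^sup>2 * (2 * d) + y\<^sup>2" by (simp add: power2_eq_square algebra_simps)
  then have "2 * (x * y) \<le> (2 * d * x\<^sup>2 * (2 * d) + y\<^sup>2) / (2 * d)" using assms by (subst pos_le_divide_eq) auto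
  also have "\<dots> = 2 * d * x\<^sup>2 + y\<^sup>2 / (2 * d)" using assms by (simp add: add_divide_distrib)
  finally show ?thesis .
qed

text \<open>Young's inequality with weight Re r absorbs the dissipation exactly. The gain 1 / Re r
  is the source of parabolic smoothing: it pays for the factor \<open>mu n\<close> in the
  energy.\<close>

lemma duhamel_bound:
  assumes f: "continuous_on {0..T} f" and t: "t \<in> {0..T}" and r: "Re r > 0"
  shows "(cmod (duhamel r f t))\<^sup>2 \<le> integral {0..t} (\<lambda>s. (cmod (f s))\<^sup>2) / (2 * Re r)"
proof -
  have ft: "continuous_on {0..t} f" by (rule continuous_on_subset[OF f]) (use t in auto)
  note dc = duhamel_continuous[OF ft]
  have "2 * integral {0..t} (\<lambda>s. Re (duhamel r f s * cnj (f s))) = integral {0..t} (\<lambda>s. 2 * Re (duhamel r f s * cnj (f s)))" by (rule integral_mult_right[symmetric])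
  also have "\<dots> \<le> integral {0..t} (\<lambda>s. 2 * Re r * (cmod (duhamel r f s))\<^sup>2 + (cmod (f s))\<^sup>2 / (2 * Re r))"
  proof (rule integral_le)
    show "(\<lambda>s. 2 * Re (duhamel r f s * cnj (f s))) integrable_on {0..t}"
      "(\<lambda>s. 2 * Re r * (cmod (duhamel r f s))\<^sup>2 + (cmod (f s))\<^sup>2 / (2 * Re r)) integrable_on {0..t}"
      using r by (intro integrable_continuous_real continuous_intros ft dc; simp)+
    fix s
    have "Re (duhamel r f s * cnj (f s)) \<le> cmod (duhamel r f s) * cmod (f s)"
      using complex_Re_le_cmod[of "duhamel r f s * cnj (f s)"] by (simp add: norm_mult)
    moreover have "2 * (cmod (duhamel r f s) * cmod (f s)) \<le> 2 * Re r * (cmod (duhamel r f s))\<^sup>2 + (cmod (f s))\<^sup>2 / (2 * Re r)"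
      by (rule young_weighted[OF r])
    ultimately show "2 * Re (duhamel r f s * cnj (f s)) \<le> 2 * Re r * (cmod (duhamel r f s))\<^sup>2 + (cmod (f s))\<^sup>2 / (2 * Re r)"
      by linarith
  qed
  also have "\<dots> = integral {0..t} (\<lambda>s. 2 * Re r * (cmod (duhamel r f s))\<^sup>2) + integral {0..t} (\<lambda>s. (cmod (f s))\<^sup>2 / (2 * Re r))"
    using r by (intro integral_add_continuous continuous_intros ft dc) auto
  finally show ?thesis using duhamel_energy[OF f t, of r] by simp
qed

lemma duhamel_diff:
  assumes f: "continuous_on {0..T} f" and g: "continuous_on {0..T} g" and t: "t \<in> {0..T}"
  shows "duhamel r f t - duhamel r g t = duhamel r (\<lambda>s. f s - g s) t"
proof -
  have ft: "continuous_on {0..t} f" "continuous_on {0..t} g"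
    by (rule continuous_on_subset[OF f] continuous_on_subset[OF g]; use t in auto)+
  have I: "integral {0..t} (\<lambda>s. exp (r * of_real s) * f s - exp (r * of_real s) * g s) = 
     integral {0..t} (\<lambda>s. exp (r * of_real s) * f s) - integral {0..t} (\<lambda>s. exp (r * of_real s) * g s)"
    by (intro integral_diff_continuous continuous_intros ft)
  show ?thesis by (simp only: duhamel_def right_diff_distrib I)
qed

lemma duhamel_const:
  assumes r: "r \<noteq> 0" and t: "t \<ge> 0"
  shows "r * duhamel r (\<lambda>_. c) t = c * (1 - exp (- (r * of_real t)))"
proof -
  have I: "((\<lambda>s. r * exp (r * of_real s)) has_integral exp (r * of_real t) - exp (r * of_real 0)) {0..t}"
    by (rule fundamental_theorem_of_calculus[OF t]) (rule exp_rate_vector_derivative)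
  have "r * integral {0..t} (\<lambda>s. exp (r * of_real s)) = exp (r * of_real t) - 1"
    using integral_unique[OF I] unfolding integral_mult_right by simp
  then have "r * duhamel r (\<lambda>_. c) t = exp (- (r * of_real t)) * (exp (r * of_real t) - 1) * c"
    unfolding duhamel_def by (simp add: mult_ac)
  also have "\<dots> = c * (1 - exp (- (r * of_real t)))" by (simp add: algebra_simps exp_minus)
  finally show ?thesis .
qed

text \<open>\<open>layer r a\<close> solves \<open>y' + r y = a'\<close>, \<open>y 0 = 0\<close>; integrating by parts removes \<open>a'\<close> from
  the Duhamel formula.\<close>

definition layer :: "complex \<Rightarrow> (real \<Rightarrow> complex) \<Rightarrow> real \<Rightarrow> complex" where
  "layer r a t = a t - exp (- (r * of_real t)) * a 0 - r * duhamel r a t"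

lemma layer_continuous:
  assumes "continuous_on {0..T} a"
  shows "continuous_on {0..T} (layer r a)"
  unfolding layer_def[abs_def] minus_mult_left by (intro continuous_intros duhamel_continuous assms)

lemma integral_exp_decay:
  fixes r :: complex
  assumes t: "t \<ge> 0"
  shows "r * integral {0..t} (\<lambda>s. exp (- (r * of_real s))) = 1 - exp (- (r * of_real t))"
proof -
  have I: "((\<lambda>s. (-r) * exp ((-r) * of_real s)) has_integral exp ((-r) * of_real t) - exp ((-r) * of_real 0)) {0..t}"
    by (rule fundamental_theorem_of_calculus[OF t]) (rule exp_rate_vector_derivative)
  have "- (r * integral {0..t} (\<lambda>s. exp (- (r * of_real s)))) = exp (- (r * of_real t)) - 1"
    using integral_unique[OF I] unfolding integral_mult_right by simp
  then have "r * integral {0..t} (\<lambda>s. exp (- (r * of_real s))) = - (exp (- (r * of_real t)) - 1)" by (metis minus_minus)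
  then show ?thesis by simp
qed

text \<open>The equation y' + r y = a' integrated once, so that no derivative of \<open>a\<close>
  occurs.\<close>

lemma layer_integral:
  assumes a: "continuous_on {0..T} a" and t: "t \<in> {0..T}"
  shows "layer r a t = a t - a 0 - r * integral {0..t} (layer r a)"
proof -
  have at: "continuous_on {0..t} a" by (rule continuous_on_subset[OF a]) (use t in auto)
  have ec: "continuous_on {0..t} (\<lambda>s. exp (- (r * complex_of_real s)))"
    unfolding minus_mult_left by (intro continuous_intros)
  have "integral {0..t} (layer r a) = integral {0..t} (\<lambda>s. a s - exp (- (r * of_real s)) * a 0) - integral {0..t} (\<lambda>s. r * duhamel r a s)"
    unfolding layer_def[abs_def]
    by (intro integral_diff_continuous continuous_intros at duhamel_continuous ec)
  also have "integral {0..t} (\<lambda>s. a s - exp (- (r * of_real s)) * a 0) = integral {0..t} a - integral {0..t} (\<lambda>s. exp (- (r * of_real s)) * a 0)"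
    by (intro integral_diff_continuous continuous_intros at ec)
  finally have I: "integral {0..t} (layer r a) = integral {0..t} a - integral {0..t} (\<lambda>s. exp (- (r * of_real s))) * a 0 - r * integral {0..t} (duhamel r a)"
    by simp
  have d: "r * integral {0..t} (duhamel r a) = integral {0..t} a - duhamel r a t" using duhamel_integral[OF a t, of r] by simp
  have "r * integral {0..t} (layer r a) = r * duhamel r a t - (1 - exp (- (r * of_real t))) * a 0"
    unfolding I d using integral_exp_decay[of t r] t by (simp add: right_diff_distrib mult.assoc[symmetric])
  then show ?thesis by (simp add: layer_def algebra_simps)
qed

text \<open>Replacing \<open>a s\<close> by its difference from \<open>a t\<close> in the Duhamel
  integral costs only an explicit exponential. Up to a constant the difference is at most the root
  of t - s, so integration against exp (- Re r (t - s)) yields the power -3/2 of Re r. With the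
  prefactor r this gives the power -1/2, up to the ratio of |r| to Re r.\<close>

lemma layer_bound:
  assumes a: "continuous_on {0..T} a" and t: "t \<in> {0..T}" and r: "Re r > 0" and C: "C \<ge> 0"
    and h: "\<And>s t. s \<in> {0..T} \<Longrightarrow> t \<in> {0..T} \<Longrightarrow> (cmod (a t - a s))\<^sup>2 \<le> C * \<bar>t - s\<bar>"
  shows "Re r * (cmod (layer r a t))\<^sup>2 \<le> C * (1 + 2 * cmod r / Re r)\<^sup>2"
proof -
  define \<rho> where "\<rho> = Re r"
  have \<rho>: "\<rho> > 0" using r by (simp add: \<rho>_def)
  have r0: "r \<noteq> 0" using r by auto
  have t0: "t \<ge> 0" using t by simp
  \<comment> \<open>Half of the exponential decay is spent on the square root, after which the time
    integral is elementary.\<close>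
  have sq: "sqrt y \<le> exp (\<rho> * y / 2) / sqrt \<rho>" if "y \<ge> 0" for y
  proof -
    have "\<rho> * y \<le> exp (\<rho> * y)" using exp_ge_add_one_self[of "\<rho> * y"] by linarith
    then have "sqrt (\<rho> * y) \<le> sqrt (exp (\<rho> * y))" by simp
    also have "sqrt (exp (\<rho> * y)) = exp (\<rho> * y / 2)" by (rule real_sqrt_unique) (auto simp: exp_double[symmetric])
    finally show ?thesis using \<rho> by (simp add: real_sqrt_mult field_simps)
  qed
  have ha: "cmod (a t - a s) \<le> sqrt C * exp (\<rho> * (t - s) / 2) / sqrt \<rho>" if "s \<in> {0..t}" for s
  proof -
    have "cmod (a t - a s) \<le> sqrt (C * (t - s))" using h[of s t] t that by (intro real_le_rsqrt) auto
    also have "\<dots> = sqrt C * sqrt (t - s)" by (simp add: real_sqrt_mult)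
    also have "\<dots> \<le> sqrt C * (exp (\<rho> * (t - s) / 2) / sqrt \<rho>)" using sq[of "t - s"] that C by (intro mult_left_mono) auto
    finally show ?thesis by simp
  qed
  have at: "continuous_on {0..t} a" by (rule continuous_on_subset[OF a]) (use t in auto)
  \<comment> \<open>The Duhamel integral of the constant \<open>a t\<close> is known from
    \<open>duhamel_const\<close>; subtracting it leaves increments of \<open>a\<close> only.\<close>
  have eq: "layer r a t = exp (- (r * of_real t)) * (a t - a 0) + r * duhamel r (\<lambda>s. a t - a s) t"
  proof -
    have "duhamel r (\<lambda>s. a t - a s) t = duhamel r (\<lambda>_. a t) t - duhamel r a t"
      by (rule duhamel_diff[symmetric, of t]) (use at t0 in \<open>auto intro: continuous_intros\<close>)
    then have "r * duhamel r (\<lambda>s. a t - a s) t = a t * (1 - exp (- (r * of_real t))) - r * duhamel r a t"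
      using duhamel_const[OF r0 t0, of "a t"] by (simp add: right_diff_distrib)
    then show ?thesis by (simp add: layer_def algebra_simps)
  qed
  have n1: "cmod (exp (- (r * of_real t)) * (a t - a 0)) \<le> sqrt C / sqrt \<rho>"
  proof -
    have "cmod (exp (- (r * of_real t)) * (a t - a 0)) = exp (- (\<rho> * t)) * cmod (a t - a 0)"
      by (simp add: norm_mult \<rho>_def)
    also have "\<dots> \<le> exp (- (\<rho> * t)) * (sqrt C * exp (\<rho> * (t - 0) / 2) / sqrt \<rho>)"
      using ha[of 0] t0 by (intro mult_left_mono) auto
    also have "\<dots> = sqrt C / sqrt \<rho> * exp (- (\<rho> * t) + \<rho> * t / 2)" unfolding exp_add by simp
    also have "\<dots> \<le> sqrt C / sqrt \<rho> * 1" using \<rho> t0 C by (intro mult_left_mono) auto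
    finally show ?thesis by simp
  qed
  have n2: "cmod (duhamel r (\<lambda>s. a t - a s) t) \<le> sqrt C / sqrt \<rho> * (2 / \<rho>)"
  proof -
    have "cmod (integral {0..t} (\<lambda>s. exp (r * of_real s) * (a t - a s))) \<le> integral {0..t} (\<lambda>s. (sqrt C / sqrt \<rho> * exp (\<rho> * t / 2)) * exp (\<rho> * s / 2))"
    proof (rule integral_norm_bound_integral)
      show "(\<lambda>s. exp (r * of_real s) * (a t - a s)) integrable_on {0..t}"
        "(\<lambda>s. (sqrt C / sqrt \<rho> * exp (\<rho> * t / 2)) * exp (\<rho> * s / 2)) integrable_on {0..t}"
        by (intro integrable_continuous_real continuous_intros at; simp)+
      fix s assume s: "s \<in> {0..t}"
      have "cmod (exp (r * of_real s) * (a t - a s)) = exp (\<rho> * s) * cmod (a t - a s)" by (simp add: norm_mult \<rho>_def)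
      also have "\<dots> \<le> exp (\<rho> * s) * (sqrt C * exp (\<rho> * (t - s) / 2) / sqrt \<rho>)"
        using ha[OF s] by (intro mult_left_mono) auto
      also have "\<dots> = sqrt C / sqrt \<rho> * exp (\<rho> * s + \<rho> * (t - s) / 2)" by (simp add: exp_add)
      also have "\<rho> * s + \<rho> * (t - s) / 2 = \<rho> * t / 2 + \<rho> * s / 2" by (simp add: field_simps)
      finally show "cmod (exp (r * of_real s) * (a t - a s)) \<le> (sqrt C / sqrt \<rho> * exp (\<rho> * t / 2)) * exp (\<rho> * s / 2)"
        by (simp add: exp_add)
    qed
    also have "\<dots> = (sqrt C / sqrt \<rho> * exp (\<rho> * t / 2)) * integral {0..t} (\<lambda>s. exp (\<rho> * s / 2))" by simp
    also have "integral {0..t} (\<lambda>s. exp (\<rho> * s / 2)) = (2 / \<rho>) * exp (\<rho> * t / 2) - (2 / \<rho>) * exp (\<rho> * 0 / 2)"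
    proof (rule integral_unique, rule fundamental_theorem_of_calculus[OF t0])
      show "((\<lambda>s. (2 / \<rho>) * exp (\<rho> * s / 2)) has_vector_derivative exp (\<rho> * s / 2)) (at s within {0..t})" for s
        unfolding has_real_derivative_iff_has_vector_derivative[symmetric]
        by (rule derivative_eq_intros refl | use \<rho> in simp)+
    qed
    also have "(sqrt C / sqrt \<rho> * exp (\<rho> * t / 2)) * ((2 / \<rho>) * exp (\<rho> * t / 2) - (2 / \<rho>) * exp (\<rho> * 0 / 2))
      \<le> (sqrt C / sqrt \<rho> * exp (\<rho> * t / 2)) * ((2 / \<rho>) * exp (\<rho> * t / 2))"
      using \<rho> C by (intro mult_left_mono) auto
    also have "\<dots> = sqrt C / sqrt \<rho> * (2 / \<rho>) * exp (\<rho> * t)"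
      by (simp add: exp_add[symmetric])
    finally have I: "cmod (integral {0..t} (\<lambda>s. exp (r * of_real s) * (a t - a s))) \<le> sqrt C / sqrt \<rho> * (2 / \<rho>) * exp (\<rho> * t)" .
    have "cmod (duhamel r (\<lambda>s. a t - a s) t) = exp (- (\<rho> * t)) * cmod (integral {0..t} (\<lambda>s. exp (r * of_real s) * (a t - a s)))"
      by (simp add: duhamel_def norm_mult \<rho>_def)
    also have "\<dots> \<le> exp (- (\<rho> * t)) * (sqrt C / sqrt \<rho> * (2 / \<rho>) * exp (\<rho> * t))"
      by (rule mult_left_mono[OF I]) simp
    also have "\<dots> = sqrt C / sqrt \<rho> * (2 / \<rho>)" by (simp add: exp_minus)
    finally show ?thesis .
  qed
  have "cmod (layer r a t) \<le> sqrt C / sqrt \<rho> + cmod r * (sqrt C / sqrt \<rho> * (2 / \<rho>))"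
    unfolding eq by (rule order_trans[OF norm_triangle_ineq add_mono[OF n1]]) (simp only: norm_mult mult_left_mono[OF n2] norm_ge_zero)
  also have "\<dots> = sqrt C / sqrt \<rho> * (1 + 2 * cmod r / \<rho>)" by (simp add: algebra_simps)
  finally have "(cmod (layer r a t))\<^sup>2 \<le> (sqrt C / sqrt \<rho> * (1 + 2 * cmod r / \<rho>))\<^sup>2" by (rule power_mono) simp
  also have "\<dots> = C / \<rho> * (1 + 2 * cmod r / \<rho>)\<^sup>2" using C \<rho> by (simp add: power_mult_distrib power_divide)
  finally show ?thesis using \<rho> by (simp add: \<rho>_def field_simps)
qed

context mixed_interval
begin

section \<open>Fourier coefficients\<close>

definition coef :: "(real \<Rightarrow> complex) \<Rightarrow> nat \<Rightarrow> complex" where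
  "coef h n = (2 / L) *\<^sub>R integral {0..L} (\<lambda>x. sin (freq n * x) *\<^sub>R h x)"

lemma coef_add:
  assumes "continuous_on {0..L} f" "continuous_on {0..L} g"
  shows "coef (\<lambda>x. f x + g x) n = coef f n + coef g n"
proof -
  have "integral {0..L} (\<lambda>x. sin (freq n * x) *\<^sub>R (f x + g x)) = 
    integral {0..L} (\<lambda>x. sin (freq n * x) *\<^sub>R f x) + integral {0..L} (\<lambda>x. sin (freq n * x) *\<^sub>R g x)"
    unfolding scaleR_add_right
    by (intro integral_add_continuous continuous_intros assms)
  then show ?thesis by (simp add: coef_def scaleR_add_right)
qed

lemma coef_diff:
  assumes "continuous_on {0..L} f" "continuous_on {0..L} g"
  shows "coef (\<lambda>x. f x - g x) n = coef f n - coef g n"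
proof -
  have "integral {0..L} (\<lambda>x. sin (freq n * x) *\<^sub>R (f x - g x)) = 
    integral {0..L} (\<lambda>x. sin (freq n * x) *\<^sub>R f x) - integral {0..L} (\<lambda>x. sin (freq n * x) *\<^sub>R g x)"
    unfolding scaleR_diff_right
    by (intro integral_diff_continuous continuous_intros assms)
  then show ?thesis by (simp add: coef_def scaleR_diff_right)
qed

lemma coef_mult: "coef (\<lambda>x. r * f x) n = r * coef f n"
proof -
  have "integral {0..L} (\<lambda>x. sin (freq n * x) *\<^sub>R (r * f x)) = integral {0..L} (\<lambda>x. r * (sin (freq n * x) *\<^sub>R f x))"
    by (simp add: algebra_simps)
  then have "integral {0..L} (\<lambda>x. sin (freq n * x) *\<^sub>R (r * f x)) = r * integral {0..L} (\<lambda>x. sin (freq n * x) *\<^sub>R f x)"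
    by (simp only: integral_mult_right)
  then show ?thesis by (simp only: coef_def mult_scaleR_right)
qed

lemma coef_cong: "(\<And>x. x \<in> {0..L} \<Longrightarrow> f x = g x) \<Longrightarrow> coef f n = coef g n"
  unfolding coef_def by (intro arg_cong[where f="\<lambda>z. _ *\<^sub>R z"] Henstock_Kurzweil_Integration.integral_cong) simp

lemma coef_sin_series: "finite_energy c \<Longrightarrow> coef (sin_series c) n = c n"
  using L_pos by (simp add: coef_def integral_sin_sin_series)

lemma coef_unique:
  assumes f: "continuous_on {0..L} f" and g: "continuous_on {0..L} g"
    and c: "\<And>n. coef f n = coef g n" and x: "x \<in> {0..L}"
  shows "f x = g x"
proof -
  have "f x - g x = 0"
  proof (rule sin_complete[where h="\<lambda>x. f x - g x"])
    show "continuous_on {0..L} (\<lambda>x. f x - g x)" by (intro continuous_intros f g)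
    show "integral {0..L} (\<lambda>x. sin (freq n * x) *\<^sub>R (f x - g x)) = 0" for n
      using coef_diff[OF f g, of n] c[of n] L_pos by (simp add: coef_def)
  qed (rule x)
  then show ?thesis by simp
qed

lemma coef_bessel:
  assumes f: "continuous_on {0..L} f" and A: "finite A"
  shows "L / 2 * (\<Sum>n\<in>A. (cmod (coef f n))\<^sup>2) \<le> integral {0..L} (\<lambda>x. (cmod (f x))\<^sup>2)"
proof -
  have c: "coef f n = (LINT x|lebesgue_on {0..L}. sin (freq n * x) *\<^sub>R f x) /\<^sub>R (L / 2)" for n
    by (subst lint_continuous) (auto simp: coef_def intro!: continuous_intros f)
  have "L / 2 * (\<Sum>n\<in>A. (cmod (coef f n))\<^sup>2) \<le> (LINT x|lebesgue_on {0..L}. (cmod (f x))\<^sup>2)"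
    by (rule bessel[OF continuous_sin_freq orthogonal_sin A _ square_integrable_continuous[OF f] c]) (use L_pos in simp)
  also have "\<dots> = integral {0..L} (\<lambda>x. (cmod (f x))\<^sup>2)" by (intro lint_continuous continuous_intros f)
  finally show ?thesis .
qed

lemma summable_coef_sq:
  assumes f: "continuous_on {0..L} f"
  shows "summable (\<lambda>n. (cmod (coef f n))\<^sup>2)"
proof (rule summableI_nonneg_bounded)
  show "(\<Sum>n<N. (cmod (coef f n))\<^sup>2) \<le> integral {0..L} (\<lambda>x. (cmod (f x))\<^sup>2) / (L / 2)" for N
    using coef_bessel[OF f, of "{..<N}"] L_pos by (simp add: field_simps)
qed simp

text \<open>Integration by parts has no boundary terms, because w 0 = 0 and cos (freq n * L) = 0.
  Hence freq n times the sine coefficient of \<open>w\<close> is a cosine coefficient of its weak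
  derivative, and Bessel's inequality applies.\<close>

lemma finite_energy_coef_H1:
  assumes w: "w \<in> H1 0 L" and w0: "w 0 = 0"
  shows "finite_energy (coef w)"
proof -
  obtain g where g: "weak_derivative 0 L w g" and wc: "continuous_on {0..L} w" using w by (auto simp: H1_def)
  define d where "d n = (LINT x|lebesgue_on {0..L}. cos (freq n * x) *\<^sub>R g x) /\<^sub>R (L / 2)" for n
  have d: "d n = freq n *\<^sub>R coef w n" for n
  proof -
    have "(LINT x|lebesgue_on {0..L}. cos (freq n * x) *\<^sub>R g x) = (LINT x|lebesgue_on {0..L}. (freq n * sin (freq n * x)) *\<^sub>R w x)"
      using weak_ibp_cos[OF g L_pos wc, of "freq n"] w0 by (simp add: cos_freq_L)
    also have "\<dots> = integral {0..L} (\<lambda>x. freq n *\<^sub>R (sin (freq n * x) *\<^sub>R w x))"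
      by (subst lint_continuous) (auto intro!: continuous_intros wc)
    also have "\<dots> = freq n *\<^sub>R integral {0..L} (\<lambda>x. sin (freq n * x) *\<^sub>R w x)" by (rule integral_cmul)
    finally show ?thesis by (simp add: d_def coef_def)
  qed
  have "L / 2 * (\<Sum>n<N. (cmod (d n))\<^sup>2) \<le> (LINT x|lebesgue_on {0..L}. (cmod (g x))\<^sup>2)" for N
    by (rule bessel[OF continuous_cos_freq orthogonal_cos _ _ weak_derivative_integrable(2)[OF g] d_def])
      (use L_pos in auto)
  then have "(\<Sum>n<N. mu n * (cmod (coef w n))\<^sup>2) \<le> (LINT x|lebesgue_on {0..L}. (cmod (g x))\<^sup>2) / (L / 2)" for N
    using L_pos by (simp add: d power_mult_distrib mu_def field_simps)
  then show ?thesis unfolding finite_energy_def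
    by (intro summableI_nonneg_bounded) (use mu_pos in \<open>auto simp: less_imp_le\<close>)
qed

lemma sin_series_coef:
  assumes fe: "finite_energy (coef w)" and w: "continuous_on {0..L} w" and x: "x \<in> {0..L}"
  shows "sin_series (coef w) x = w x"
  by (rule coef_unique[OF sin_series_continuous_on[OF fe] w _ x]) (rule coef_sin_series[OF fe])

section \<open>Trajectories of finite energy\<close>

text \<open>The majorant \<open>m\<close> is common to all times, which is stronger than finite
  energy at each time: it makes the energy continuous in time and with it the trajectory continuous
  into H1.\<close>

definition traj :: "real \<Rightarrow> (nat \<Rightarrow> real \<Rightarrow> complex) \<Rightarrow> bool" where
  "traj T w \<longleftrightarrow> (\<forall>n. continuous_on {0..T} (w n)) \<and>
     (\<exists>m. summable m \<and> (\<forall>n. \<forall>t\<in>{0..T}. mu n * (cmod (w n t))\<^sup>2 \<le> m n))"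

lemma trajI:
  assumes "\<And>n. continuous_on {0..T} (w n)" "summable m"
    "\<And>n t. t \<in> {0..T} \<Longrightarrow> mu n * (cmod (w n t))\<^sup>2 \<le> m n"
  shows "traj T w"
  using assms unfolding traj_def by blast

lemma traj_finite_energy: "traj T w \<Longrightarrow> t \<in> {0..T} \<Longrightarrow> finite_energy (\<lambda>n. w n t)"
  unfolding traj_def by (blast intro: finite_energyI)

lemma traj_continuous:
  assumes "traj T w"
  shows "continuous_on ({0..T} \<times> Y) (\<lambda>(t, x). sin_series (\<lambda>n. w n t) x)"
  using assms unfolding traj_def by (blast intro: sin_series_continuous)

lemma traj_add:
  assumes "traj T v" "traj T w"
  shows "traj T (\<lambda>n t. v n t + w n t)"
proof -
  obtain m1 where m1: "summable m1" "\<And>n t. t \<in> {0..T} \<Longrightarrow> mu n * (cmod (v n t))\<^sup>2 \<le> m1 n"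
    using assms(1) by (auto simp: traj_def)
  obtain m2 where m2: "summable m2" "\<And>n t. t \<in> {0..T} \<Longrightarrow> mu n * (cmod (w n t))\<^sup>2 \<le> m2 n"
    using assms(2) by (auto simp: traj_def)
  show ?thesis
  proof (rule trajI)
    show "continuous_on {0..T} (\<lambda>t. v n t + w n t)" for n
      using assms by (auto simp: traj_def intro!: continuous_intros)
    show "summable (\<lambda>n. 2 * m1 n + 2 * m2 n)" by (intro summable_add summable_mult m1 m2)
    fix n t assume t: "t \<in> {0..T}"
    have "mu n * (cmod (v n t + w n t))\<^sup>2 \<le> mu n * (2 * (cmod (v n t))\<^sup>2 + 2 * (cmod (w n t))\<^sup>2)"
      using mu_pos[of n] by (intro mult_left_mono norm_add_sq_le) auto
    also have "\<dots> = 2 * (mu n * (cmod (v n t))\<^sup>2) + 2 * (mu n * (cmod (w n t))\<^sup>2)" by (simp add: algebra_simps)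
    also have "\<dots> \<le> 2 * m1 n + 2 * m2 n" using m1(2)[OF t, of n] m2(2)[OF t, of n] by simp
    finally show "mu n * (cmod (v n t + w n t))\<^sup>2 \<le> 2 * m1 n + 2 * m2 n" .
  qed
qed

lemma traj_mult:
  assumes "traj T v"
  shows "traj T (\<lambda>n t. r * v n t)"
proof -
  obtain m where m: "summable m" "\<And>n t. t \<in> {0..T} \<Longrightarrow> mu n * (cmod (v n t))\<^sup>2 \<le> m n"
    using assms by (auto simp: traj_def)
  show ?thesis
  proof (rule trajI)
    show "continuous_on {0..T} (\<lambda>t. r * v n t)" for n
      using assms by (auto simp: traj_def intro!: continuous_intros)
    show "summable (\<lambda>n. (cmod r)\<^sup>2 * m n)" by (intro summable_mult m)
    fix n t assume t: "t \<in> {0..T}"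
    show "mu n * (cmod (r * v n t))\<^sup>2 \<le> (cmod r)\<^sup>2 * m n"
      using mult_left_mono[OF m(2)[OF t, of n], of "(cmod r)\<^sup>2"] by (simp add: norm_mult power_mult_distrib mult_ac)
  qed
qed

lemma energy_nonneg: "finite_energy c \<Longrightarrow> 0 \<le> energy c"
  unfolding energy_def finite_energy_def by (intro suminf_nonneg) (use mu_pos in \<open>auto simp: less_imp_le\<close>)

lemma energy_continuous:
  assumes w: "traj T w"
  shows "continuous_on {0..T} (\<lambda>t. energy (\<lambda>n. w n t))"
proof -
  obtain m where m: "summable m" "\<And>n t. t \<in> {0..T} \<Longrightarrow> mu n * (cmod (w n t))\<^sup>2 \<le> m n"
    using w by (auto simp: traj_def)
  have "uniform_limit {0..T} (\<lambda>N t. \<Sum>n<N. mu n * (cmod (w n t))\<^sup>2) (\<lambda>t. \<Sum>n. mu n * (cmod (w n t))\<^sup>2) sequentially"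
    by (rule Weierstrass_m_test[OF _ m(1)]) (use m(2) mu_pos in \<open>auto simp: less_imp_le\<close>)
  then show ?thesis unfolding energy_def
    by (rule uniform_limit_theorem[OF always_eventually, rotated])
      (use w in \<open>auto simp: traj_def intro!: continuous_intros\<close>)
qed

text \<open>The affine part will carry the inhomogeneous boundary values. The constant is a crude
  common majorant; what matters is that it does not depend on \<open>\<alpha>\<close>,
  \<open>\<beta>\<close> and \<open>c\<close>.\<close>

lemma affine_sin_series_H1:
  assumes c: "finite_energy c"
  shows "(\<lambda>x. \<alpha> + of_real x * \<beta> + sin_series c x) \<in> H1 0 L"
    "(H1_norm 0 L (\<lambda>x. \<alpha> + of_real x * \<beta> + sin_series c x))\<^sup>2 \<le> 
       (3 * L + 3 * L ^ 3 + 2 * L + 3 * L / mu 0) * ((cmod \<alpha>)\<^sup>2 + (cmod \<beta>)\<^sup>2 + energy c)"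
proof -
  define h where "h x = \<alpha> + of_real x * \<beta> + sin_series c x" for x
  have sc: "continuous_on Y (sin_series c)" for Y by (rule sin_series_continuous_on[OF c])
  have hc: "continuous_on {0..L} h" unfolding h_def by (intro continuous_intros sc)
  obtain g where g: "weak_derivative 0 L (sin_series c) g" "(LINT x|lebesgue_on {0..L}. (cmod (g x))\<^sup>2) \<le> L / 2 * energy c"
    using sin_series_weak_derivative[OF c] by blast
  have "weak_derivative 0 L (\<lambda>x. \<alpha> + of_real x * \<beta>) (\<lambda>x. \<beta>)"
  proof (rule weak_derivative_C1)
    fix x
    have "((\<lambda>x. \<alpha> + x * \<beta>) has_field_derivative \<beta>) (at (of_real x))" by (auto intro!: derivative_eq_intros)
    from has_vector_derivative_real_field[OF this]
    show "((\<lambda>x. \<alpha> + complex_of_real x * \<beta>) has_vector_derivative \<beta>) (at x within {0..L})" by simp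
  qed (intro continuous_intros)
  from weak_derivative_add[OF this g(1)] have w: "weak_derivative 0 L h (\<lambda>x. \<beta> + g x)" by (simp add: h_def[abs_def])
  have 1: "h \<in> H1 0 L" using w hc by (auto simp: H1_def)
  define E where "E = energy c"
  define K where "K = 3 * L + 3 * L ^ 3 + 2 * L + 3 * L / mu 0"
  have E0: "E \<ge> 0" using energy_nonneg[OF c] by (simp add: E_def)
  have sq3: "(cmod (a + b + d))\<^sup>2 \<le> 3 * (cmod a)\<^sup>2 + 3 * (cmod b)\<^sup>2 + 3 * (cmod d)\<^sup>2" for a b d
  proof -
    have "cmod (a + b + d) \<le> cmod a + cmod b + cmod d" by (metis add_right_mono norm_triangle_ineq order_trans)
    then have "(cmod (a + b + d))\<^sup>2 \<le> (cmod a + cmod b + cmod d)\<^sup>2" by (rule power_mono) simp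
    also have "\<dots> \<le> 3 * (cmod a)\<^sup>2 + 3 * (cmod b)\<^sup>2 + 3 * (cmod d)\<^sup>2"
      using zero_le_power2[of "cmod a - cmod b"] zero_le_power2[of "cmod a - cmod d"] zero_le_power2[of "cmod b - cmod d"]
      by (simp add: power2_eq_square algebra_simps)
    finally show ?thesis .
  qed
  have "(LINT x|lebesgue_on {0..L}. (cmod (h x))\<^sup>2) = integral {0..L} (\<lambda>x. (cmod (h x))\<^sup>2)" by (intro lint_continuous continuous_intros hc)
  also have "\<dots> \<le> integral {0..L} (\<lambda>x. (3 * (cmod \<alpha>)\<^sup>2 + 3 * L\<^sup>2 * (cmod \<beta>)\<^sup>2) + 3 * (cmod (sin_series c x))\<^sup>2)"
  proof (rule integral_le)
    show "(\<lambda>x. (cmod (h x))\<^sup>2) integrable_on {0..L}"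
      "(\<lambda>x. (3 * (cmod \<alpha>)\<^sup>2 + 3 * L\<^sup>2 * (cmod \<beta>)\<^sup>2) + 3 * (cmod (sin_series c x))\<^sup>2) integrable_on {0..L}"
      by (intro integrable_continuous_real continuous_intros hc sc)+
    fix x assume x: "x \<in> {0..L}"
    have "(cmod (of_real x * \<beta>))\<^sup>2 \<le> L\<^sup>2 * (cmod \<beta>)\<^sup>2"
      using x L_pos by (auto simp: norm_mult power_mult_distrib intro!: mult_right_mono power_mono)
    then show "(cmod (h x))\<^sup>2 \<le> (3 * (cmod \<alpha>)\<^sup>2 + 3 * L\<^sup>2 * (cmod \<beta>)\<^sup>2) + 3 * (cmod (sin_series c x))\<^sup>2"
      using sq3[of \<alpha> "of_real x * \<beta>" "sin_series c x"] by (simp add: h_def)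
  qed
  also have "\<dots> = integral {0..L} (\<lambda>x. (3 * (cmod \<alpha>)\<^sup>2 + 3 * L\<^sup>2 * (cmod \<beta>)\<^sup>2)) + integral {0..L} (\<lambda>x. 3 * (cmod (sin_series c x))\<^sup>2)"
    by (intro integral_add_continuous continuous_intros sc)
  also have "\<dots> = L * (3 * (cmod \<alpha>)\<^sup>2 + 3 * L\<^sup>2 * (cmod \<beta>)\<^sup>2) + 3 * (L / 2 * (\<Sum>n. (cmod (c n))\<^sup>2))"
    using L_pos by (simp add: parseval_sin[OF c])
  also have "(\<Sum>n. (cmod (c n))\<^sup>2) \<le> E / mu 0" using suminf_sq_le_energy[OF c] by (simp add: E_def)
  finally have n1: "(LINT x|lebesgue_on {0..L}. (cmod (h x))\<^sup>2) \<le> L * (3 * (cmod \<alpha>)\<^sup>2 + 3 * L\<^sup>2 * (cmod \<beta>)\<^sup>2) + 3 * (L / 2 * (E / mu 0))"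
    using L_pos by (simp add: mult_left_mono)
  note gs = weak_derivative_integrable(2)[OF g(1)]
  have bi: "integrable (lebesgue_on {0..L}) (\<lambda>x. 2 * (cmod \<beta>)\<^sup>2)"
    by (intro continuous_imp_integrable_real continuous_intros)
  have "(LINT x|lebesgue_on {0..L}. (cmod (\<beta> + g x))\<^sup>2) \<le> (LINT x|lebesgue_on {0..L}. 2 * (cmod \<beta>)\<^sup>2 + 2 * (cmod (g x))\<^sup>2)"
  proof (rule integral_mono)
    show "integrable (lebesgue_on {0..L}) (\<lambda>x. (cmod (\<beta> + g x))\<^sup>2)"
      using weak_derivative_integrable(2)[OF w] by (simp add: square_integrable_def)
    show "integrable (lebesgue_on {0..L}) (\<lambda>x. 2 * (cmod \<beta>)\<^sup>2 + 2 * (cmod (g x))\<^sup>2)"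
      using gs bi by (intro Bochner_Integration.integrable_add integrable_mult_right) (auto simp: square_integrable_def)
  qed (rule norm_add_sq_le)
  also have "\<dots> = (LINT x|lebesgue_on {0..L}. 2 * (cmod \<beta>)\<^sup>2) + (LINT x|lebesgue_on {0..L}. 2 * (cmod (g x))\<^sup>2)"
    using gs bi by (intro Bochner_Integration.integral_add integrable_mult_right) (auto simp: square_integrable_def)
  also have "\<dots> = 2 * (cmod \<beta>)\<^sup>2 * L + 2 * (LINT x|lebesgue_on {0..L}. (cmod (g x))\<^sup>2)"
    using L_pos by (simp add: measure_lebesgue_on_Icc)
  also have "\<dots> \<le> 2 * (cmod \<beta>)\<^sup>2 * L + 2 * (L / 2 * E)" using g(2) by (simp add: E_def)
  finally have n2: "(LINT x|lebesgue_on {0..L}. (cmod (\<beta> + g x))\<^sup>2) \<le> 2 * (cmod \<beta>)\<^sup>2 * L + L * E" by simp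
  have "(H1_norm 0 L h)\<^sup>2 = (LINT x|lebesgue_on {0..L}. (cmod (h x))\<^sup>2) + (LINT x|lebesgue_on {0..L}. (cmod (\<beta> + g x))\<^sup>2)"
    unfolding H1_norm_eq[OF w hc]
    by (intro real_sqrt_pow2 add_nonneg_nonneg Bochner_Integration.integral_nonneg) auto
  also have "\<dots> \<le> 3 * L * (cmod \<alpha>)\<^sup>2 + (3 * L ^ 3 + 2 * L) * (cmod \<beta>)\<^sup>2 + (3 * L / mu 0 + L) * E"
  proof -
    have "3 * (L / 2 * (E / mu 0)) \<le> 3 * L / mu 0 * E" using L_pos E0 mu_pos[of 0] by (simp add: field_simps)
    then show ?thesis using n1 n2 by (simp add: algebra_simps power3_eq_cube power2_eq_square)
  qed
  also have "\<dots> \<le> K * (cmod \<alpha>)\<^sup>2 + K * (cmod \<beta>)\<^sup>2 + K * E"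
  proof (intro add_mono mult_right_mono)
    show "3 * L \<le> K" "3 * L ^ 3 + 2 * L \<le> K" "3 * L / mu 0 + L \<le> K"
      using L_pos mu_pos[of 0] by (simp_all add: K_def)
  qed (use E0 in auto)
  finally have 2: "(H1_norm 0 L h)\<^sup>2 \<le> (3 * L + 3 * L ^ 3 + 2 * L + 3 * L / mu 0) * ((cmod \<alpha>)\<^sup>2 + (cmod \<beta>)\<^sup>2 + energy c)"
    unfolding K_def[symmetric] by (simp add: E_def distrib_left)
  show "(\<lambda>x. \<alpha> + of_real x * \<beta> + sin_series c x) \<in> H1 0 L"
    "(H1_norm 0 L (\<lambda>x. \<alpha> + of_real x * \<beta> + sin_series c x))\<^sup>2 \<le> 
       (3 * L + 3 * L ^ 3 + 2 * L + 3 * L / mu 0) * ((cmod \<alpha>)\<^sup>2 + (cmod \<beta>)\<^sup>2 + energy c)"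
    using 1 2 by (simp_all add: h_def[abs_def])
qed

text \<open>The difference of two time slices is again affine plus a sine series, so
  \<open>affine_sin_series_H1\<close> reduces the claim to the continuity of the energy of a shifted
  trajectory.\<close>

lemma traj_C_H1:
  assumes w: "traj T w" and a: "continuous_on {0..T} a" and b: "continuous_on {0..T} b"
  shows "(\<lambda>t x. a t + of_real x * b t + sin_series (\<lambda>n. w n t) x) \<in> C_H1 T L"
  unfolding C_H1_def
proof (intro CollectI conjI ballI)
  fix t assume t: "t \<in> {0..T}"
  note ft = traj_finite_energy[OF w t]
  show "(\<lambda>x. a t + of_real x * b t + sin_series (\<lambda>n. w n t) x) \<in> H1 0 L" by (rule affine_sin_series_H1(1)[OF ft])
  define K where "K = 3 * L + 3 * L ^ 3 + 2 * L + 3 * L / mu 0"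
  define D where "D s = (cmod (a s - a t))\<^sup>2 + (cmod (b s - b t))\<^sup>2 + energy (\<lambda>n. w n s - w n t)" for s
  have "traj T (\<lambda>n s. w n s + (-1) * w n t)"
  proof (rule traj_add[OF w traj_mult])
    obtain m where m: "summable m" "\<And>n t. t \<in> {0..T} \<Longrightarrow> mu n * (cmod (w n t))\<^sup>2 \<le> m n"
      using w by (auto simp: traj_def)
    show "traj T (\<lambda>n s. w n t)" by (rule trajI[OF _ m(1)]) (use m t in auto)
  qed
  from energy_continuous[OF this] have "continuous_on {0..T} (\<lambda>s. energy (\<lambda>n. w n s - w n t))" by simp
  then have Dc: "continuous_on {0..T} D" unfolding D_def by (intro continuous_intros a b)
  then have "(D \<longlongrightarrow> D t) (at t within {0..T})" using t by (auto simp: continuous_on_def)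
  moreover have "D t = 0" by (simp add: D_def energy_def)
  ultimately have "((\<lambda>s. sqrt (K * D s)) \<longlongrightarrow> sqrt (K * 0)) (at t within {0..T})" by (intro tendsto_intros) simp
  then have lim: "((\<lambda>s. sqrt (K * D s)) \<longlongrightarrow> 0) (at t within {0..T})" by simp
  show "((\<lambda>s. H1_norm 0 L (\<lambda>x. a s + of_real x * b s + sin_series (\<lambda>n. w n s) x - (a t + of_real x * b t + sin_series (\<lambda>n. w n t) x))) \<longlongrightarrow> 0) (at t within {0..T})"
  proof (rule Lim_null_comparison[OF _ lim])
    show "\<forall>\<^sub>F s in at t within {0..T}. norm (H1_norm 0 L (\<lambda>x. a s + of_real x * b s + sin_series (\<lambda>n. w n s) x - (a t + of_real x * b t + sin_series (\<lambda>n. w n t) x))) \<le> sqrt (K * D s)"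
      unfolding eventually_at_filter
    proof (rule always_eventually, intro allI impI)
      fix s assume "s \<noteq> t" and s: "s \<in> {0..T}"
      note fs = traj_finite_energy[OF w s]
      have eq: "a s + of_real x * b s + sin_series (\<lambda>n. w n s) x - (a t + of_real x * b t + sin_series (\<lambda>n. w n t) x)
         = (a s - a t) + of_real x * (b s - b t) + sin_series (\<lambda>n. w n s - w n t) x" for x
        by (simp add: sin_series_diff[OF fs ft] algebra_simps)
      show "norm (H1_norm 0 L (\<lambda>x. a s + of_real x * b s + sin_series (\<lambda>n. w n s) x - (a t + of_real x * b t + sin_series (\<lambda>n. w n t) x))) \<le> sqrt (K * D s)"
        unfolding eq using affine_sin_series_H1(2)[OF finite_energy_diff[OF fs ft], of "a s - a t" "b s - b t"] H1_norm_nonneg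
        by (simp add: K_def D_def real_le_rsqrt)
    qed
  qed
qed

end

context mixed_interval
begin

section \<open>Functions on the space-time rectangle\<close>

text \<open>The time interval is fixed to unit length because the continuation proceeds in unit
  steps.\<close>

definition cont_rect :: "(real \<Rightarrow> real \<Rightarrow> 'a::topological_space) \<Rightarrow> bool" where
  "cont_rect f \<longleftrightarrow> continuous_on ({0..1} \<times> {0..L}) (\<lambda>(t, x). f t x)"

lemma cont_rect_slice:
  assumes "cont_rect f"
  shows "t \<in> {0..1} \<Longrightarrow> continuous_on {0..L} (f t)" 
    and "x \<in> {0..L} \<Longrightarrow> continuous_on {0..1} (\<lambda>t. f t x)"
proof -
  assume t: "t \<in> {0..1}"
  have "continuous_on {0..L} (\<lambda>x. case (t, x) of (t, x) \<Rightarrow> f t x)"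
    by (rule continuous_on_compose2[OF assms[unfolded cont_rect_def]]) (use t in \<open>auto intro!: continuous_intros\<close>)
  then show "continuous_on {0..L} (f t)" by simp
next
  assume x: "x \<in> {0..L}"
  have "continuous_on {0..1} (\<lambda>t. case (t, x) of (t, x) \<Rightarrow> f t x)"
    by (rule continuous_on_compose2[OF assms[unfolded cont_rect_def]]) (use x in \<open>auto intro!: continuous_intros\<close>)
  then show "continuous_on {0..1} (\<lambda>t. f t x)" by simp
qed

lemma cont_rect_compose:
  assumes "cont_rect f" "continuous_on UNIV g"
  shows "cont_rect (\<lambda>t x. g (f t x))"
  using continuous_on_compose2[OF assms(2) assms(1)[unfolded cont_rect_def]] by (simp add: cont_rect_def case_prod_beta')

lemma cont_rect_add: "cont_rect f \<Longrightarrow> cont_rect g \<Longrightarrow> cont_rect (\<lambda>t x. f t x + g t x :: 'a::real_normed_vector)"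
  unfolding cont_rect_def case_prod_beta' by (rule continuous_on_add)
lemma cont_rect_diff: "cont_rect f \<Longrightarrow> cont_rect g \<Longrightarrow> cont_rect (\<lambda>t x. f t x - g t x :: 'a::real_normed_vector)"
  unfolding cont_rect_def case_prod_beta' by (rule continuous_on_diff)
lemma cont_rect_mult: "cont_rect f \<Longrightarrow> cont_rect g \<Longrightarrow> cont_rect (\<lambda>t x. f t x * g t x :: 'a::real_normed_algebra)"
  unfolding cont_rect_def case_prod_beta' by (rule continuous_on_mult)
lemma cont_rect_norm: "cont_rect f \<Longrightarrow> cont_rect (\<lambda>t x. norm (f t x :: 'a::real_normed_vector))"
  unfolding cont_rect_def case_prod_beta' by (rule continuous_on_norm)
lemma cont_rect_power: "cont_rect f \<Longrightarrow> cont_rect (\<lambda>t x. (f t x :: 'a::real_normed_algebra_1) ^ n)"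
  unfolding cont_rect_def case_prod_beta' by (rule continuous_on_power)
lemma cont_rect_cnj: "cont_rect f \<Longrightarrow> cont_rect (\<lambda>t x. cnj (f t x))"
  unfolding cont_rect_def case_prod_beta' by (rule continuous_on_cnj)
lemma cont_rect_Re: "cont_rect f \<Longrightarrow> cont_rect (\<lambda>t x. Re (f t x))"
  unfolding cont_rect_def case_prod_beta' by (rule continuous_on_Re)
lemma cont_rect_time: "continuous_on {0..1} g \<Longrightarrow> cont_rect (\<lambda>t x. g t)"
  unfolding cont_rect_def case_prod_beta' 
  by (rule continuous_on_compose2[OF _ continuous_on_fst[OF continuous_on_id]]) auto
lemma cont_rect_space: "continuous_on {0..L} g \<Longrightarrow> cont_rect (\<lambda>t x. g x)"
  unfolding cont_rect_def case_prod_beta' 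
  by (rule continuous_on_compose2[OF _ continuous_on_snd[OF continuous_on_id]]) auto

lemma cont_rect_integral_space:
  fixes f :: "real \<Rightarrow> real \<Rightarrow> 'a::banach"
  assumes "cont_rect f"
  shows "continuous_on {0..1} (\<lambda>s. integral {0..L} (f s))"
  using integral_continuous_on_param[of "{0..1}" 0 L f] assms by (simp add: cont_rect_def)

lemma cont_rect_swap:
  fixes f :: "real \<Rightarrow> real \<Rightarrow> 'a::topological_space"
  assumes "cont_rect f" "t \<in> {0..1}"
  shows "continuous_on ({0..L} \<times> {0..t}) (\<lambda>(x, s). f s x)"
proof -
  have "continuous_on ({0..L} \<times> {0..t}) (\<lambda>z. case (snd z, fst z) of (s, x) \<Rightarrow> f s x)"
    by (rule continuous_on_compose2[OF assms(1)[unfolded cont_rect_def]]) (use assms(2) in \<open>auto intro!: continuous_intros\<close>)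
  then show ?thesis by (simp add: case_prod_beta')
qed

lemma cont_rect_integral_time:
  fixes f :: "real \<Rightarrow> real \<Rightarrow> 'a::banach"
  assumes "cont_rect f" "t \<in> {0..1}"
  shows "continuous_on {0..L} (\<lambda>x. integral {0..t} (\<lambda>s. f s x))"
  using integral_continuous_on_param[of "{0..L}" 0 t "\<lambda>x s. f s x"] cont_rect_swap[OF assms] by simp

lemma cont_rect_fubini:
  fixes f :: "real \<Rightarrow> real \<Rightarrow> 'a::banach"
  assumes "cont_rect f" "t \<in> {0..1}"
  shows "integral {0..t} (\<lambda>s. integral {0..L} (f s)) = integral {0..L} (\<lambda>x. integral {0..t} (\<lambda>s. f s x))"
proof -
  have "continuous_on (cbox (0, 0) (t, L)) (\<lambda>(s, x). f s x)"
    unfolding cbox_Pair_eq box_real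
    by (rule continuous_on_subset[OF assms(1)[unfolded cont_rect_def]]) (use assms(2) in auto)
  from integral_swap_continuous[OF this] show ?thesis by simp
qed

lemma cont_rect_bounded:
  assumes "cont_rect (f :: real \<Rightarrow> real \<Rightarrow> complex)"
  obtains B where "\<And>t x. t \<in> {0..1} \<Longrightarrow> x \<in> {0..L} \<Longrightarrow> cmod (f t x) \<le> B"
proof -
  have "compact ({0..1::real} \<times> {0..L})" by (intro compact_Times compact_Icc)
  from compact_imp_bounded[OF compact_continuous_image[OF assms[unfolded cont_rect_def] this]]
  obtain B where "\<forall>z\<in>{0..1} \<times> {0..L}. cmod (case z of (t, x) \<Rightarrow> f t x) \<le> B" by (auto simp: bounded_iff)
  then show thesis using that[of B] by auto
qed

lemma cont_rect_coef:
  assumes "cont_rect f"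
  shows "continuous_on {0..1} (\<lambda>s. coef (f s) n)"
proof -
  have "cont_rect (\<lambda>s x. complex_of_real (sin (freq n * x)) * f s x)"
    by (intro cont_rect_mult assms cont_rect_space continuous_intros)
  from cont_rect_integral_space[OF this] show ?thesis unfolding coef_def scaleR_conv_of_real
    by (intro continuous_intros)
qed

lemma cont_rect_coef_integral:
  assumes "cont_rect f" and t: "t \<in> {0..1}"
  shows "integral {0..t} (\<lambda>s. coef (f s) n) = coef (\<lambda>x. integral {0..t} (\<lambda>s. f s x)) n"
proof -
  have j: "cont_rect (\<lambda>s x. complex_of_real (sin (freq n * x)) * f s x)"
    by (intro cont_rect_mult assms cont_rect_space continuous_intros)
  have "integral {0..t} (\<lambda>s. coef (f s) n) = (2 / L) *\<^sub>R integral {0..t} (\<lambda>s. integral {0..L} (\<lambda>x. complex_of_real (sin (freq n * x)) * f s x))"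
    unfolding coef_def scaleR_conv_of_real by simp
  also have "\<dots> = (2 / L) *\<^sub>R integral {0..L} (\<lambda>x. integral {0..t} (\<lambda>s. complex_of_real (sin (freq n * x)) * f s x))"
    by (simp only: cont_rect_fubini[OF j t])
  also have "\<dots> = coef (\<lambda>x. integral {0..t} (\<lambda>s. f s x)) n"
    unfolding coef_def scaleR_conv_of_real by simp
  finally show ?thesis .
qed

lemma sin_series_sup_energy:
  assumes c: "finite_energy c" and x: "x \<in> {0..L}"
  shows "(cmod (sin_series c x))\<^sup>2 \<le> L / freq 0 * energy c"
proof (rule power2_le_imp_le)
  note E0 = energy_nonneg[OF c]
  have "((cmod (sin_series c x))\<^sup>2)\<^sup>2 = (cmod (sin_series c x)) ^ 4" by simp
  also have "\<dots> \<le> L\<^sup>2 * (\<Sum>n. (cmod (c n))\<^sup>2) * energy c" by (rule agmon[OF c x])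
  also have "\<dots> \<le> L\<^sup>2 * (energy c / mu 0) * energy c"
    using suminf_sq_le_energy[OF c] E0 by (intro mult_right_mono mult_left_mono) auto
  also have "\<dots> = (L / freq 0 * energy c)\<^sup>2" by (simp add: mu_def power2_eq_square)
  finally show "((cmod (sin_series c x))\<^sup>2)\<^sup>2 \<le> (L / freq 0 * energy c)\<^sup>2" .
  show "0 \<le> L / freq 0 * energy c" using L_pos freq_pos[of 0] E0 by simp
qed

end

section \<open>Duhamel's formula for the mixed problem\<close>

locale cgl = mixed_interval L for L :: real +
  fixes \<nu> \<alpha> \<kappa> \<beta> \<gamma> p :: real
  assumes \<nu>: "\<nu> > 0" and \<kappa>: "\<kappa> > 0" and \<gamma>: "\<gamma> \<ge> 0" and p: "0 < p" "p \<le> 2"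
begin

definition lam :: complex where "lam = of_real \<nu> + \<i> * of_real \<alpha>"
definition rate :: "nat \<Rightarrow> complex" where "rate n = lam * of_real (mu n)"

lemma Re_rate: "Re (rate n) = \<nu> * mu n" by (simp add: rate_def lam_def)
lemma Re_rate_pos: "Re (rate n) > 0" using \<nu> mu_pos[of n] by (simp add: Re_rate)
lemma lam_nonzero: "lam \<noteq> 0" using \<nu> by (auto simp: lam_def complex_eq_iff)
text \<open>The ratio does not depend on \<open>n\<close>, which makes \<open>layer_bound\<close>
  uniform over the modes.\<close>

lemma rate_ratio: "cmod (rate n) / Re (rate n) = cmod lam / \<nu>"
  using mu_pos[of n] unfolding Re_rate by (simp add: rate_def norm_mult)

definition duhamel_mode :: "(real \<Rightarrow> real \<Rightarrow> complex) \<Rightarrow> nat \<Rightarrow> real \<Rightarrow> complex" where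
  "duhamel_mode f n t = duhamel (rate n) (\<lambda>s. coef (f s) n) t"

text \<open>The factor \<open>mu n\<close> cancels against Re (rate n): one space derivative is
  gained over the forcing.\<close>

lemma duhamel_mode_mode_bound:
  assumes f: "cont_rect f" and t: "t \<in> {0..1}"
  shows "mu n * (cmod (duhamel_mode f n t))\<^sup>2 \<le> integral {0..t} (\<lambda>s. (cmod (coef (f s) n))\<^sup>2) / (2 * \<nu>)"
proof -
  have "(cmod (duhamel_mode f n t))\<^sup>2 \<le> integral {0..t} (\<lambda>s. (cmod (coef (f s) n))\<^sup>2) / (2 * (\<nu> * mu n))"
    using duhamel_bound[OF cont_rect_coef[OF f] t Re_rate_pos, of n n] by (simp add: duhamel_mode_def Re_rate)
  from mult_left_mono[OF this, of "mu n"] show ?thesis using mu_pos[of n] by (simp add: mult_ac)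
qed

lemma coef_time_bessel:
  assumes f: "cont_rect f" and t: "t \<in> {0..1}"
  shows "(\<Sum>n<N. integral {0..t} (\<lambda>s. (cmod (coef (f s) n))\<^sup>2)) \<le> 2 / L * integral {0..t} (\<lambda>s. integral {0..L} (\<lambda>x. (cmod (f s x))\<^sup>2))"
proof -
  have c: "continuous_on {0..t} (\<lambda>s. coef (f s) n)" for n
    by (rule continuous_on_subset[OF cont_rect_coef[OF f]]) (use t in auto)
  have ic: "continuous_on {0..t} (\<lambda>s. integral {0..L} (\<lambda>x. (cmod (f s x))\<^sup>2))"
    by (rule continuous_on_subset[OF cont_rect_integral_space[OF cont_rect_power[OF cont_rect_norm[OF f]]]]) (use t in auto)
  have "(\<Sum>n<N. integral {0..t} (\<lambda>s. (cmod (coef (f s) n))\<^sup>2)) = integral {0..t} (\<lambda>s. \<Sum>n<N. (cmod (coef (f s) n))\<^sup>2)"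
    by (intro Henstock_Kurzweil_Integration.integral_sum[symmetric] integrable_continuous_real continuous_intros c) simp
  also have "\<dots> \<le> integral {0..t} (\<lambda>s. 2 / L * integral {0..L} (\<lambda>x. (cmod (f s x))\<^sup>2))"
  proof (rule integral_le)
    show "(\<lambda>s. \<Sum>n<N. (cmod (coef (f s) n))\<^sup>2) integrable_on {0..t}"
      "(\<lambda>s. 2 / L * integral {0..L} (\<lambda>x. (cmod (f s x))\<^sup>2)) integrable_on {0..t}"
      by (intro integrable_continuous_real continuous_intros c ic)+
    fix s assume "s \<in> {0..t}"
    then have "continuous_on {0..L} (f s)" using t by (intro cont_rect_slice(1)[OF f]) auto
    from coef_bessel[OF this, of "{..<N}"]
    show "(\<Sum>n<N. (cmod (coef (f s) n))\<^sup>2) \<le> 2 / L * integral {0..L} (\<lambda>x. (cmod (f s x))\<^sup>2)"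
      using L_pos by (simp add: field_simps)
  qed
  finally show ?thesis by simp
qed

lemma duhamel_mode_traj:
  assumes f: "cont_rect f"
  shows "traj 1 (duhamel_mode f)"
proof (rule trajI)
  show "continuous_on {0..1} (duhamel_mode f n)" for n
    unfolding duhamel_mode_def[abs_def] by (rule duhamel_continuous[OF cont_rect_coef[OF f]])
  have c: "continuous_on {0..1} (\<lambda>s. (cmod (coef (f s) n))\<^sup>2)" for n
    by (intro continuous_intros cont_rect_coef f)
  show "summable (\<lambda>n. integral {0..1} (\<lambda>s. (cmod (coef (f s) n))\<^sup>2) / (2 * \<nu>))"
  proof (rule summable_divide, rule summableI_nonneg_bounded)
    show "0 \<le> integral {0..1} (\<lambda>s. (cmod (coef (f s) n))\<^sup>2)" for n
      by (intro Henstock_Kurzweil_Integration.integral_nonneg integrable_continuous_real c) simp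
    show "(\<Sum>n<N. integral {0..1} (\<lambda>s. (cmod (coef (f s) n))\<^sup>2)) \<le> 2 / L * integral {0..1} (\<lambda>s. integral {0..L} (\<lambda>x. (cmod (f s x))\<^sup>2))" for N
      by (rule coef_time_bessel[OF f]) simp
  qed
  fix n and t :: real assume t: "t \<in> {0..1}"
  have "integral {0..t} (\<lambda>s. (cmod (coef (f s) n))\<^sup>2) \<le> integral {0..1} (\<lambda>s. (cmod (coef (f s) n))\<^sup>2)"
    by (intro integral_subset_le integrable_continuous_real c continuous_on_subset[OF c]) (use t in auto)
  then show "mu n * (cmod (duhamel_mode f n t))\<^sup>2 \<le> integral {0..1} (\<lambda>s. (cmod (coef (f s) n))\<^sup>2) / (2 * \<nu>)"
    using duhamel_mode_mode_bound[OF f t, of n] \<nu> by (smt (verit) divide_right_mono)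
qed

lemma duhamel_mode_energy_le:
  assumes f: "cont_rect f" and t: "t \<in> {0..1}"
  shows "energy (\<lambda>n. duhamel_mode f n t) \<le> integral {0..t} (\<lambda>s. integral {0..L} (\<lambda>x. (cmod (f s x))\<^sup>2)) / (\<nu> * L)"
  unfolding energy_def
proof (rule suminf_le_const)
  show "summable (\<lambda>n. mu n * (cmod (duhamel_mode f n t))\<^sup>2)"
    using traj_finite_energy[OF duhamel_mode_traj[OF f] t] by (simp add: finite_energy_def)
  fix N
  have "(\<Sum>n<N. mu n * (cmod (duhamel_mode f n t))\<^sup>2) \<le> (\<Sum>n<N. integral {0..t} (\<lambda>s. (cmod (coef (f s) n))\<^sup>2) / (2 * \<nu>))"
    by (intro sum_mono duhamel_mode_mode_bound f t)
  also have "\<dots> = (\<Sum>n<N. integral {0..t} (\<lambda>s. (cmod (coef (f s) n))\<^sup>2)) / (2 * \<nu>)" by (rule sum_divide_distrib[symmetric])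
  also have "\<dots> \<le> (2 / L * integral {0..t} (\<lambda>s. integral {0..L} (\<lambda>x. (cmod (f s x))\<^sup>2))) / (2 * \<nu>)"
    using \<nu> by (intro divide_right_mono coef_time_bessel f t) simp
  also have "\<dots> = integral {0..t} (\<lambda>s. integral {0..L} (\<lambda>x. (cmod (f s x))\<^sup>2)) / (\<nu> * L)" by (simp add: mult.commute)
  finally show "(\<Sum>n<N. mu n * (cmod (duhamel_mode f n t))\<^sup>2) \<le> integral {0..t} (\<lambda>s. integral {0..L} (\<lambda>x. (cmod (f s x))\<^sup>2)) / (\<nu> * L)" .
qed

lemma duhamel_mode_diff:
  assumes f: "cont_rect f" and g: "cont_rect g" and t: "t \<in> {0..1}"
  shows "duhamel_mode f n t - duhamel_mode g n t = duhamel_mode (\<lambda>s x. f s x - g s x) n t"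
proof -
  have "duhamel_mode f n t - duhamel_mode g n t = duhamel (rate n) (\<lambda>s. coef (f s) n - coef (g s) n) t"
    unfolding duhamel_mode_def by (rule duhamel_diff[OF cont_rect_coef[OF f] cont_rect_coef[OF g] t])
  also have "\<dots> = duhamel_mode (\<lambda>s x. f s x - g s x) n t"
    unfolding duhamel_mode_def duhamel_def
    by (intro arg_cong[where f="\<lambda>z. _ * z"] Henstock_Kurzweil_Integration.integral_cong)
      (use t in \<open>simp add: coef_diff[OF cont_rect_slice(1)[OF f] cont_rect_slice(1)[OF g]]\<close>)
  finally show ?thesis .
qed

lemma duhamel_mode_integral:
  assumes f: "cont_rect f" and t: "t \<in> {0..1}"
  shows "duhamel_mode f n t = coef (\<lambda>x. integral {0..t} (\<lambda>s. f s x)) n - rate n * integral {0..t} (duhamel_mode f n)"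
  using duhamel_integral[OF cont_rect_coef[OF f] t, of "rate n"] cont_rect_coef_integral[OF f t] by (simp add: duhamel_mode_def[abs_def])

end

locale cgl_data = cgl L \<nu> \<alpha> \<kappa> \<beta> \<gamma> p for L \<nu> \<alpha> \<kappa> \<beta> \<gamma> p :: real +
  fixes u0 a b :: "real \<Rightarrow> complex" and H :: real
  assumes u0: "u0 \<in> H1 0 L" and ac: "continuous_on {0..1} a" and bc: "continuous_on {0..1} b"
    and H: "H \<ge> 0"
    and ah: "\<And>s t. s \<in> {0..1} \<Longrightarrow> t \<in> {0..1} \<Longrightarrow> (cmod (a t - a s))\<^sup>2 \<le> H * \<bar>t - s\<bar>"
    and bh: "\<And>s t. s \<in> {0..1} \<Longrightarrow> t \<in> {0..1} \<Longrightarrow> (cmod (b t - b s))\<^sup>2 \<le> H * \<bar>t - s\<bar>"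
    and compat: "u0 0 = a 0"
begin

text \<open>Subtracting the affine lift makes the initial value vanish at 0, by compatibility; only
  then are its sine coefficients of finite energy.\<close>

definition w0 :: "real \<Rightarrow> complex" where "w0 x = u0 x - (a 0 + of_real x * b 0)"

text \<open>The lift minus its affine part a t + x b t solves y_t - lam y_xx = - (a' + x b') with
  homogeneous boundary conditions. In each mode the initial value decays and the right-hand side
  contributes one boundary layer for \<open>a\<close> and one for \<open>b\<close>.\<close>

definition ell :: "nat \<Rightarrow> real \<Rightarrow> complex" where
  "ell n t = exp (- (rate n * of_real t)) * coef w0 n - coef (\<lambda>x. 1) n * layer (rate n) a t
     - coef of_real n * layer (rate n) b t"

lemma w0_H1: "w0 \<in> H1 0 L"
proof -
  have "(\<lambda>x. a 0 + of_real x * b 0 + sin_series (\<lambda>n. 0) x) \<in> H1 0 L"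
    by (rule affine_sin_series_H1(1)) (simp add: finite_energy_def)
  then have "(\<lambda>x. a 0 + of_real x * b 0) \<in> H1 0 L" by (simp add: sin_series_def)
  from H1_diff[OF u0 this] show ?thesis by (simp add: w0_def[abs_def])
qed

lemma w0_continuous: "continuous_on {0..L} w0" using w0_H1 by (simp add: H1_def)

lemma w0_energy: "finite_energy (coef w0)"
  by (rule finite_energy_coef_H1[OF w0_H1]) (simp add: w0_def compat)

lemma layer_traj:
  assumes c: "continuous_on {0..1} c" and h: "\<And>s t. s \<in> {0..1} \<Longrightarrow> t \<in> {0..1} \<Longrightarrow> (cmod (c t - c s))\<^sup>2 \<le> H * \<bar>t - s\<bar>"
    and f: "continuous_on {0..L} f"
  shows "traj 1 (\<lambda>n t. coef f n * layer (rate n) c t)"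
proof (rule trajI)
  show "continuous_on {0..1} (\<lambda>t. coef f n * layer (rate n) c t)" for n
    by (intro continuous_intros layer_continuous c)
  show "summable (\<lambda>n. (cmod (coef f n))\<^sup>2 * (H * (1 + 2 * cmod lam / \<nu>)\<^sup>2 / \<nu>))"
    by (intro summable_mult2 summable_coef_sq f)
  fix n and t :: real assume t: "t \<in> {0..1}"
  have "Re (rate n) * (cmod (layer (rate n) c t))\<^sup>2 \<le> H * (1 + 2 * cmod (rate n) / Re (rate n))\<^sup>2"
    by (rule layer_bound[OF c t Re_rate_pos H h])
  also have "2 * cmod (rate n) / Re (rate n) = 2 * cmod lam / \<nu>" using rate_ratio[of n] by (metis times_divide_eq_right)
  finally have "mu n * (cmod (layer (rate n) c t))\<^sup>2 \<le> H * (1 + 2 * cmod lam / \<nu>)\<^sup>2 / \<nu>"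
    using \<nu> by (simp add: Re_rate field_simps)
  from mult_left_mono[OF this, of "(cmod (coef f n))\<^sup>2"]
  show "mu n * (cmod (coef f n * layer (rate n) c t))\<^sup>2 \<le> (cmod (coef f n))\<^sup>2 * (H * (1 + 2 * cmod lam / \<nu>)\<^sup>2 / \<nu>)"
    by (simp add: norm_mult power_mult_distrib mult_ac)
qed

lemma exp_rate_continuous: "continuous_on S (\<lambda>t. exp (- (rate n * complex_of_real t)))"
  unfolding minus_mult_left by (rule continuous_exp_rate)

lemma ell_traj: "traj 1 ell"
proof -
  have 1: "traj 1 (\<lambda>n t. exp (- (rate n * of_real t)) * coef w0 n)"
  proof (rule trajI)
    show "continuous_on {0..1} (\<lambda>t. exp (- (rate n * complex_of_real t)) * coef w0 n)" for n
      by (intro continuous_intros exp_rate_continuous)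
    show "summable (\<lambda>n. mu n * (cmod (coef w0 n))\<^sup>2)" using w0_energy by (simp add: finite_energy_def)
    fix n and t :: real assume t: "t \<in> {0..1}"
    have "cmod (exp (- (rate n * of_real t))) \<le> 1" using Re_rate_pos[of n] t by simp
    then have "cmod (exp (- (rate n * of_real t)) * coef w0 n) \<le> cmod (coef w0 n)"
      by (metis mult_left_le_one_le norm_ge_zero norm_mult)
    then show "mu n * (cmod (exp (- (rate n * of_real t)) * coef w0 n))\<^sup>2 \<le> mu n * (cmod (coef w0 n))\<^sup>2"
      using mu_pos[of n] by (intro mult_left_mono power_mono) auto
  qed
  have xc: "continuous_on {0..L} (\<lambda>x. complex_of_real x)" by (intro continuous_intros)
  have "traj 1 (\<lambda>n t. (exp (- (rate n * of_real t)) * coef w0 n + (-1) * (coef (\<lambda>x. 1) n * layer (rate n) a t))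
     + (-1) * (coef of_real n * layer (rate n) b t))"
    by (intro traj_add traj_mult 1 layer_traj ac ah bc bh xc continuous_on_const)
  then show ?thesis by (simp add: ell_def[abs_def])
qed

lemma ell_integral:
  assumes t: "t \<in> {0..1}"
  shows "ell n t = coef w0 n - rate n * integral {0..t} (ell n)
      - coef (\<lambda>x. 1) n * (a t - a 0) - coef of_real n * (b t - b 0)"
proof -
  have l: "continuous_on {0..t} (layer (rate n) a)" "continuous_on {0..t} (layer (rate n) b)"
    using t by (auto intro!: layer_continuous continuous_on_subset[OF ac] continuous_on_subset[OF bc])
  have "integral {0..t} (ell n) = integral {0..t} (\<lambda>s. exp (- (rate n * of_real s)) * coef w0 n - coef (\<lambda>x. 1) n * layer (rate n) a s)
     - integral {0..t} (\<lambda>s. coef of_real n * layer (rate n) b s)"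
    unfolding ell_def[abs_def]
    by (intro integral_diff_continuous continuous_intros l exp_rate_continuous)
  also have "integral {0..t} (\<lambda>s. exp (- (rate n * of_real s)) * coef w0 n - coef (\<lambda>x. 1) n * layer (rate n) a s)
     = integral {0..t} (\<lambda>s. exp (- (rate n * of_real s)) * coef w0 n) - integral {0..t} (\<lambda>s. coef (\<lambda>x. 1) n * layer (rate n) a s)"
    by (intro integral_diff_continuous continuous_intros l exp_rate_continuous)
  finally have I: "integral {0..t} (ell n) = integral {0..t} (\<lambda>s. exp (- (rate n * of_real s))) * coef w0 n
     - coef (\<lambda>x. 1) n * integral {0..t} (layer (rate n) a) - coef of_real n * integral {0..t} (layer (rate n) b)"
    by simp
  have "rate n * integral {0..t} (ell n) = (rate n * integral {0..t} (\<lambda>s. exp (- (rate n * of_real s)))) * coef w0 n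
     - coef (\<lambda>x. 1) n * (rate n * integral {0..t} (layer (rate n) a)) - coef of_real n * (rate n * integral {0..t} (layer (rate n) b))"
    unfolding I by (simp add: algebra_simps)
  also have "rate n * integral {0..t} (\<lambda>s. exp (- (rate n * of_real s))) = 1 - exp (- (rate n * of_real t))"
    by (rule integral_exp_decay) (use t in simp)
  also have "rate n * integral {0..t} (layer (rate n) a) = a t - a 0 - layer (rate n) a t"
    using layer_integral[OF ac t, of "rate n"] by (simp add: algebra_simps)
  also have "rate n * integral {0..t} (layer (rate n) b) = b t - b 0 - layer (rate n) b t"
    using layer_integral[OF bc t, of "rate n"] by (simp add: algebra_simps)
  finally have J: "rate n * integral {0..t} (ell n) = (1 - exp (- (rate n * of_real t))) * coef w0 n
     - coef (\<lambda>x. 1) n * (a t - a 0 - layer (rate n) a t) - coef of_real n * (b t - b 0 - layer (rate n) b t)" .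
  show ?thesis unfolding J by (simp add: ell_def algebra_simps)
qed

lemma ell_0: "ell n 0 = coef w0 n" by (simp add: ell_def layer_def duhamel_0)

text \<open>The solution of y_t = lam y_xx with the given initial and boundary data. The linear
  growth term is not included; it belongs to the forcing \<open>G\<close>.\<close>

definition zeta :: "real \<Rightarrow> real \<Rightarrow> complex" where
  "zeta t x = a t + of_real x * b t + sin_series (\<lambda>n. ell n t) x"

lemma zeta_cont_rect: "cont_rect zeta"
proof -
  have "cont_rect (\<lambda>t x. a t + of_real x * b t)"
    by (intro cont_rect_add cont_rect_mult cont_rect_time cont_rect_space ac bc continuous_intros)
  moreover have "cont_rect (\<lambda>t x. sin_series (\<lambda>n. ell n t) x)" unfolding cont_rect_def by (rule traj_continuous[OF ell_traj])
  ultimately show ?thesis unfolding zeta_def[abs_def] by (rule cont_rect_add)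
qed

end

context cgl
begin

section \<open>The truncated nonlinearity\<close>

definition damping :: complex where "damping = of_real \<kappa> + \<i> * of_real \<beta>"

text \<open>Only the modulus in the power factor is cut off; the phase of \<open>u\<close> is kept,
  so the damping retains its sign.\<close>

definition trunc_power :: "real \<Rightarrow> complex \<Rightarrow> complex" where
  "trunc_power r u = of_real (min (cmod u) r powr p) * u"

definition G :: "real \<Rightarrow> complex \<Rightarrow> complex" where
  "G r u = of_real \<gamma> * u - damping * trunc_power r u"

text \<open>Order the moduli so that |u| is the smaller one. The difference u - v carries the
  smaller weight, and the difference of the weights, which multiplies v, is controlled through 1 -
  x^p <= 1 - x^2 <= 2 (1 - x) on [0,1], valid as p <= 2. The two parts contribute 1 and 2 to the
  constant 3.\<close>

lemma trunc_power_lipschitz: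
  assumes r: "r > 0"
  shows "cmod (trunc_power r u - trunc_power r v) \<le> 3 * r powr p * cmod (u - v)"
proof -
  have *: "cmod (trunc_power r u - trunc_power r v) \<le> 3 * r powr p * cmod (u - v)" if uv: "cmod u \<le> cmod v" for u v
  proof -
    define s where "s = min (cmod u) r"
    define m where "m = min (cmod v) r"
    have sm: "0 \<le> s" "s \<le> m" "m \<le> r" "m \<le> cmod v" using uv r by (auto simp: s_def m_def)
    have "trunc_power r u - trunc_power r v = of_real (s powr p) * (u - v) - of_real (m powr p - s powr p) * v"
      by (simp add: trunc_power_def s_def m_def algebra_simps)
    then have "cmod (trunc_power r u - trunc_power r v) \<le> cmod (of_real (s powr p) * (u - v)) + cmod (of_real (m powr p - s powr p) * v)"
      by (simp only: norm_triangle_ineq4)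
    also have "cmod (of_real (s powr p) * (u - v)) \<le> r powr p * cmod (u - v)"
      using sm p by (simp add: norm_mult mult_right_mono powr_mono2)
    also have "cmod (of_real (m powr p - s powr p) * v) \<le> 2 * r powr p * cmod (u - v)"
    proof (cases "s = m")
      case True then show ?thesis by simp
    next
      case False
      \<comment> \<open>If |u| reached the level, both truncated moduli would equal
        \<open>r\<close>.\<close>
      then have "cmod u < r" "s = cmod u" "m > 0" using uv r sm by (auto simp: s_def m_def min_def split: if_splits)
      have q1: "0 \<le> s / m" "s / m \<le> 1" using sm \<open>m > 0\<close> by auto
      have "(s / m)\<^sup>2 \<le> (s / m) powr p"
      proof (cases "s = 0")
        case False
        then have "(s / m)\<^sup>2 = (s / m) powr 2" using sm \<open>m > 0\<close> by (simp add: powr_numeral)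
        also have "\<dots> \<le> (s / m) powr p" using q1 p by (intro powr_mono') auto
        finally show ?thesis .
      qed simp
      moreover have "1 - (s / m)\<^sup>2 \<le> 2 * (1 - s / m)"
        using zero_le_power2[of "1 - s / m"] by (simp add: power2_eq_square algebra_simps)
      ultimately have "1 - (s / m) powr p \<le> 2 * (1 - s / m)" by linarith
      then have "m powr p * (1 - (s / m) powr p) \<le> m powr p * (2 * (1 - s / m))" by (rule mult_left_mono) simp
      moreover have "m powr p * (1 - (s / m) powr p) = m powr p - s powr p"
        using sm \<open>m > 0\<close> by (simp add: powr_divide field_simps)
      ultimately have "(m powr p - s powr p) * cmod v \<le> m powr p * (2 * (1 - s / m)) * cmod v"
        by (simp add: mult_right_mono)
      also have "\<dots> = 2 * m powr p * ((1 - s / m) * cmod v)" by simp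
      also have "(1 - s / m) * cmod v \<le> cmod v - s"
      proof -
        have "s * m \<le> s * cmod v" using sm by (intro mult_left_mono) auto
        then have "s \<le> s / m * cmod v" using \<open>m > 0\<close> by (simp add: field_simps)
        then show ?thesis by (simp add: algebra_simps)
      qed
      also have "2 * m powr p * (cmod v - s) \<le> 2 * r powr p * cmod (u - v)"
      proof (rule mult_mono)
        show "cmod v - s \<le> cmod (u - v)"
          using norm_triangle_ineq2[of v u] \<open>s = cmod u\<close> by (simp add: norm_minus_commute)
        show "2 * m powr p \<le> 2 * r powr p" using sm p by (simp add: powr_mono2)
      qed (use sm in auto)
      finally have "(m powr p - s powr p) * cmod v \<le> 2 * r powr p * cmod (u - v)" by (simp add: mult_left_mono)
      moreover have "s powr p \<le> m powr p" using sm p by (intro powr_mono2) auto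
      ultimately show ?thesis by (simp add: norm_mult flip: of_real_diff)
    qed
    finally show ?thesis by simp
  qed
  show ?thesis
    using *[of u v] *[of v u] by (cases "cmod u \<le> cmod v") (auto simp: norm_minus_commute)
qed

definition G_lip :: "real \<Rightarrow> real" where "G_lip r = \<gamma> + cmod damping * (3 * r powr p)"

lemma G_lip_nonneg: "G_lip r \<ge> 0" using \<gamma> by (simp add: G_lip_def)

lemma G_lipschitz:
  assumes r: "r > 0"
  shows "cmod (G r u - G r v) \<le> G_lip r * cmod (u - v)"
proof -
  have "G r u - G r v = of_real \<gamma> * (u - v) - damping * (trunc_power r u - trunc_power r v)" by (simp add: G_def algebra_simps)
  then have "cmod (G r u - G r v) \<le> cmod (of_real \<gamma> * (u - v)) + cmod (damping * (trunc_power r u - trunc_power r v))"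
    by (simp only: norm_triangle_ineq4)
  also have "\<dots> \<le> \<gamma> * cmod (u - v) + cmod damping * (3 * r powr p * cmod (u - v))"
    unfolding norm_mult using \<gamma> by (intro add_mono mult_left_mono trunc_power_lipschitz r) auto
  finally show ?thesis by (simp add: G_lip_def algebra_simps)
qed

lemma G_continuous:
  assumes r: "r > 0"
  shows "continuous_on UNIV (G r)"
  unfolding continuous_on_iff
proof (intro ballI allI impI)
  fix u and e :: real assume e: "e > 0"
  have K: "G_lip r + 1 > 0" using G_lip_nonneg[of r] by simp
  show "\<exists>d>0. \<forall>v\<in>UNIV. dist v u < d \<longrightarrow> dist (G r v) (G r u) < e"
  proof (intro exI[of _ "e / (G_lip r + 1)"] conjI ballI impI)
    show "e / (G_lip r + 1) > 0" using e K by simp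
    fix v assume "dist v u < e / (G_lip r + 1)"
    then have "(G_lip r + 1) * cmod (v - u) < e" using K by (simp add: dist_norm field_simps)
    moreover have "G_lip r * cmod (v - u) \<le> (G_lip r + 1) * cmod (v - u)" by (intro mult_right_mono) auto
    ultimately show "dist (G r v) (G r u) < e" using G_lipschitz[OF r, of v u] by (simp add: dist_norm)
  qed
qed

lemma trunc_power_norm: "cmod (trunc_power r u) = min (cmod u) r powr p * cmod u"
  by (simp add: trunc_power_def norm_mult)

text \<open>The damping \<open>\<kappa> |u|\<^sup>p\<^sup>+\<^sup>2\<close> beats the interaction with the lift \<open>z\<close> as soon as
  \<open>\<kappa> |u| \<ge> |\<kappa> + i\<beta>| M\<close>, whatever the sign of \<open>\<beta>\<close> and the truncation level.\<close>

lemma G_dissipative: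
  assumes r: "r > 0" and z: "cmod z \<le> M"
  shows "Re (q * cnj (G r (z + q))) \<le> \<gamma> * ((cmod q)\<^sup>2 + M * cmod q) + (cmod damping * M / \<kappa>) powr p * (cmod damping * M / \<kappa>) * (cmod damping * M)"
proof -
  define u where "u = z + q"
  define m where "m = min (cmod u) r powr p"
  define M1 where "M1 = cmod damping * M / \<kappa>"
  have M0: "M \<ge> 0" using z norm_ge_zero order_trans by blast
  have m0: "m \<ge> 0" by (simp add: m_def)
  have M10: "M1 \<ge> 0" using M0 \<kappa> by (simp add: M1_def)
  have "Re (q * cnj (G r u)) = \<gamma> * Re (q * cnj u) - m * Re (q * cnj (damping * u))"
    by (simp add: G_def trunc_power_def m_def algebra_simps)
  moreover have "\<gamma> * Re (q * cnj u) \<le> \<gamma> * ((cmod q)\<^sup>2 + M * cmod q)"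
  proof (rule mult_left_mono[OF _ \<gamma>])
    have "Re (q * cnj u) \<le> cmod q * cmod u" using complex_Re_le_cmod[of "q * cnj u"] by (simp add: norm_mult)
    also have "\<dots> \<le> cmod q * (M + cmod q)"
      using norm_triangle_ineq[of z q] z by (intro mult_left_mono) (auto simp: u_def)
    finally show "Re (q * cnj u) \<le> (cmod q)\<^sup>2 + M * cmod q" by (simp add: power2_eq_square algebra_simps)
  qed
  moreover have "- (m * Re (q * cnj (damping * u))) \<le> M1 powr p * M1 * (cmod damping * M)"
  proof -
    have q: "q = u - z" by (simp add: u_def)
    have "Re (q * cnj (damping * u)) = \<kappa> * (cmod u)\<^sup>2 - Re (z * cnj (damping * u))"
      unfolding q cmod_power2 by (simp add: damping_def power2_eq_square algebra_simps)
    moreover have "Re (z * cnj (damping * u)) \<le> M * (cmod damping * cmod u)"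
    proof -
      have "Re (z * cnj (damping * u)) \<le> cmod z * (cmod damping * cmod u)"
        using complex_Re_le_cmod[of "z * cnj (damping * u)"] by (simp add: norm_mult)
      also have "\<dots> \<le> M * (cmod damping * cmod u)" using z by (intro mult_right_mono) auto
      finally show ?thesis .
    qed
    ultimately have lb: "Re (q * cnj (damping * u)) \<ge> cmod u * (\<kappa> * cmod u - cmod damping * M)"
      by (simp add: power2_eq_square algebra_simps)
    show ?thesis
    proof (cases "cmod u \<ge> M1")
      case True
      then have "\<kappa> * cmod u - cmod damping * M \<ge> 0" using \<kappa> by (simp add: M1_def field_simps)
      then have "Re (q * cnj (damping * u)) \<ge> 0" using lb by (meson mult_nonneg_nonneg norm_ge_zero order_trans)
      then have "- (m * Re (q * cnj (damping * u))) \<le> 0" using m0 by simp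
      also have "0 \<le> M1 powr p * M1 * (cmod damping * M)" using M0 M10 by simp
      finally show ?thesis .
    next
      case False
      \<comment> \<open>Below the threshold \<open>M1\<close> the favourable term is simply dropped,
        since |u| itself is bounded there.\<close>
      have "- (m * Re (q * cnj (damping * u))) \<le> m * (cmod u * (cmod damping * M))"
      proof -
        have "- Re (q * cnj (damping * u)) \<le> cmod u * (cmod damping * M)"
        proof -
          have "0 \<le> cmod u * (\<kappa> * cmod u)" using \<kappa> by simp
          then show ?thesis using lb by (simp add: right_diff_distrib)
        qed
        from mult_left_mono[OF this m0] show ?thesis by (simp only: mult_minus_right)
      qed
      also have "\<dots> \<le> M1 powr p * (M1 * (cmod damping * M))"
      proof (rule mult_mono)
        show "m \<le> M1 powr p" unfolding m_def using False p r by (intro powr_mono2) auto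
      qed (use False M0 in \<open>auto intro!: mult_right_mono\<close>)
      finally show ?thesis by simp
    qed
  qed
  ultimately show ?thesis by (simp add: u_def M1_def)
qed

text \<open>As p <= 2, the weight is at most 1 + |u|^2 at every truncation level, so the forcing is
  at most cubic with constants free of \<open>r\<close>.\<close>

lemma G_growth:
  assumes r: "r > 0"
  shows "(cmod (G r u))\<^sup>2 \<le> (\<gamma> + cmod damping)\<^sup>2 * (2 + 4 * (cmod u) ^ 6)"
proof -
  define y where "y = cmod u"
  have y0: "y \<ge> 0" by (simp add: y_def)
  have "min y r powr p \<le> 1 + y\<^sup>2"
  proof (cases "y \<le> 1")
    case True
    have "min y r powr p \<le> 1 powr p" using True r p y0 by (intro powr_mono2) auto
    then show ?thesis by (simp add: add_increasing2)
  next
    case False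
    have "min y r powr p \<le> y powr p" using r p y0 by (intro powr_mono2) auto
    also have "\<dots> \<le> y powr 2" using False p by (intro powr_mono) auto
    also have "\<dots> = y\<^sup>2" using False by (simp add: powr_numeral)
    finally show ?thesis by simp
  qed
  then have nlb: "cmod (trunc_power r u) \<le> (1 + y\<^sup>2) * y" unfolding trunc_power_norm y_def[symmetric] using y0 by (rule mult_right_mono)
  have "cmod (G r u) \<le> cmod (of_real \<gamma> * u) + cmod (damping * trunc_power r u)" unfolding G_def by (rule norm_triangle_ineq4)
  also have "\<dots> \<le> \<gamma> * y + cmod damping * ((1 + y\<^sup>2) * y)"
    unfolding norm_mult using \<gamma> nlb by (intro add_mono mult_left_mono) (auto simp: y_def)
  also have "\<dots> \<le> \<gamma> * ((1 + y\<^sup>2) * y) + cmod damping * ((1 + y\<^sup>2) * y)"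
    using \<gamma> y0 by (intro add_mono mult_left_mono) (auto simp: algebra_simps)
  also have "\<dots> = (\<gamma> + cmod damping) * ((1 + y\<^sup>2) * y)" by (simp add: algebra_simps)
  finally have "(cmod (G r u))\<^sup>2 \<le> ((\<gamma> + cmod damping) * ((1 + y\<^sup>2) * y))\<^sup>2" by (rule power_mono) simp
  also have "\<dots> = (\<gamma> + cmod damping)\<^sup>2 * ((1 + y\<^sup>2) * y)\<^sup>2" by (simp add: power_mult_distrib)
  also have "\<dots> \<le> (\<gamma> + cmod damping)\<^sup>2 * (2 + 4 * y ^ 6)"
  proof (rule mult_left_mono)
    define q where "q = y\<^sup>2"
    have q0: "q \<ge> 0" by (simp add: q_def)
    have "((1 + y\<^sup>2) * y)\<^sup>2 = (1 + q)\<^sup>2 * q" by (simp add: q_def power_mult_distrib)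
    also have "\<dots> \<le> 2 + 4 * q ^ 3"
    proof -
      have "0 \<le> (q - 1)\<^sup>2 * (q + 1)" "0 \<le> q * (q - 1)\<^sup>2" using q0 by auto
      then have "q + q * q \<le> 1 + q * (q * q)" "2 * (q * q) \<le> q + q * (q * q)"
        by (simp_all add: power2_eq_square algebra_simps)
      moreover have "0 \<le> q * (q * q)" using q0 by simp
      ultimately have "q + 2 * (q * q) \<le> 2 + 3 * (q * (q * q))" by linarith
      then show ?thesis by (simp add: power2_eq_square power3_eq_cube algebra_simps)
    qed
    also have "q ^ 3 = y ^ 6" by (simp add: q_def flip: power_mult)
    finally show "((1 + y\<^sup>2) * y)\<^sup>2 \<le> 2 + 4 * y ^ 6" .
  qed simp
  finally show ?thesis by (simp add: y_def)
qed

end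

context cgl_data
begin

section \<open>Picard iteration\<close>

text \<open>Its fixed points are the solutions of the truncated problem in Duhamel form.\<close>

definition Phi :: "real \<Rightarrow> (real \<Rightarrow> real \<Rightarrow> complex) \<Rightarrow> real \<Rightarrow> real \<Rightarrow> complex" where
  "Phi r u t x = zeta t x + sin_series (\<lambda>n. duhamel_mode (\<lambda>s y. G r (u s y)) n t) x"

lemma cont_rect_G: "r > 0 \<Longrightarrow> cont_rect u \<Longrightarrow> cont_rect (\<lambda>s y. G r (u s y))"
  by (rule cont_rect_compose[OF _ G_continuous])

lemma cont_rect_sin_series_duhamel_mode: "cont_rect f \<Longrightarrow> cont_rect (\<lambda>t x. sin_series (\<lambda>n. duhamel_mode f n t) x)"
  unfolding cont_rect_def by (rule traj_continuous[OF duhamel_mode_traj]) (simp add: cont_rect_def)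

lemma Phi_cont_rect: "r > 0 \<Longrightarrow> cont_rect u \<Longrightarrow> cont_rect (Phi r u)"
  unfolding Phi_def[abs_def] by (intro cont_rect_add zeta_cont_rect cont_rect_sin_series_duhamel_mode cont_rect_G)

text \<open>The product of the constants of \<open>sin_series_sup_energy\<close>,
  \<open>duhamel_mode_energy_le\<close> and the squared Lipschitz constant of
  \<open>G\<close>.\<close>

definition Phi_lip :: "real \<Rightarrow> real" where "Phi_lip r = L * (G_lip r)\<^sup>2 / (freq 0 * \<nu>)"

lemma Phi_lip_nonneg: "Phi_lip r \<ge> 0" using L_pos freq_pos[of 0] \<nu> by (simp add: Phi_lip_def)

text \<open>Parabolic smoothing followed by the sup bound through the energy. The estimate is by a
  time integral, not by a supremum, which is what makes the iteration converge without a small time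
  step.\<close>

lemma Phi_diff:
  assumes r: "r > 0" and u: "cont_rect u" and v: "cont_rect v" and t: "t \<in> {0..1}" and x: "x \<in> {0..L}"
    and \<phi>: "continuous_on {0..t} \<phi>"
    and d: "\<And>s y. s \<in> {0..t} \<Longrightarrow> y \<in> {0..L} \<Longrightarrow> (cmod (u s y - v s y))\<^sup>2 \<le> \<phi> s"
  shows "(cmod (Phi r u t x - Phi r v t x))\<^sup>2 \<le> Phi_lip r * integral {0..t} \<phi>"
proof -
  define f where "f s y = G r (u s y) - G r (v s y)" for s y
  note gu = cont_rect_G[OF r u] and gv = cont_rect_G[OF r v]
  have f: "cont_rect f" unfolding f_def[abs_def] by (intro cont_rect_diff gu gv)
  have "Phi r u t x - Phi r v t x = sin_series (\<lambda>n. duhamel_mode (\<lambda>s y. G r (u s y)) n t - duhamel_mode (\<lambda>s y. G r (v s y)) n t) x"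
    unfolding Phi_def by (simp add: sin_series_diff[OF traj_finite_energy[OF duhamel_mode_traj[OF gu] t] traj_finite_energy[OF duhamel_mode_traj[OF gv] t]])
  also have "\<dots> = sin_series (\<lambda>n. duhamel_mode f n t) x"
    by (simp add: duhamel_mode_diff[OF gu gv t] f_def[abs_def])
  finally have "(cmod (Phi r u t x - Phi r v t x))\<^sup>2 \<le> L / freq 0 * energy (\<lambda>n. duhamel_mode f n t)"
    using sin_series_sup_energy[OF traj_finite_energy[OF duhamel_mode_traj[OF f] t] x] by simp
  also have "\<dots> \<le> L / freq 0 * (integral {0..t} (\<lambda>s. integral {0..L} (\<lambda>y. (cmod (f s y))\<^sup>2)) / (\<nu> * L))"
    using L_pos freq_pos[of 0] by (intro mult_left_mono duhamel_mode_energy_le f t) (auto simp: less_imp_le)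
  also have "integral {0..t} (\<lambda>s. integral {0..L} (\<lambda>y. (cmod (f s y))\<^sup>2)) \<le> integral {0..t} (\<lambda>s. L * (G_lip r)\<^sup>2 * \<phi> s)"
  proof (rule integral_le)
    have jf: "cont_rect (\<lambda>s y. (cmod (f s y))\<^sup>2)" by (intro cont_rect_power cont_rect_norm f)
    show "(\<lambda>s. integral {0..L} (\<lambda>y. (cmod (f s y))\<^sup>2)) integrable_on {0..t}"
      by (intro integrable_continuous_real continuous_on_subset[OF cont_rect_integral_space[OF jf]]) (use t in auto)
    show "(\<lambda>s. L * (G_lip r)\<^sup>2 * \<phi> s) integrable_on {0..t}" by (intro integrable_continuous_real continuous_intros \<phi>)
    fix s assume s: "s \<in> {0..t}"
    have s1: "s \<in> {0..1}" using s t by auto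
    have "integral {0..L} (\<lambda>y. (cmod (f s y))\<^sup>2) \<le> integral {0..L} (\<lambda>y. (G_lip r)\<^sup>2 * \<phi> s)"
    proof (rule integral_le)
      show "(\<lambda>y. (cmod (f s y))\<^sup>2) integrable_on {0..L}" by (intro integrable_continuous_real cont_rect_slice(1)[OF jf s1])
      show "(\<lambda>y. (G_lip r)\<^sup>2 * \<phi> s) integrable_on {0..L}" by (intro integrable_continuous_real continuous_on_const)
      fix y assume y: "y \<in> {0..L}"
      have "(cmod (f s y))\<^sup>2 \<le> (G_lip r * cmod (u s y - v s y))\<^sup>2"
        unfolding f_def by (intro power_mono G_lipschitz r) auto
      also have "\<dots> \<le> (G_lip r)\<^sup>2 * \<phi> s" unfolding power_mult_distrib by (intro mult_left_mono d s y) simp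
      finally show "(cmod (f s y))\<^sup>2 \<le> (G_lip r)\<^sup>2 * \<phi> s" .
    qed
    then show "integral {0..L} (\<lambda>y. (cmod (f s y))\<^sup>2) \<le> L * (G_lip r)\<^sup>2 * \<phi> s" using L_pos by (simp add: mult_ac)
  qed
  finally have "(cmod (Phi r u t x - Phi r v t x))\<^sup>2 \<le> L / freq 0 * (integral {0..t} (\<lambda>s. L * (G_lip r)\<^sup>2 * \<phi> s) / (\<nu> * L))"
    using L_pos freq_pos[of 0] \<nu> by (simp add: mult_left_mono divide_right_mono)
  also have "\<dots> = Phi_lip r * integral {0..t} \<phi>"
    using L_pos freq_pos[of 0] \<nu> unfolding Phi_lip_def integral_mult_right by (simp add: field_simps)
  finally show ?thesis .
qed

text \<open>In the weight exp (2 C t) each iteration halves the squared distance: the integral of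
  the weight is at most the weight divided by 2 C, and \<open>Phi_lip r\<close> is at most
  C.\<close>

lemma picard:
  assumes r: "r > 0"
  obtains u where "cont_rect u" "\<And>t x. t \<in> {0..1} \<Longrightarrow> x \<in> {0..L} \<Longrightarrow> u t x = Phi r u t x"
proof -
  define U where "U k = ((Phi r) ^^ k) zeta" for k
  have US: "U (Suc k) = Phi r (U k)" for k by (simp add: U_def)
  have Uj: "cont_rect (U k)" for k by (induction k) (auto simp: US Phi_cont_rect[OF r], simp add: U_def zeta_cont_rect)
  obtain B where B: "\<And>t x. t \<in> {0..1} \<Longrightarrow> x \<in> {0..L} \<Longrightarrow> cmod (U 1 t x - U 0 t x) \<le> B"
    using cont_rect_bounded[OF cont_rect_diff[OF Uj Uj]] by blast
  \<comment> \<open>The summand 1 makes C positive, so that it can be divided by.\<close>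
  define C where "C = Phi_lip r + 1"
  have C: "C > 0" "Phi_lip r \<le> C" using Phi_lip_nonneg[of r] by (auto simp: C_def)
  have bd: "(cmod (U (Suc k) t x - U k t x))\<^sup>2 \<le> B\<^sup>2 * exp (2 * C * t) / 2 ^ k" if "t \<in> {0..1}" "x \<in> {0..L}" for k t x
    using that
  proof (induction k arbitrary: t x)
    case 0
    have "(cmod (U 1 t x - U 0 t x))\<^sup>2 \<le> B\<^sup>2" using B[OF 0] by (intro power_mono) auto
    also have "\<dots> \<le> B\<^sup>2 * exp (2 * C * t)" using C 0 by (simp add: mult_le_cancel_left1)
    finally show ?case by simp
  next
    case (Suc k)
    have t0: "0 \<le> t" using Suc.prems by simp
    have "(cmod (Phi r (U (Suc k)) t x - Phi r (U k) t x))\<^sup>2 \<le> Phi_lip r * integral {0..t} (\<lambda>s. B\<^sup>2 * exp (2 * C * s) / 2 ^ k)"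
      by (rule Phi_diff[OF r Uj Uj Suc.prems]) (use Suc.prems Suc.IH in \<open>auto intro!: continuous_intros\<close>)
    also have "integral {0..t} (\<lambda>s. B\<^sup>2 * exp (2 * C * s) / 2 ^ k) = B\<^sup>2 * exp (2 * C * t) / (2 ^ k * (2 * C)) - B\<^sup>2 * exp (2 * C * 0) / (2 ^ k * (2 * C))"
    proof (rule integral_unique, rule fundamental_theorem_of_calculus[OF t0])
      show "((\<lambda>s. B\<^sup>2 * exp (2 * C * s) / (2 ^ k * (2 * C))) has_vector_derivative B\<^sup>2 * exp (2 * C * s) / 2 ^ k) (at s within {0..t})" for s
        unfolding has_real_derivative_iff_has_vector_derivative[symmetric]
        by (rule derivative_eq_intros refl | use C in simp)+
    qed
    also have "Phi_lip r * (B\<^sup>2 * exp (2 * C * t) / (2 ^ k * (2 * C)) - B\<^sup>2 * exp (2 * C * 0) / (2 ^ k * (2 * C)))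
        \<le> C * (B\<^sup>2 * exp (2 * C * t) / (2 ^ k * (2 * C)))"
    proof (rule mult_mono)
      show "0 \<le> B\<^sup>2 * exp (2 * C * t) / (2 ^ k * (2 * C)) - B\<^sup>2 * exp (2 * C * 0) / (2 ^ k * (2 * C))"
        using divide_right_mono[OF mult_left_mono[of 1 "exp (2 * C * t)" "B\<^sup>2"], of "2 ^ k * (2 * C)"] C t0 by simp
    qed (use C in auto)
    also have "\<dots> = B\<^sup>2 * exp (2 * C * t) / 2 ^ Suc k" using C by simp
    finally show ?case by (simp add: US)
  qed
  define f where "f k z = U (Suc k) (fst z) (snd z) - U k (fst z) (snd z)" for k z
  define Q where "Q = {0..1::real} \<times> {0..L}"
  have fb: "norm (f k z) \<le> sqrt (B\<^sup>2 * exp (2 * C)) * (sqrt (1/2)) ^ k" if "z \<in> Q" for k z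
  proof -
    have "(cmod (f k z))\<^sup>2 \<le> B\<^sup>2 * exp (2 * C * fst z) / 2 ^ k" unfolding f_def using that by (intro bd) (auto simp: Q_def)
    also have "\<dots> \<le> B\<^sup>2 * exp (2 * C) / 2 ^ k" using that C by (intro divide_right_mono mult_left_mono) (auto simp: Q_def mult_left_le)
    finally have "cmod (f k z) \<le> sqrt (B\<^sup>2 * exp (2 * C) / 2 ^ k)" by (rule real_le_rsqrt)
    also have "\<dots> = sqrt (B\<^sup>2 * exp (2 * C)) * (sqrt (1/2)) ^ k"
      by (simp add: real_sqrt_divide real_sqrt_power power_divide)
    finally show ?thesis by simp
  qed
  have "sqrt (1/2) < sqrt (1::real)" by (simp only: real_sqrt_less_iff)
  then have "summable (\<lambda>k. sqrt (B\<^sup>2 * exp (2 * C)) * (sqrt (1/2)) ^ k)"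
    by (intro summable_mult summable_geometric) simp
  from Weierstrass_m_test[OF fb this]
  have ul: "uniform_limit Q (\<lambda>N z. \<Sum>k<N. f k z) (\<lambda>z. \<Sum>k. f k z) sequentially" .
  have tel: "(\<Sum>k<N. f k z) = U N (fst z) (snd z) - U 0 (fst z) (snd z)" for N z
    unfolding f_def by (rule sum_lessThan_telescope)
  define u where "u t x = U 0 t x + (\<Sum>k. f k (t, x))" for t x
  have close: "\<forall>\<^sub>F N in sequentially. \<forall>z\<in>Q. cmod (U N (fst z) (snd z) - u (fst z) (snd z)) < e" if "e > 0" for e
    using uniform_limitD[OF ul that] by (simp add: tel u_def dist_norm algebra_simps)
  have "uniform_limit Q (\<lambda>N z. U N (fst z) (snd z)) (\<lambda>z. u (fst z) (snd z)) sequentially"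
    using close by (intro uniform_limitI) (simp add: dist_norm)
  then have "continuous_on Q (\<lambda>z. u (fst z) (snd z))"
    by (rule uniform_limit_theorem[OF always_eventually, rotated])
      (use Uj in \<open>auto simp: cont_rect_def Q_def case_prod_beta'\<close>)
  then have uj: "cont_rect u" by (simp add: cont_rect_def Q_def case_prod_beta')
  have "u t x = Phi r u t x" if t: "t \<in> {0..1}" and x: "x \<in> {0..L}" for t x
  proof -
    have l1: "(\<lambda>N. U (Suc N) t x) \<longlonglongrightarrow> u t x"
    proof (rule LIMSEQ_Suc, rule tendstoI)
      fix e :: real assume "e > 0"
      from close[OF this] show "\<forall>\<^sub>F N in sequentially. dist (U N t x) (u t x) < e"
        by (rule eventually_mono) (use t x in \<open>force simp: Q_def dist_norm\<close>)
    qed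
    have l2: "(\<lambda>N. Phi r (U N) t x) \<longlonglongrightarrow> Phi r u t x"
    proof (rule tendstoI)
      fix e :: real assume e: "e > 0"
      \<comment> \<open>Chosen so that C d'^2 = (e/2)^2.\<close>
      define d' where "d' = e / (sqrt C * 2)"
      have d: "d' > 0" using e C by (simp add: d'_def)
      from close[OF d] show "\<forall>\<^sub>F N in sequentially. dist (Phi r (U N) t x) (Phi r u t x) < e"
      proof eventually_elim
        case (elim N)
        have "(cmod (Phi r (U N) t x - Phi r u t x))\<^sup>2 \<le> Phi_lip r * integral {0..t} (\<lambda>s. d'\<^sup>2)"
        proof (rule Phi_diff[OF r Uj uj t x])
          fix s y assume "s \<in> {0..t}" "y \<in> {0..L}"
          then have "(s, y) \<in> Q" using t by (auto simp: Q_def)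
          then have "cmod (U N s y - u s y) < d'" using elim by force
          then show "(cmod (U N s y - u s y))\<^sup>2 \<le> d'\<^sup>2" by (intro power_mono) auto
        qed auto
        also have "\<dots> = Phi_lip r * (t * d'\<^sup>2)" using t by simp
        also have "\<dots> \<le> C * (1 * d'\<^sup>2)" using C t Phi_lip_nonneg[of r] by (intro mult_mono) auto
        also have "\<dots> = (e / 2)\<^sup>2" using C by (simp add: d'_def power_divide power_mult_distrib)
        finally have "cmod (Phi r (U N) t x - Phi r u t x) \<le> e / 2" by (rule power2_le_imp_le) (use e in simp)
        then show ?case using e by (simp add: dist_norm)
      qed
    qed
    show ?thesis using LIMSEQ_unique[OF l1] l2 by (simp add: US)
  qed
  then show thesis using that uj by blast
qed

end

section \<open>A priori bound\<close>

lemma gronwall: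
  fixes y :: "real \<Rightarrow> real"
  assumes y: "continuous_on {0..T} y" and K: "K \<ge> 0" and t: "t \<in> {0..T}"
    and le: "\<And>t. t \<in> {0..T} \<Longrightarrow> y t \<le> A + K * integral {0..t} y"
  shows "y t \<le> A * exp (K * t)"
proof -
  define w where "w t = exp (- K * t) * (A + K * integral {0..t} y)" for t
  have "((\<lambda>s. exp (- K * s) * K * (y s - (A + K * integral {0..s} y))) has_integral w t - w 0) {0..t}"
  proof (rule fundamental_theorem_of_calculus)
    fix s assume s: "s \<in> {0..t}"
    have "continuous_on {0..t} y" by (rule continuous_on_subset[OF y]) (use t in auto)
    note I = integral_has_real_derivative[OF this s]
    have "(w has_real_derivative (- K * exp (- K * s)) * (A + K * integral {0..s} y) + (K * y s) * exp (- K * s)) (at s within {0..t})"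
      unfolding w_def by (rule derivative_eq_intros I refl | simp)+
    then have "(w has_real_derivative exp (- K * s) * K * (y s - (A + K * integral {0..s} y))) (at s within {0..t})"
      by (simp add: algebra_simps)
    then show "(w has_vector_derivative exp (- K * s) * K * (y s - (A + K * integral {0..s} y))) (at s within {0..t})"
      by (simp add: has_real_derivative_iff_has_vector_derivative)
  qed (use t in simp)
  then have "w t - w 0 \<le> 0"
  proof (rule has_integral_le[OF _ has_integral_0])
    fix s assume "s \<in> {0..t}"
    then have "y s - (A + K * integral {0..s} y) \<le> 0" using le[of s] t by simp
    then show "exp (- K * s) * K * (y s - (A + K * integral {0..s} y)) \<le> 0"
      using K by (intro mult_nonneg_nonpos) auto
  qed
  then have "exp (- K * t) * (A + K * integral {0..t} y) \<le> A" by (simp add: w_def)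
  then have "exp (K * t) * (exp (- K * t) * (A + K * integral {0..t} y)) \<le> exp (K * t) * A" by (rule mult_left_mono) simp
  moreover have "exp (K * t) * exp (- K * t) = 1" by (simp add: exp_minus)
  ultimately have "A + K * integral {0..t} y \<le> A * exp (K * t)" by (metis mult.assoc mult.commute mult_1)
  then show ?thesis using le[OF t] by simp
qed

context cgl
begin

text \<open>Sum \<open>duhamel_energy\<close> over the modes. It is stated for the partial sums of
  the combined terms: their nonnegativity later bounds the mass and the dissipation
  separately.\<close>

lemma duhamel_mode_energy_identity:
  assumes f: "cont_rect f" and t: "t \<in> {0..1}"
  shows "(\<lambda>N. L / 2 * (\<Sum>n<N. (cmod (duhamel_mode f n t))\<^sup>2 + 2 * \<nu> * (mu n * integral {0..t} (\<lambda>s. (cmod (duhamel_mode f n s))\<^sup>2))))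
     \<longlonglongrightarrow> 2 * integral {0..t} (\<lambda>s. integral {0..L} (\<lambda>x. Re (sin_series (\<lambda>n. duhamel_mode f n s) x * cnj (f s x))))"
proof -
  define c where "c = duhamel_mode f"
  have c: "traj 1 c" unfolding c_def by (rule duhamel_mode_traj[OF f])
  then obtain m where m: "summable m" "\<And>n t. t \<in> {0..1} \<Longrightarrow> mu n * (cmod (c n t))\<^sup>2 \<le> m n" and
    damping: "\<And>n. continuous_on {0..1} (c n)"
    by (auto simp: traj_def)
  have ct: "continuous_on {0..t} (c n)" for n by (rule continuous_on_subset[OF damping]) (use t in auto)
  have ft: "continuous_on {0..t} (\<lambda>s. coef (f s) n)" for n
    by (rule continuous_on_subset[OF cont_rect_coef[OF f]]) (use t in auto)
  obtain B where B: "\<And>s x. s \<in> {0..1} \<Longrightarrow> x \<in> {0..L} \<Longrightarrow> cmod (f s x) \<le> B"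
    using cont_rect_bounded[OF f] by blast
  have B0: "B \<ge> 0" using order_trans[OF norm_ge_zero B[of 0 0]] L_pos by simp
  have cb: "cmod (coef (f s) n) \<le> 2 * B" if s: "s \<in> {0..1}" for s n
  proof -
    note fs = cont_rect_slice(1)[OF f s]
    have "L / 2 * (cmod (coef (f s) n))\<^sup>2 \<le> integral {0..L} (\<lambda>x. (cmod (f s x))\<^sup>2)"
      using coef_bessel[OF fs, of "{n}"] by simp
    also have "\<dots> \<le> integral {0..L} (\<lambda>x. B\<^sup>2)"
      using B[OF s] by (intro integral_le integrable_continuous_real continuous_intros fs power_mono) auto
    also have "\<dots> = L * B\<^sup>2" using L_pos by simp
    finally have "(cmod (coef (f s) n))\<^sup>2 \<le> 2 * B\<^sup>2" using L_pos by (simp add: field_simps)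
    also have "\<dots> \<le> (2 * B)\<^sup>2" by (simp add: power2_eq_square)
    finally show ?thesis by (rule power2_le_imp_le) (use B0 in simp)
  qed
  \<comment> \<open>The coefficients of q have a summable majorant by \<open>mode_le\<close>, those
    of \<open>f\<close> are bounded by 2 B, so the series may be integrated in time term by
    term.\<close>
  have ul: "uniform_limit {0..t} (\<lambda>N s. \<Sum>n<N. Re (c n s * cnj (coef (f s) n))) (\<lambda>s. \<Sum>n. Re (c n s * cnj (coef (f s) n))) sequentially"
  proof (rule Weierstrass_m_test)
    show "summable (\<lambda>n. (1 / mu n + m n) / 2 * (2 * B))" by (intro summable_mult2 summable_mode_bound m)
    fix n s assume "s \<in> {0..t}"
    then have s: "s \<in> {0..1}" using t by auto
    have "norm (Re (c n s * cnj (coef (f s) n))) \<le> cmod (c n s) * cmod (coef (f s) n)"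
      using abs_Re_le_cmod[of "c n s * cnj (coef (f s) n)"] by (simp add: norm_mult)
    also have "\<dots> \<le> (1 / mu n + m n) / 2 * (2 * B)"
    proof -
      have le: "cmod (c n s) \<le> (1 / mu n + m n) / 2"
        using mode_le[of "cmod (c n s)" n] m(2)[OF s, of n] by simp
      show ?thesis by (intro mult_mono le cb s order_trans[OF norm_ge_zero le]) simp
    qed
    finally show "norm (Re (c n s * cnj (coef (f s) n))) \<le> (1 / mu n + m n) / 2 * (2 * B)" .
  qed
  have pair: "L / 2 * (\<Sum>n. Re (c n s * cnj (coef (f s) n))) = integral {0..L} (\<lambda>x. Re (sin_series (\<lambda>n. c n s) x * cnj (f s x)))"
    if "s \<in> {0..t}" for s
  proof -
    have s: "s \<in> {0..1}" using that t by auto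
    note fs = cont_rect_slice(1)[OF f s] and fe = traj_finite_energy[OF c s]
    have i: "integral {0..L} (\<lambda>x. sin (freq n * x) *\<^sub>R cnj (f s x)) = of_real (L / 2) * cnj (coef (f s) n)" for n
    proof -
      have "integral {0..L} (\<lambda>x. cnj (sin (freq n * x) *\<^sub>R f s x)) = cnj (integral {0..L} (\<lambda>x. sin (freq n * x) *\<^sub>R f s x))"
        using integral_linear[OF integrable_continuous_real bounded_linear_cnj, of 0 L "\<lambda>x. sin (freq n * x) *\<^sub>R f s x"]
        by (simp add: o_def continuous_intros fs)
      then show ?thesis using L_pos by (simp add: coef_def scaleR_conv_of_real)
    qed
    have "(\<lambda>n. c n s * (of_real (L / 2) * cnj (coef (f s) n))) sums integral {0..L} (\<lambda>x. sin_series (\<lambda>n. c n s) x * cnj (f s x))"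
      using sin_series_pairing[OF fe, of "\<lambda>x. cnj (f s x)"] fs unfolding i by (auto intro: continuous_intros)
    from sums_Re[OF this]
    have "(\<lambda>n. Re (c n s * (of_real (L / 2) * cnj (coef (f s) n)))) sums Re (integral {0..L} (\<lambda>x. sin_series (\<lambda>n. c n s) x * cnj (f s x)))" .
    moreover have "Re (c n s * (of_real (L / 2) * cnj (coef (f s) n))) = L / 2 * Re (c n s * cnj (coef (f s) n))" for n
      by (simp add: algebra_simps)
    ultimately have S: "(\<lambda>n. L / 2 * Re (c n s * cnj (coef (f s) n))) sums Re (integral {0..L} (\<lambda>x. sin_series (\<lambda>n. c n s) x * cnj (f s x)))"
      by (simp only:)
    then have "summable (\<lambda>n. L / 2 * Re (c n s * cnj (coef (f s) n)))" by (rule sums_summable)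
    then have "summable (\<lambda>n. Re (c n s * cnj (coef (f s) n)))" using L_pos by (simp add: summable_cmult_iff)
    then have "L / 2 * (\<Sum>n. Re (c n s * cnj (coef (f s) n))) = Re (integral {0..L} (\<lambda>x. sin_series (\<lambda>n. c n s) x * cnj (f s x)))"
      using sums_unique[OF S] suminf_mult by metis
    also have "\<dots> = integral {0..L} (\<lambda>x. Re (sin_series (\<lambda>n. c n s) x * cnj (f s x)))"
      using integral_linear[OF integrable_continuous_real bounded_linear_Re, of 0 L "\<lambda>x. sin_series (\<lambda>n. c n s) x * cnj (f s x)"]
      by (simp add: o_def continuous_intros fs sin_series_continuous_on[OF fe])
    finally show ?thesis .
  qed
  obtain I J where IJ: "\<And>N. ((\<lambda>s. \<Sum>n<N. Re (c n s * cnj (coef (f s) n))) has_integral I N) {0..t}"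
    "((\<lambda>s. \<Sum>n. Re (c n s * cnj (coef (f s) n))) has_integral J) {0..t}" "(I \<longlongrightarrow> J) sequentially"
    by (rule uniform_limit_integral[OF ul]) (auto intro!: continuous_intros ct ft simp del: complex_cnj times_complex.simps)
  have lhs: "L / 2 * (\<Sum>n<N. (cmod (c n t))\<^sup>2 + 2 * \<nu> * (mu n * integral {0..t} (\<lambda>s. (cmod (c n s))\<^sup>2))) = L * I N" for N
  proof -
    have "(cmod (c n t))\<^sup>2 + 2 * \<nu> * (mu n * integral {0..t} (\<lambda>s. (cmod (c n s))\<^sup>2)) = 2 * integral {0..t} (\<lambda>s. Re (c n s * cnj (coef (f s) n)))" for n
      using duhamel_energy[OF cont_rect_coef[OF f] t, of "rate n" n] unfolding c_def duhamel_mode_def Re_rate by (simp only: mult.assoc)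
    then have "(\<Sum>n<N. (cmod (c n t))\<^sup>2 + 2 * \<nu> * (mu n * integral {0..t} (\<lambda>s. (cmod (c n s))\<^sup>2)))
       = 2 * (\<Sum>n<N. integral {0..t} (\<lambda>s. Re (c n s * cnj (coef (f s) n))))" by (simp add: sum_distrib_left)
    also have "(\<Sum>n<N. integral {0..t} (\<lambda>s. Re (c n s * cnj (coef (f s) n)))) = integral {0..t} (\<lambda>s. \<Sum>n<N. Re (c n s * cnj (coef (f s) n)))"
      by (intro Henstock_Kurzweil_Integration.integral_sum[symmetric] integrable_continuous_real continuous_intros ct ft) simp
    also have "\<dots> = I N" by (rule integral_unique[OF IJ(1)])
    finally show ?thesis by simp
  qed
  have "2 * integral {0..t} (\<lambda>s. integral {0..L} (\<lambda>x. Re (sin_series (\<lambda>n. c n s) x * cnj (f s x)))) =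
     2 * integral {0..t} (\<lambda>s. L / 2 * (\<Sum>n. Re (c n s * cnj (coef (f s) n))))"
    using pair by (intro arg_cong[where f="\<lambda>z. 2 * z"] Henstock_Kurzweil_Integration.integral_cong) simp
  also have "\<dots> = L * J" by (simp only: integral_mult_right integral_unique[OF IJ(2)])
  finally have rhs: "2 * integral {0..t} (\<lambda>s. integral {0..L} (\<lambda>x. Re (sin_series (\<lambda>n. c n s) x * cnj (f s x)))) = L * J" .
  have "(\<lambda>N. L * I N) \<longlonglongrightarrow> L * J" by (intro tendsto_intros IJ(3))
  then show ?thesis unfolding c_def[symmetric] lhs rhs .
qed

lemma integral_energy_le:
  assumes c: "traj 1 c" and le: "\<And>N. (\<Sum>n<N. mu n * integral {0..1} (\<lambda>s. (cmod (c n s))\<^sup>2)) \<le> Z"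
  shows "integral {0..1} (\<lambda>s. energy (\<lambda>n. c n s)) \<le> Z"
proof -
  obtain m where m: "summable m" "\<And>n t. t \<in> {0..1} \<Longrightarrow> mu n * (cmod (c n t))\<^sup>2 \<le> m n" and
    damping: "\<And>n. continuous_on {0..1} (c n)"
    using c by (auto simp: traj_def)
  have ul: "uniform_limit {0..1} (\<lambda>N t. \<Sum>n<N. mu n * (cmod (c n t))\<^sup>2) (\<lambda>t. \<Sum>n. mu n * (cmod (c n t))\<^sup>2) sequentially"
    by (rule Weierstrass_m_test[OF _ m(1)]) (use m(2) mu_pos in \<open>auto simp: less_imp_le\<close>)
  obtain I J where IJ: "\<And>N. ((\<lambda>t. \<Sum>n<N. mu n * (cmod (c n t))\<^sup>2) has_integral I N) {0..1}"
    "((\<lambda>t. \<Sum>n. mu n * (cmod (c n t))\<^sup>2) has_integral J) {0..1}" "(I \<longlongrightarrow> J) sequentially"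
    by (rule uniform_limit_integral[OF ul]) (auto intro!: continuous_intros damping)
  have "I N = (\<Sum>n<N. mu n * integral {0..1} (\<lambda>s. (cmod (c n s))\<^sup>2))" for N
  proof -
    have "I N = integral {0..1} (\<lambda>t. \<Sum>n<N. mu n * (cmod (c n t))\<^sup>2)" by (rule integral_unique[OF IJ(1), symmetric])
    also have "\<dots> = (\<Sum>n<N. integral {0..1} (\<lambda>t. mu n * (cmod (c n t))\<^sup>2))"
      by (intro Henstock_Kurzweil_Integration.integral_sum integrable_continuous_real continuous_intros damping) simp
    finally show ?thesis by simp
  qed
  then have "J \<le> Z" using le by (intro LIMSEQ_le_const2[OF IJ(3)]) auto
  then show ?thesis using IJ(2) by (simp add: energy_def integral_unique)
qed

end

context cgl_data
begin

text \<open>The quantifier order is the point: \<open>Q\<close> is fixed before \<open>r\<close> and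
  \<open>u\<close>. Every constant comes from \<open>zeta\<close>, the parameters and the estimates
  of \<open>G\<close> that hold for all truncation levels.\<close>

lemma apriori:
  obtains Q where "\<And>r u t x. r > 0 \<Longrightarrow> cont_rect u \<Longrightarrow> (\<And>t x. t \<in> {0..1} \<Longrightarrow> x \<in> {0..L} \<Longrightarrow> u t x = Phi r u t x) \<Longrightarrow>
     t \<in> {0..1} \<Longrightarrow> x \<in> {0..L} \<Longrightarrow> cmod (u t x) \<le> Q"
proof -
  obtain M where M: "\<And>t x. t \<in> {0..1} \<Longrightarrow> x \<in> {0..L} \<Longrightarrow> cmod (zeta t x) \<le> M"
    using cont_rect_bounded[OF zeta_cont_rect] by blast
  have M0: "M \<ge> 0" using order_trans[OF norm_ge_zero M[of 0 0]] L_pos by simp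
  \<comment> \<open>\<open>C0\<close> is the constant of \<open>G_dissipative\<close>, and
    \<open>C1\<close> adds what Young's inequality leaves of the growth term. \<open>Y1\<close> will
    bound the squared L2 norm of q by Gronwall, \<open>Z\<close> the time integral of its energy,
    and \<open>E1\<close> its energy at each time.\<close>
  define C0 where "C0 = (cmod damping * M / \<kappa>) powr p * (cmod damping * M / \<kappa>) * (cmod damping * M)"
  have C00: "C0 \<ge> 0" using M0 \<kappa> by (simp add: C0_def)
  define C1 where "C1 = \<gamma> * M\<^sup>2 + C0"
  have C10: "C1 \<ge> 0" using C00 \<gamma> by (simp add: C1_def)
  define Y1 where "Y1 = 2 * L * C1 * exp (4 * \<gamma>)"
  have Y10: "Y1 \<ge> 0" using L_pos C10 by (simp add: Y1_def)
  define Z where "Z = (2 * (2 * \<gamma> * Y1 + L * C1)) / (L * \<nu>)"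
  define K1 where "K1 = (\<gamma> + cmod damping)\<^sup>2"
  have K10: "K1 \<ge> 0" by (simp add: K1_def)
  define E1 where "E1 = K1 * (L * (2 + 256 * M ^ 6) + 512 * L * Y1\<^sup>2 * Z) / (\<nu> * L)"
  define Q where "Q = M + sqrt (L / freq 0 * E1)"
  have main: "cmod (u t x) \<le> Q" if r: "r > 0" and u: "cont_rect u" 
    and fp: "\<And>t x. t \<in> {0..1} \<Longrightarrow> x \<in> {0..L} \<Longrightarrow> u t x = Phi r u t x"
    and tx: "t \<in> {0..1}" "x \<in> {0..L}" for r u t x
  proof -
    define f where "f s y = G r (u s y)" for s y
    have f: "cont_rect f" unfolding f_def[abs_def] by (rule cont_rect_G[OF r u])
    define c where "c = duhamel_mode f"
    have c: "traj 1 c" unfolding c_def by (rule duhamel_mode_traj[OF f])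
    define q where "q s y = sin_series (\<lambda>n. c n s) y" for s y
    have q: "cont_rect q" unfolding q_def[abs_def] c_def by (rule cont_rect_sin_series_duhamel_mode[OF f])
    have uq: "u s y = zeta s y + q s y" if "s \<in> {0..1}" "y \<in> {0..L}" for s y
      using fp[OF that] by (simp add: Phi_def q_def c_def f_def[abs_def])
    define Y where "Y s = integral {0..L} (\<lambda>y. (cmod (q s y))\<^sup>2)" for s
    have Yc: "continuous_on {0..1} Y" unfolding Y_def by (intro cont_rect_integral_space cont_rect_power cont_rect_norm q)
    have Y_sum: "Y s = L / 2 * (\<Sum>n. (cmod (c n s))\<^sup>2)" if "s \<in> {0..1}" for s
      unfolding Y_def q_def by (rule parseval_sin[OF traj_finite_energy[OF c that]])
    define P where "P s = integral {0..L} (\<lambda>y. Re (q s y * cnj (f s y)))" for s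
    have Pj: "cont_rect (\<lambda>s y. Re (q s y * cnj (f s y)))" by (intro cont_rect_Re cont_rect_mult cont_rect_cnj q f)
    have Pc: "continuous_on {0..1} P" unfolding P_def by (rule cont_rect_integral_space[OF Pj])
    have P_le: "P s \<le> 2 * \<gamma> * Y s + L * C1" if s: "s \<in> {0..1}" for s
    proof -
      note qs = cont_rect_slice(1)[OF q s]
      have "P s \<le> integral {0..L} (\<lambda>y. 2 * \<gamma> * (cmod (q s y))\<^sup>2 + C1)"
        unfolding P_def
      proof (rule integral_le)
        show "(\<lambda>y. Re (q s y * cnj (f s y))) integrable_on {0..L}"
          by (intro integrable_continuous_real cont_rect_slice(1)[OF Pj s])
        show "(\<lambda>y. 2 * \<gamma> * (cmod (q s y))\<^sup>2 + C1) integrable_on {0..L}"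
          by (intro integrable_continuous_real continuous_intros qs)
        fix y assume y: "y \<in> {0..L}"
        have "Re (q s y * cnj (f s y)) \<le> \<gamma> * ((cmod (q s y))\<^sup>2 + M * cmod (q s y)) + C0"
          unfolding f_def uq[OF s y] C0_def by (rule G_dissipative[OF r M[OF s y]])
        also have "\<gamma> * ((cmod (q s y))\<^sup>2 + M * cmod (q s y)) \<le> \<gamma> * (2 * (cmod (q s y))\<^sup>2 + M\<^sup>2)"
        proof (rule mult_left_mono[OF _ \<gamma>])
          have "0 \<le> (M - cmod (q s y))\<^sup>2" by simp
          then have "2 * (M * cmod (q s y)) \<le> (cmod (q s y))\<^sup>2 + M\<^sup>2" by (simp add: power2_diff)
          moreover have "0 \<le> M * cmod (q s y)" using M0 by simp
          ultimately show "(cmod (q s y))\<^sup>2 + M * cmod (q s y) \<le> 2 * (cmod (q s y))\<^sup>2 + M\<^sup>2" by linarith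
        qed
        finally show "Re (q s y * cnj (f s y)) \<le> 2 * \<gamma> * (cmod (q s y))\<^sup>2 + C1"
          by (simp add: C1_def distrib_left mult.commute mult.left_commute)
      qed
      also have "\<dots> = integral {0..L} (\<lambda>y. 2 * \<gamma> * (cmod (q s y))\<^sup>2) + integral {0..L} (\<lambda>y. C1)"
        by (intro integral_add_continuous continuous_intros qs)
      also have "\<dots> = 2 * \<gamma> * Y s + L * C1" using L_pos by (simp add: Y_def)
      finally show ?thesis .
    qed
    have partial: "L / 2 * (\<Sum>n<N. (cmod (c n s))\<^sup>2 + 2 * \<nu> * (mu n * integral {0..s} (\<lambda>s. (cmod (c n s))\<^sup>2)))
       \<le> 2 * integral {0..s} (\<lambda>s. 2 * \<gamma> * Y s + L * C1)" if s: "s \<in> {0..1}" for s N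
    proof -
      have sub: "{0..s} \<subseteq> {0..1}" using s by auto
      have cs: "continuous_on {0..s} (c n)" for n using c continuous_on_subset[OF _ sub] by (auto simp: traj_def)
      define g where "g n = (cmod (c n s))\<^sup>2 + 2 * \<nu> * (mu n * integral {0..s} (\<lambda>s. (cmod (c n s))\<^sup>2))" for n
      have g0: "g n \<ge> 0" for n
      proof -
        have "integral {0..s} (\<lambda>s. (cmod (c n s))\<^sup>2) \<ge> 0"
          by (intro Henstock_Kurzweil_Integration.integral_nonneg integrable_continuous_real continuous_intros cs) simp
        then show ?thesis using \<nu> mu_pos[of n] by (simp add: g_def)
      qed
      have lim: "(\<lambda>N. L / 2 * (\<Sum>n<N. g n)) \<longlonglongrightarrow> 2 * integral {0..s} P"
        using duhamel_mode_energy_identity[OF f s] by (simp add: g_def c_def q_def P_def[abs_def])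
      \<comment> \<open>All terms are nonnegative, so partial sums stay below the limit in the
        energy identity.\<close>
      have "L / 2 * (\<Sum>n<N. g n) \<le> 2 * integral {0..s} P"
      proof (rule LIMSEQ_le_const[OF lim], intro exI[of _ N] allI impI)
        fix N' assume "N \<le> N'"
        then have "(\<Sum>n<N. g n) \<le> (\<Sum>n<N'. g n)" by (intro sum_mono2) (auto simp: g0)
        then show "L / 2 * (\<Sum>n<N. g n) \<le> L / 2 * (\<Sum>n<N'. g n)" using L_pos by (intro mult_left_mono) auto
      qed
      also have "integral {0..s} P \<le> integral {0..s} (\<lambda>s. 2 * \<gamma> * Y s + L * C1)"
        using sub by (intro integral_le integrable_continuous_real continuous_intros continuous_on_subset[OF Pc sub] continuous_on_subset[OF Yc sub] P_le) auto
      finally show ?thesis by (simp add: g_def)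
    qed
    have YI: "integral {0..s} (\<lambda>s. 2 * \<gamma> * Y s + L * C1) = 2 * \<gamma> * integral {0..s} Y + L * C1 * s" if s: "s \<in> {0..1}" for s
    proof -
      have sub: "{0..s} \<subseteq> {0..1}" using s by auto
      have "integral {0..s} (\<lambda>s. 2 * \<gamma> * Y s + L * C1) = integral {0..s} (\<lambda>s. 2 * \<gamma> * Y s) + integral {0..s} (\<lambda>s. L * C1)"
        by (intro integral_add_continuous continuous_intros continuous_on_subset[OF Yc sub])
      then show ?thesis using s by simp
    qed
    have Y_le: "Y s \<le> 2 * L * C1 + 4 * \<gamma> * integral {0..s} Y" if s: "s \<in> {0..1}" for s
    proof -
      have sub: "{0..s} \<subseteq> {0..1}" using s by auto
      have cs: "continuous_on {0..s} (c n)" for n using c continuous_on_subset[OF _ sub] by (auto simp: traj_def)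
      have "(\<lambda>N. L / 2 * (\<Sum>n<N. (cmod (c n s))\<^sup>2)) \<longlonglongrightarrow> Y s"
        unfolding Y_sum[OF s] by (intro tendsto_intros summable_LIMSEQ summable_sq traj_finite_energy[OF c s])
      then have "Y s \<le> 2 * integral {0..s} (\<lambda>s. 2 * \<gamma> * Y s + L * C1)"
      proof (rule LIMSEQ_le_const2, intro exI[of _ 0] allI impI)
        fix N
        have "integral {0..s} (\<lambda>s. (cmod (c n s))\<^sup>2) \<ge> 0" for n
          by (intro Henstock_Kurzweil_Integration.integral_nonneg integrable_continuous_real continuous_intros cs) simp
        then have "(\<Sum>n<N. (cmod (c n s))\<^sup>2) \<le> (\<Sum>n<N. (cmod (c n s))\<^sup>2 + 2 * \<nu> * (mu n * integral {0..s} (\<lambda>s. (cmod (c n s))\<^sup>2)))"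
          using \<nu> mu_pos by (intro sum_mono) (simp add: less_imp_le)
        then have "L / 2 * (\<Sum>n<N. (cmod (c n s))\<^sup>2) \<le> L / 2 * (\<Sum>n<N. (cmod (c n s))\<^sup>2 + 2 * \<nu> * (mu n * integral {0..s} (\<lambda>s. (cmod (c n s))\<^sup>2)))"
          using L_pos by (intro mult_left_mono) auto
        then show "L / 2 * (\<Sum>n<N. (cmod (c n s))\<^sup>2) \<le> 2 * integral {0..s} (\<lambda>s. 2 * \<gamma> * Y s + L * C1)"
          using partial[OF s, of N] by linarith
      qed
      also have "\<dots> = 4 * \<gamma> * integral {0..s} Y + 2 * L * C1 * s" unfolding YI[OF s] by simp
      also have "2 * L * C1 * s \<le> 2 * L * C1 * 1" using s L_pos C10 by (intro mult_left_mono) auto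
      finally show ?thesis by simp
    qed
    have Y1: "Y s \<le> Y1" if s: "s \<in> {0..1}" for s
    proof -
      have "Y s \<le> 2 * L * C1 * exp (4 * \<gamma> * s)"
        by (rule gronwall[OF Yc _ s]) (use Y_le \<gamma> in auto)
      also have "\<dots> \<le> Y1" unfolding Y1_def using s \<gamma> L_pos C10 by (intro mult_left_mono) (auto simp: mult_left_le)
      finally show ?thesis .
    qed
    define S where "S s = energy (\<lambda>n. c n s)" for s
    have Sc: "continuous_on {0..1} S" unfolding S_def by (rule energy_continuous[OF c])
    have S0: "S s \<ge> 0" if "s \<in> {0..1}" for s unfolding S_def by (rule energy_nonneg[OF traj_finite_energy[OF c that]])
    \<comment> \<open>The same estimate at time 1, now dropping the mass and keeping the
      dissipation, with \<open>Y1\<close> inserted on the right.\<close>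
    have "integral {0..1} S \<le> Z"
      unfolding S_def
    proof (rule integral_energy_le[OF c])
      fix N
      have "(\<Sum>n<N. 2 * \<nu> * (mu n * integral {0..1} (\<lambda>s. (cmod (c n s))\<^sup>2))) \<le> (\<Sum>n<N. (cmod (c n 1))\<^sup>2 + 2 * \<nu> * (mu n * integral {0..1} (\<lambda>s. (cmod (c n s))\<^sup>2)))"
        by (intro sum_mono) simp
      then have "L / 2 * (\<Sum>n<N. 2 * \<nu> * (mu n * integral {0..1} (\<lambda>s. (cmod (c n s))\<^sup>2))) \<le> 2 * integral {0..1} (\<lambda>s. 2 * \<gamma> * Y s + L * C1)"
        using partial[of 1 N] L_pos by (smt (verit) atLeastAtMost_iff divide_pos_pos mult_left_mono)
      also have "integral {0..1} (\<lambda>s. 2 * \<gamma> * Y s + L * C1) \<le> integral {0..1::real} (\<lambda>s. 2 * \<gamma> * Y1 + L * C1)"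
      proof (rule integral_le)
        show "(\<lambda>s. 2 * \<gamma> * Y s + L * C1) integrable_on {0..1}" "(\<lambda>s::real. 2 * \<gamma> * Y1 + L * C1) integrable_on {0..1}"
          by (intro integrable_continuous_real continuous_intros Yc)+
        fix s :: real assume "s \<in> {0..1}"
        from mult_left_mono[OF Y1[OF this], of "2 * \<gamma>"] show "2 * \<gamma> * Y s + L * C1 \<le> 2 * \<gamma> * Y1 + L * C1"
          using \<gamma> by simp
      qed
      also have "\<dots> = 2 * \<gamma> * Y1 + L * C1" by simp
      finally have "L * \<nu> * (\<Sum>n<N. mu n * integral {0..1} (\<lambda>s. (cmod (c n s))\<^sup>2)) \<le> 2 * (2 * \<gamma> * Y1 + L * C1)"
        by (simp add: sum_distrib_left[symmetric])
      then show "(\<Sum>n<N. mu n * integral {0..1} (\<lambda>s. (cmod (c n s))\<^sup>2)) \<le> Z"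
        unfolding Z_def using L_pos \<nu> by (subst pos_le_divide_eq) (auto simp: mult.commute)
    qed
    have f6: "integral {0..L} (\<lambda>y. (cmod (f s y))\<^sup>2) \<le> K1 * (L * (2 + 256 * M ^ 6) + 512 * L * Y1\<^sup>2 * S s)" if s: "s \<in> {0..1}" for s
    proof -
      note fe = traj_finite_energy[OF c s]
      \<comment> \<open>Agmon's inequality: one factor is the L2 norm, already bounded by
        \<open>Y1\<close>, and the energy appears only to the first power.\<close>
      have q4: "(cmod (q s y)) ^ 4 \<le> 2 * L * Y1 * S s" if y: "y \<in> {0..L}" for y
      proof -
        have "(cmod (q s y)) ^ 4 \<le> L\<^sup>2 * (\<Sum>n. (cmod (c n s))\<^sup>2) * S s"
          unfolding q_def S_def by (rule agmon[OF fe y])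
        also have "L\<^sup>2 * (\<Sum>n. (cmod (c n s))\<^sup>2) = 2 * L * Y s" using Y_sum[OF s] L_pos by (simp add: power2_eq_square)
        also have "2 * L * Y s * S s \<le> 2 * L * Y1 * S s" using Y1[OF s] S0[OF s] L_pos by (intro mult_right_mono mult_left_mono) auto
        finally show ?thesis .
      qed
      \<comment> \<open>|u| <= 2 max M v gives 64 (M^6 + v^6), and v^6 splits into v^4, bounded by
        \<open>q4\<close>, and v^2, left for the space integral. The result is linear in
        \<open>S s\<close>, hence integrable in time.\<close>
      have pw: "(cmod (f s y))\<^sup>2 \<le> K1 * (2 + 256 * M ^ 6) + K1 * (512 * L * Y1 * S s) * (cmod (q s y))\<^sup>2" if y: "y \<in> {0..L}" for y
      proof -
        define v where "v = cmod (q s y)"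
        have "cmod (u s y) \<le> M + v" using M[OF s y] norm_triangle_ineq[of "zeta s y" "q s y"] unfolding uq[OF s y] v_def by simp
        also have "\<dots> \<le> 2 * max M v" by simp
        finally have "(cmod (u s y)) ^ 6 \<le> (2 * max M v) ^ 6" by (rule power_mono) simp
        also have "\<dots> = 64 * (max M v) ^ 6" by (simp add: power_mult_distrib)
        also have "(max M v) ^ 6 \<le> M ^ 6 + v ^ 6" using M0 by (simp add: max_def v_def)
        finally have u6: "(cmod (u s y)) ^ 6 \<le> 64 * (M ^ 6 + v ^ 6)" by simp
        have "(cmod (f s y))\<^sup>2 \<le> K1 * (2 + 4 * (cmod (u s y)) ^ 6)" unfolding f_def K1_def by (rule G_growth[OF r])
        also have "\<dots> \<le> K1 * (2 + 256 * M ^ 6 + 256 * v ^ 6)" using u6 by (intro mult_left_mono K10) simp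
        also have "\<dots> \<le> K1 * (2 + 256 * M ^ 6 + 256 * ((2 * L * Y1 * S s) * v\<^sup>2))"
        proof -
          have "v ^ 6 = v ^ 4 * v\<^sup>2" by (simp flip: power_add)
          also have "\<dots> \<le> (2 * L * Y1 * S s) * v\<^sup>2" using q4[OF y] by (intro mult_right_mono) (auto simp: v_def)
          finally show ?thesis by (intro mult_left_mono K10) simp
        qed
        finally show ?thesis by (simp add: v_def algebra_simps)
      qed
      note qs = cont_rect_slice(1)[OF q s] and fs = cont_rect_slice(1)[OF f s]
      have "integral {0..L} (\<lambda>y. (cmod (f s y))\<^sup>2) \<le> integral {0..L} (\<lambda>y. K1 * (2 + 256 * M ^ 6) + K1 * (512 * L * Y1 * S s) * (cmod (q s y))\<^sup>2)"
        by (intro integral_le integrable_continuous_real continuous_intros qs fs pw)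
      also have "\<dots> = integral {0..L} (\<lambda>y. K1 * (2 + 256 * M ^ 6)) + integral {0..L} (\<lambda>y. K1 * (512 * L * Y1 * S s) * (cmod (q s y))\<^sup>2)"
        by (intro integral_add_continuous continuous_intros qs)
      also have "\<dots> = L * (K1 * (2 + 256 * M ^ 6)) + K1 * (512 * L * Y1 * S s) * Y s"
        using L_pos unfolding integral_mult_right Y_def by simp
      also have "K1 * (512 * L * Y1 * S s) * Y s \<le> K1 * (512 * L * Y1 * S s) * Y1"
        using Y1[OF s] K10 L_pos Y10 S0[OF s] by (intro mult_left_mono) auto
      finally show ?thesis by (simp add: power2_eq_square algebra_simps)
    qed
    have sub: "{0..t} \<subseteq> {0..1}" using tx(1) by auto
    have fj: "cont_rect (\<lambda>s y. (cmod (f s y))\<^sup>2)" by (intro cont_rect_power cont_rect_norm f)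
    have "energy (\<lambda>n. c n t) \<le> integral {0..t} (\<lambda>s. integral {0..L} (\<lambda>y. (cmod (f s y))\<^sup>2)) / (\<nu> * L)"
      unfolding c_def by (rule duhamel_mode_energy_le[OF f tx(1)])
    also have "\<dots> \<le> E1" unfolding E1_def
    proof (rule divide_right_mono)
      have "integral {0..t} (\<lambda>s. integral {0..L} (\<lambda>y. (cmod (f s y))\<^sup>2)) \<le> integral {0..1} (\<lambda>s. integral {0..L} (\<lambda>y. (cmod (f s y))\<^sup>2))"
        using sub by (intro integral_subset_le integrable_continuous_real continuous_on_subset[OF cont_rect_integral_space[OF fj]])
          (auto intro!: Henstock_Kurzweil_Integration.integral_nonneg integrable_continuous_real cont_rect_slice(1)[OF fj])
      also have "\<dots> \<le> integral {0..1} (\<lambda>s. K1 * (L * (2 + 256 * M ^ 6)) + K1 * (512 * L * Y1\<^sup>2) * S s)"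
        using f6 by (intro integral_le integrable_continuous_real continuous_intros cont_rect_integral_space[OF fj] Sc) (auto simp: algebra_simps)
      also have "\<dots> = integral {0..1::real} (\<lambda>s. K1 * (L * (2 + 256 * M ^ 6))) + integral {0..1} (\<lambda>s. K1 * (512 * L * Y1\<^sup>2) * S s)"
        by (intro integral_add_continuous continuous_intros Sc)
      also have "\<dots> = K1 * (L * (2 + 256 * M ^ 6)) + K1 * (512 * L * Y1\<^sup>2) * integral {0..1} S"
        unfolding integral_mult_right by simp
      also have "K1 * (512 * L * Y1\<^sup>2) * integral {0..1} S \<le> K1 * (512 * L * Y1\<^sup>2) * Z"
        using \<open>integral {0..1} S \<le> Z\<close> K10 L_pos by (intro mult_left_mono) auto
      finally show "integral {0..t} (\<lambda>s. integral {0..L} (\<lambda>y. (cmod (f s y))\<^sup>2)) \<le> K1 * (L * (2 + 256 * M ^ 6) + 512 * L * Y1\<^sup>2 * Z)"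
        by (simp add: algebra_simps)
    qed (use L_pos \<nu> in simp)
    finally have E: "energy (\<lambda>n. c n t) \<le> E1" .
    have "(cmod (q t x))\<^sup>2 \<le> L / freq 0 * energy (\<lambda>n. c n t)"
      unfolding q_def by (rule sin_series_sup_energy[OF traj_finite_energy[OF c tx(1)] tx(2)])
    also have "\<dots> \<le> L / freq 0 * E1" using E L_pos freq_pos[of 0] by (intro mult_left_mono) (auto simp: less_imp_le)
    finally have "cmod (q t x) \<le> sqrt (L / freq 0 * E1)" by (rule real_le_rsqrt)
    then show ?thesis
      using M[OF tx] norm_triangle_ineq[of "zeta t x" "q t x"] unfolding uq[OF tx] Q_def by simp
  qed
  then show thesis using that by blast
qed

end

section \<open>Existence on the unit time interval\<close>

context mixed_interval
begin

lemma sin_series_0: "sin_series c 0 = 0" by (simp add: sin_series_def)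

text \<open>Two integrations by parts at once. The boundary terms vanish because sin and h vanish at
  0, k vanishes at L, and cos (freq n * L) = 0.\<close>

lemma coef_second_derivative:
  assumes h: "\<And>x. x \<in> {0..L} \<Longrightarrow> (h has_vector_derivative k x) (at x within {0..L})"
    and k: "\<And>x. x \<in> {0..L} \<Longrightarrow> (k has_vector_derivative W x) (at x within {0..L})"
    and W: "continuous_on {0..L} W" and h0: "h 0 = 0" and kL: "k L = 0"
  shows "coef W n = - of_real (mu n) * coef h n"
proof -
  have hc: "continuous_on {0..L} h" 
    using h by (meson continuous_on_eq_continuous_within has_vector_derivative_continuous)
  have "((\<lambda>x. sin (freq n * x) *\<^sub>R W x + mu n *\<^sub>R (sin (freq n * x) *\<^sub>R h x)) has_integral
     (sin (freq n * L) *\<^sub>R k L - (freq n * cos (freq n * L)) *\<^sub>R h L) - (sin (freq n * 0) *\<^sub>R k 0 - (freq n * cos (freq n * 0)) *\<^sub>R h 0)) {0..L}"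
  proof (rule fundamental_theorem_of_calculus)
    fix x assume x: "x \<in> {0..L}"
    have s: "((\<lambda>x. sin (freq n * x)) has_real_derivative cos (freq n * x) * freq n) (at x within {0..L})"
      by (rule derivative_eq_intros refl | simp)+
    have c: "((\<lambda>x. freq n * cos (freq n * x)) has_real_derivative - (mu n * sin (freq n * x))) (at x within {0..L})"
      by (rule derivative_eq_intros refl | simp add: mu_def power2_eq_square)+
    have "((\<lambda>x. sin (freq n * x) *\<^sub>R k x - (freq n * cos (freq n * x)) *\<^sub>R h x) has_vector_derivative
        (sin (freq n * x) *\<^sub>R W x + (cos (freq n * x) * freq n) *\<^sub>R k x)
        - ((freq n * cos (freq n * x)) *\<^sub>R k x + (- (mu n * sin (freq n * x))) *\<^sub>R h x)) (at x within {0..L})"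
      by (intro has_vector_derivative_diff has_vector_derivative_scaleR s c h k x)
    then show "((\<lambda>x. sin (freq n * x) *\<^sub>R k x - (freq n * cos (freq n * x)) *\<^sub>R h x) has_vector_derivative
        sin (freq n * x) *\<^sub>R W x + mu n *\<^sub>R (sin (freq n * x) *\<^sub>R h x)) (at x within {0..L})"
      by (simp add: mult.commute)
  qed (use L_pos in simp)
  then have "integral {0..L} (\<lambda>x. sin (freq n * x) *\<^sub>R W x + mu n *\<^sub>R (sin (freq n * x) *\<^sub>R h x)) = 0"
    using h0 kL by (simp add: cos_freq_L integral_unique)
  moreover have "integral {0..L} (\<lambda>x. sin (freq n * x) *\<^sub>R W x + mu n *\<^sub>R (sin (freq n * x) *\<^sub>R h x)) =
     integral {0..L} (\<lambda>x. sin (freq n * x) *\<^sub>R W x) + integral {0..L} (\<lambda>x. mu n *\<^sub>R (sin (freq n * x) *\<^sub>R h x))"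
    by (intro integral_add_continuous continuous_intros W hc)
  moreover have "integral {0..L} (\<lambda>x. mu n *\<^sub>R (sin (freq n * x) *\<^sub>R h x)) = mu n *\<^sub>R integral {0..L} (\<lambda>x. sin (freq n * x) *\<^sub>R h x)"
    by (rule integral_cmul)
  ultimately have "integral {0..L} (\<lambda>x. sin (freq n * x) *\<^sub>R W x) = - (mu n *\<^sub>R integral {0..L} (\<lambda>x. sin (freq n * x) *\<^sub>R h x))"
    by (simp add: eq_neg_iff_add_eq_0)
  then show ?thesis by (simp add: coef_def scaleR_conv_of_real)
qed

end

context cgl_data
begin

text \<open>In the proof, \<open>W\<close> is defined so as to make the equation hold; it is the second derivative of the
  time integral of the solution because its second primitive has the same Fourier coefficients.\<close>

lemma solution_exists: "\<exists>v. CGL_solution L \<nu> \<alpha> \<kappa> \<beta> \<gamma> p u0 a b 1 v"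
proof -
  obtain Q where Q: "\<And>r u t x. r > 0 \<Longrightarrow> cont_rect u \<Longrightarrow> (\<And>t x. t \<in> {0..1} \<Longrightarrow> x \<in> {0..L} \<Longrightarrow> u t x = Phi r u t x) \<Longrightarrow>
     t \<in> {0..1} \<Longrightarrow> x \<in> {0..L} \<Longrightarrow> cmod (u t x) \<le> Q"
    using apriori by blast
  \<comment> \<open>At or above the a priori bound the truncation is inactive; the maximum with 1
    ensures positivity.\<close>
  define r where "r = max Q 1"
  have r: "r > 0" by (simp add: r_def)
  obtain u where u: "cont_rect u" and fp: "\<And>t x. t \<in> {0..1} \<Longrightarrow> x \<in> {0..L} \<Longrightarrow> u t x = Phi r u t x"
    using picard[OF r] by blast
  have ub: "cmod (u t x) \<le> r" if "t \<in> {0..1}" "x \<in> {0..L}" for t x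
    using Q[OF r u fp that] by (simp add: r_def)
  define f where "f s y = G r (u s y)" for s y
  have f: "cont_rect f" unfolding f_def[abs_def] by (rule cont_rect_G[OF r u])
  define w where "w n t = ell n t + duhamel_mode f n t" for n t
  have w: "traj 1 w" unfolding w_def[abs_def] by (intro traj_add ell_traj duhamel_mode_traj f)
  define v where "v t x = a t + of_real x * b t + sin_series (\<lambda>n. w n t) x" for t x
  have v_C: "v \<in> C_H1 1 L" unfolding v_def[abs_def] by (rule traj_C_H1[OF w ac bc])
  have vu: "v t x = u t x" if t: "t \<in> {0..1}" and x: "x \<in> {0..L}" for t x
    unfolding fp[OF t x] Phi_def zeta_def v_def w_def
    by (subst sin_series_add) (auto simp: f_def[abs_def] intro!: traj_finite_energy[OF ell_traj] traj_finite_energy[OF duhamel_mode_traj[OF f], unfolded f_def[abs_def]] t[unfolded atLeastAtMost_iff])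
  have v: "cont_rect v" unfolding v_def[abs_def]
    by (intro cont_rect_add cont_rect_mult cont_rect_time cont_rect_space ac bc continuous_intros) 
      (unfold cont_rect_def, rule traj_continuous[OF w])
  define F where "F t x = - (of_real \<kappa> + \<i> * of_real \<beta>) * of_real (cmod (v t x) powr p) * v t x" for t x
  have fF: "f t x = of_real \<gamma> * v t x + F t x" if t: "t \<in> {0..1}" and x: "x \<in> {0..L}" for t x
    using ub[OF t x] unfolding f_def vu[OF t x, symmetric] 
    by (simp add: G_def trunc_power_def F_def damping_def min_def algebra_simps)
  have F: "cont_rect F"
  proof -
    have "continuous_on UNIV (\<lambda>z::complex. - (of_real \<kappa> + \<i> * of_real \<beta>) * of_real (cmod z powr p) * z)"
      using p by (intro continuous_intros continuous_on_powr') auto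
    from cont_rect_compose[OF v this] show ?thesis by (simp add: F_def[abs_def])
  qed
  have v0: "v 0 x = u0 x" if x: "x \<in> {0..L}" for x
  proof -
    have "w n 0 = coef w0 n" for n by (simp add: w_def ell_0 duhamel_mode_def duhamel_0)
    then have "v 0 x = a 0 + of_real x * b 0 + w0 x"
      using sin_series_coef[OF w0_energy w0_continuous x] by (simp add: v_def)
    then show ?thesis by (simp add: w0_def)
  qed
  have u0c: "continuous_on {0..L} u0" using u0 by (simp add: H1_def)
  define An where "An n = coef (\<lambda>x. 1) n" for n
  define Bn where "Bn n = coef of_real n" for n
  have coef_v: "coef (v s) n = a s * An n + b s * Bn n + w n s" if s: "s \<in> {0..1}" for s n
  proof -
    note fe = traj_finite_energy[OF w s]
    have "coef (v s) n = coef (\<lambda>x. (a s * 1 + b s * of_real x) + sin_series (\<lambda>n. w n s) x) n"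
      by (rule coef_cong) (simp add: v_def mult.commute)
    also have "\<dots> = coef (\<lambda>x. a s * 1 + b s * of_real x) n + coef (sin_series (\<lambda>n. w n s)) n"
      by (intro coef_add continuous_intros sin_series_continuous_on fe)
    also have "coef (\<lambda>x. a s * 1 + b s * of_real x) n = coef (\<lambda>x. a s * 1) n + coef (\<lambda>x. b s * of_real x) n"
      by (intro coef_add continuous_intros)
    finally show ?thesis by (simp only: coef_mult coef_sin_series[OF fe] An_def Bn_def)
  qed
  have coef_u0: "coef u0 n = a 0 * An n + b 0 * Bn n + coef w0 n" for n
  proof -
    have "coef u0 n = coef (v 0) n" by (rule coef_cong) (simp add: v0)
    also have "\<dots> = a 0 * An n + b 0 * Bn n + w n 0" by (rule coef_v) simp
    finally show ?thesis by (simp add: w_def ell_0 duhamel_mode_def duhamel_0)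
  qed
  have mild: "\<exists>V W. weak_derivative 0 L (\<lambda>x. LINT s|lebesgue_on {0..t}. v s x) V \<and> weak_derivative 0 L V W \<and> V \<in> H1 0 L \<and>
          V L = (LINT s|lebesgue_on {0..t}. b s) \<and>
          (AE x in lebesgue_on {0..L}.
             v t x - u0 x - (of_real \<nu> + \<i> * of_real \<alpha>) * W x - of_real \<gamma> * (LINT s|lebesgue_on {0..t}. v s x) =
             (LINT s|lebesgue_on {0..t}. F s x))" if t: "t \<in> {0..1}" for t
  proof -
    have sub: "{0..t} \<subseteq> {0..1}" using t by auto
    define Iv where "Iv x = integral {0..t} (\<lambda>s. v s x)" for x
    define IF where "IF x = integral {0..t} (\<lambda>s. F s x)" for x
    have Ivc: "continuous_on {0..L} Iv" unfolding Iv_def by (rule cont_rect_integral_time[OF v t])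
    have IFc: "continuous_on {0..L} IF" unfolding IF_def by (rule cont_rect_integral_time[OF F t])
    have Iv_eq: "(LINT s|lebesgue_on {0..t}. v s x) = Iv x" if "x \<in> {0..L}" for x
      unfolding Iv_def by (intro lint_continuous continuous_on_subset[OF cont_rect_slice(2)[OF v that] sub])
    have IF_eq: "(LINT s|lebesgue_on {0..t}. F s x) = IF x" if "x \<in> {0..L}" for x
      unfolding IF_def by (intro lint_continuous continuous_on_subset[OF cont_rect_slice(2)[OF F that] sub])
    define W where "W x = (v t x - u0 x - of_real \<gamma> * Iv x - IF x) / lam" for x
    have Wc: "continuous_on {0..L} W" unfolding W_def
      using lam_nonzero by (intro continuous_intros cont_rect_slice(1)[OF v t] u0c Ivc IFc) auto
    define A where "A = integral {0..t} a"
    define B where "B = integral {0..t} b"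
    \<comment> \<open>The constant of integration imposes the Neumann condition V L = B; in the next
      primitive it imposes the Dirichlet condition Ut 0 = A.\<close>
    define V where "V x = (B - integral {0..L} W) + integral {0..x} W" for x
    have VD: "(V has_vector_derivative W x) (at x within {0..L})" if "x \<in> {0..L}" for x
      unfolding V_def using has_vector_derivative_add[OF has_vector_derivative_const integral_has_vector_derivative[OF Wc that]] by simp
    have Vc: "continuous_on {0..L} V"
      using VD by (meson continuous_on_eq_continuous_within has_vector_derivative_continuous)
    define Ut where "Ut x = A + integral {0..x} V" for x
    have UD: "(Ut has_vector_derivative V x) (at x within {0..L})" if "x \<in> {0..L}" for x
      unfolding Ut_def using has_vector_derivative_add[OF has_vector_derivative_const integral_has_vector_derivative[OF Vc that]] by simp
    have Uc: "continuous_on {0..L} Ut"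
      using UD by (meson continuous_on_eq_continuous_within has_vector_derivative_continuous)
    have coef_Iv: "coef Iv n = A * An n + B * Bn n + integral {0..t} (w n)" for n
    proof -
      have act: "continuous_on {0..t} a" "continuous_on {0..t} b" "continuous_on {0..t} (w n)"
        using ac bc w sub by (auto simp: traj_def intro: continuous_on_subset)
      have "coef Iv n = integral {0..t} (\<lambda>s. coef (v s) n)" unfolding Iv_def by (rule cont_rect_coef_integral[OF v t, symmetric])
      also have "\<dots> = integral {0..t} (\<lambda>s. (a s * An n + b s * Bn n) + w n s)"
        by (rule Henstock_Kurzweil_Integration.integral_cong) (use coef_v sub in auto)
      also have "\<dots> = integral {0..t} (\<lambda>s. a s * An n + b s * Bn n) + integral {0..t} (w n)"
        by (intro integral_add_continuous continuous_intros act)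
      also have "integral {0..t} (\<lambda>s. a s * An n + b s * Bn n) = integral {0..t} (\<lambda>s. a s * An n) + integral {0..t} (\<lambda>s. b s * Bn n)"
        by (intro integral_add_continuous continuous_intros act)
      finally show ?thesis by (simp add: A_def B_def)
    qed
    have coef_f: "coef (\<lambda>x. integral {0..t} (\<lambda>s. f s x)) n = of_real \<gamma> * coef Iv n + coef IF n" for n
    proof -
      have "coef (\<lambda>x. integral {0..t} (\<lambda>s. f s x)) n = coef (\<lambda>x. of_real \<gamma> * Iv x + IF x) n"
      proof (rule coef_cong)
        fix x assume x: "x \<in> {0..L}"
        have "integral {0..t} (\<lambda>s. f s x) = integral {0..t} (\<lambda>s. of_real \<gamma> * v s x + F s x)"
          by (rule Henstock_Kurzweil_Integration.integral_cong) (use fF x sub in auto)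
        also have "\<dots> = integral {0..t} (\<lambda>s. of_real \<gamma> * v s x) + integral {0..t} (\<lambda>s. F s x)"
          by (intro integral_add_continuous continuous_intros
              continuous_on_subset[OF cont_rect_slice(2)[OF v x] sub] continuous_on_subset[OF cont_rect_slice(2)[OF F x] sub])
        finally show "integral {0..t} (\<lambda>s. f s x) = of_real \<gamma> * Iv x + IF x" by (simp add: Iv_def IF_def)
      qed
      also have "\<dots> = coef (\<lambda>x. of_real \<gamma> * Iv x) n + coef IF n"
        by (intro coef_add continuous_intros Ivc IFc)
      finally show ?thesis by (simp only: coef_mult)
    qed
    have coef_W: "coef W n = - of_real (mu n) * integral {0..t} (w n)" for n
    proof -
      have cl: "continuous_on {0..t} (ell n)" "continuous_on {0..t} (duhamel_mode f n)"
        using ell_traj duhamel_mode_traj[OF f] sub by (auto simp: traj_def intro: continuous_on_subset)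
      have Iw: "integral {0..t} (w n) = integral {0..t} (ell n) + integral {0..t} (duhamel_mode f n)"
        unfolding w_def[abs_def] by (intro integral_add_continuous cl)
      \<comment> \<open>The integrated equations of the lift and of the Duhamel part added up. The
        affine terms cancel in \<open>coef W n\<close>, which leaves the eigenvalue times the
        integral of \<open>w n\<close>.\<close>
      have wt: "w n t = coef w0 n - rate n * integral {0..t} (w n) - An n * (a t - a 0) - Bn n * (b t - b 0)
         + (of_real \<gamma> * coef Iv n + coef IF n)"
        unfolding w_def[of n t] ell_integral[OF t] duhamel_mode_integral[OF f t] coef_f Iw An_def Bn_def
        by (simp add: algebra_simps)
      have "lam * coef W n = coef (\<lambda>x. lam * W x) n" by (rule coef_mult[symmetric])
      also have "\<dots> = coef (\<lambda>x. (v t x - u0 x) - (of_real \<gamma> * Iv x + IF x)) n"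
        by (rule coef_cong) (use lam_nonzero in \<open>simp add: W_def\<close>)
      also have "\<dots> = coef (\<lambda>x. v t x - u0 x) n - coef (\<lambda>x. of_real \<gamma> * Iv x + IF x) n"
        by (intro coef_diff continuous_intros cont_rect_slice(1)[OF v t] u0c Ivc IFc)
      also have "coef (\<lambda>x. v t x - u0 x) n = coef (v t) n - coef u0 n"
        by (intro coef_diff continuous_intros cont_rect_slice(1)[OF v t] u0c)
      also have "coef (\<lambda>x. of_real \<gamma> * Iv x + IF x) n = coef (\<lambda>x. of_real \<gamma> * Iv x) n + coef IF n"
        by (intro coef_add continuous_intros Ivc IFc)
      finally have "lam * coef W n = - (rate n * integral {0..t} (w n))"
        unfolding coef_v[OF t] coef_u0 coef_mult wt by (simp add: algebra_simps)
      then have "lam * coef W n = lam * (- of_real (mu n) * integral {0..t} (w n))" by (simp add: rate_def)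
      then show ?thesis using lam_nonzero mult_left_cancel by blast
    qed
    have coef_Ut: "coef Ut n = coef Iv n" for n
    proof -
      \<comment> \<open>Subtracting the affine function with data \<open>A\<close> and
        \<open>B\<close> makes the boundary conditions homogeneous, as
        \<open>coef_second_derivative\<close> requires.\<close>
      define h where "h x = Ut x - (A + of_real x * B)" for x
      define k where "k x = V x - B" for x
      have xD: "((\<lambda>x. A + complex_of_real x * B) has_vector_derivative B) (at x within {0..L})" for x
      proof -
        have "((\<lambda>x. A + x * B) has_field_derivative B) (at (of_real x))" by (auto intro!: derivative_eq_intros)
        from has_vector_derivative_real_field[OF this] show ?thesis by simp
      qed
      have "coef W n = - of_real (mu n) * coef h n"
      proof (rule coef_second_derivative[of h k])
        show "(h has_vector_derivative k x) (at x within {0..L})" if "x \<in> {0..L}" for x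
          unfolding h_def k_def by (intro has_vector_derivative_diff UD xD that)
        show "(k has_vector_derivative W x) (at x within {0..L})" if "x \<in> {0..L}" for x
          unfolding k_def using has_vector_derivative_diff[OF VD[OF that] has_vector_derivative_const] by simp
      qed (auto simp: Wc h_def Ut_def k_def V_def)
      then have "of_real (mu n) * coef h n = of_real (mu n) * integral {0..t} (w n)" unfolding coef_W by auto
      then have ch: "coef h n = integral {0..t} (w n)" using mu_pos[of n] by simp
      have "coef Ut n = coef (\<lambda>x. h x + (A * 1 + B * of_real x)) n" by (rule coef_cong) (simp add: h_def mult.commute)
      also have "\<dots> = coef h n + coef (\<lambda>x. A * 1 + B * of_real x) n"
        unfolding h_def by (intro coef_add continuous_intros Uc)
      also have "coef (\<lambda>x. A * 1 + B * of_real x) n = coef (\<lambda>x. A * 1) n + coef (\<lambda>x. B * of_real x) n"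
        by (intro coef_add continuous_intros)
      finally show ?thesis unfolding coef_mult ch coef_Iv An_def Bn_def by simp
    qed
    have UtIv: "Ut x = Iv x" if "x \<in> {0..L}" for x
      by (rule coef_unique[OF Uc Ivc coef_Ut that])
    have wU: "weak_derivative 0 L (\<lambda>x. LINT s|lebesgue_on {0..t}. v s x) V"
    proof -
      have "weak_derivative 0 L Ut V" by (rule weak_derivative_C1[OF UD Vc])
      moreover have "weak_derivative 0 L (\<lambda>x. LINT s|lebesgue_on {0..t}. v s x) V \<longleftrightarrow> weak_derivative 0 L Ut V"
        by (rule weak_derivative_cong) (simp_all add: Iv_eq UtIv)
      ultimately show ?thesis by simp
    qed
    have wV: "weak_derivative 0 L V W" by (rule weak_derivative_C1[OF VD Wc])
    have VL: "V L = (LINT s|lebesgue_on {0..t}. b s)"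
      using lint_continuous[OF continuous_on_subset[OF bc sub]] by (simp add: V_def B_def)
    have eq: "v t x - u0 x - (of_real \<nu> + \<i> * of_real \<alpha>) * W x - of_real \<gamma> * (LINT s|lebesgue_on {0..t}. v s x) =
             (LINT s|lebesgue_on {0..t}. F s x)" if x: "x \<in> {0..L}" for x
      unfolding Iv_eq[OF x] IF_eq[OF x] lam_def[symmetric] W_def using lam_nonzero by simp
    show ?thesis
      using wU wV Vc VL by (intro exI[of _ V] exI[of _ W] conjI AE_I2 eq) (auto simp: H1_def)
  qed
  have "linear_mild_solution L \<nu> \<alpha> \<gamma> u0 a b F 1 v"
    unfolding linear_mild_solution_def Let_def
    using v_C v0 mild by (auto simp: v_def sin_series_0)
  then show ?thesis unfolding CGL_solution_def F_def[abs_def] by blast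
qed

end

section \<open>Concatenation of solutions\<close>

lemma H1_norm_cong:
  assumes "\<And>x. x \<in> {c..d} \<Longrightarrow> f x = f' x"
  shows "H1_norm c d f = H1_norm c d f'"
proof -
  have "weak_derivative c d f g = weak_derivative c d f' g" for g
    by (rule weak_derivative_cong) (use assms in auto)
  then have "weak_derivative c d f = weak_derivative c d f'" by blast
  moreover have "(LINT x|lebesgue_on {c..d}. (cmod (f x))\<^sup>2) = (LINT x|lebesgue_on {c..d}. (cmod (f' x))\<^sup>2)"
    by (rule Bochner_Integration.integral_cong) (use assms in auto)
  ultimately show ?thesis by (simp add: H1_norm_def)
qed

lemma C_H1_cong:
  assumes u: "u \<in> C_H1 T L" and eq: "\<And>t x. t \<in> {0..T} \<Longrightarrow> x \<in> {0..L} \<Longrightarrow> v t x = u t x"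
  shows "v \<in> C_H1 T L"
  unfolding C_H1_def
proof (intro CollectI conjI ballI)
  fix t assume t: "t \<in> {0..T}"
  show "v t \<in> H1 0 L" using u t H1_cong[of 0 L "v t" "u t"] eq[OF t] by (auto simp: C_H1_def)
  have "((\<lambda>s. H1_norm 0 L (\<lambda>x. u s x - u t x)) \<longlongrightarrow> 0) (at t within {0..T})" using u t by (auto simp: C_H1_def)
  then show "((\<lambda>s. H1_norm 0 L (\<lambda>x. v s x - v t x)) \<longlongrightarrow> 0) (at t within {0..T})"
  proof (rule Lim_transform_eventually)
    show "\<forall>\<^sub>F s in at t within {0..T}. H1_norm 0 L (\<lambda>x. u s x - u t x) = H1_norm 0 L (\<lambda>x. v s x - v t x)"
      unfolding eventually_at_filter
      by (rule always_eventually) (use t eq in \<open>auto intro!: H1_norm_cong\<close>)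
  qed
qed

lemma C_H1_mono:
  assumes u: "u \<in> C_H1 T L" and "T' \<le> T"
  shows "u \<in> C_H1 T' L"
proof -
  have sub: "{0..T'} \<subseteq> {0..T}" using assms(2) by auto
  show ?thesis unfolding C_H1_def
  proof (intro CollectI conjI ballI)
    fix t assume "t \<in> {0..T'}"
    then have t: "t \<in> {0..T}" using sub by blast
    show "u t \<in> H1 0 L" using u t by (auto simp: C_H1_def)
    have "((\<lambda>s. H1_norm 0 L (\<lambda>x. u s x - u t x)) \<longlongrightarrow> 0) (at t within {0..T})"
      using u t unfolding C_H1_def by blast
    then show "((\<lambda>s. H1_norm 0 L (\<lambda>x. u s x - u t x)) \<longlongrightarrow> 0) (at t within {0..T'})"
      by (rule tendsto_within_subset[OF _ sub])
  qed
qed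

lemma CGL_solution_mono:
  assumes "CGL_solution L \<nu> \<alpha> \<kappa> \<beta> \<gamma> p u0 a b T u" "T' \<le> T"
  shows "CGL_solution L \<nu> \<alpha> \<kappa> \<beta> \<gamma> p u0 a b T' u"
  using assms C_H1_mono[of u T L T'] unfolding CGL_solution_def linear_mild_solution_def by (auto simp: Let_def)

lemma CGL_solution_cong:
  assumes s: "CGL_solution L \<nu> \<alpha> \<kappa> \<beta> \<gamma> p u0 a b T u" and eq: "\<And>t. t \<in> {0..T} \<Longrightarrow> v t = u t" and T: "T \<ge> 0"
  shows "CGL_solution L \<nu> \<alpha> \<kappa> \<beta> \<gamma> p u0 a b T v"
proof -
  define N where "N z = - (of_real \<kappa> + \<i> * of_real \<beta>) * of_real (cmod z powr p) * z" for z :: complex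
  note u' = s[unfolded CGL_solution_def linear_mild_solution_def Let_def, folded N_def]
  have vC: "v \<in> C_H1 T L" by (rule C_H1_cong[of u]) (use u' eq in auto)
  have mild: "\<exists>V W. weak_derivative 0 L (\<lambda>x. LINT s|lebesgue_on {0..t}. v s x) V \<and> weak_derivative 0 L V W \<and> V \<in> H1 0 L \<and>
          V L = (LINT s|lebesgue_on {0..t}. b s) \<and>
          (AE x in lebesgue_on {0..L}.
             v t x - u0 x - (of_real \<nu> + \<i> * of_real \<alpha>) * W x - of_real \<gamma> * (LINT s|lebesgue_on {0..t}. v s x) =
             (LINT s|lebesgue_on {0..t}. N (v s x)))" if t: "t \<in> {0..T}" for t
  proof -
    have 1: "(LINT s|lebesgue_on {0..t}. v s x) = (LINT s|lebesgue_on {0..t}. u s x)" for x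
      by (rule Bochner_Integration.integral_cong) (use t eq in auto)
    have 2: "(LINT s|lebesgue_on {0..t}. N (v s x)) = (LINT s|lebesgue_on {0..t}. N (u s x))" for x
      by (rule Bochner_Integration.integral_cong) (use t eq in auto)
    show ?thesis unfolding 1 2 eq[OF t] using u' t by blast
  qed
  have init: "v 0 x = u0 x" if "x \<in> {0..L}" for x using u' eq[of 0] T that by auto
  have bdry: "v t 0 = a t" if "t \<in> {0..T}" for t using u' eq[OF that] that by auto
  show ?thesis
    unfolding CGL_solution_def linear_mild_solution_def Let_def N_def[symmetric]
    using vC init bdry mild by blast
qed

text \<open>Limits are taken along the two closed time intervals separately and joined. At the
  junction both apply, since on \<open>{0..L}\<close> the concatenation agrees with the shifted
  \<open>w\<close> up to and including time T.\<close>

lemma C_H1_concat: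
  assumes u: "u \<in> C_H1 T L" and w: "w \<in> C_H1 S L" and T: "T \<ge> 0" "S \<ge> 0"
    and eq: "\<And>x. x \<in> {0..L} \<Longrightarrow> w 0 x = u T x"
  shows "(\<lambda>t. if t \<le> T then u t else w (t - T)) \<in> C_H1 (T + S) L" (is "?v \<in> _")
  unfolding C_H1_def
proof (intro CollectI conjI ballI)
  have split: "{0..T + S} = {0..T} \<union> {T..T + S}" using T by auto
  have vw: "?v t x = w (t - T) x" if "T \<le> t" "x \<in> {0..L}" for t x
    using that eq by (cases "t = T") auto
  fix t assume t: "t \<in> {0..T + S}"
  show "?v t \<in> H1 0 L"
    using u w t by (auto simp: C_H1_def)
  have left: "((\<lambda>s. H1_norm 0 L (\<lambda>x. ?v s x - ?v t x)) \<longlongrightarrow> 0) (at t within {0..T})"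
  proof (cases "t \<le> T")
    case True
    then have "((\<lambda>s. H1_norm 0 L (\<lambda>x. u s x - u t x)) \<longlongrightarrow> 0) (at t within {0..T})"
      using u t by (auto simp: C_H1_def)
    then show ?thesis
    proof (rule Lim_transform_eventually)
      show "\<forall>\<^sub>F s in at t within {0..T}. H1_norm 0 L (\<lambda>x. u s x - u t x) = H1_norm 0 L (\<lambda>x. ?v s x - ?v t x)"
        unfolding eventually_at_filter
        by (rule always_eventually) (use True in \<open>auto intro!: H1_norm_cong\<close>)
    qed
  next
    case False
    \<comment> \<open>A time outside the closed interval is no limit point of it, so the limit along
      it is vacuous.\<close>
    then have "\<not> t islimpt {0..T}" using closed_limpt closed_atLeastAtMost t by (metis atLeastAtMost_iff)
    then have "at t within {0..T} = bot" using trivial_limit_within by blast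
    then show ?thesis by simp
  qed
  have right: "((\<lambda>s. H1_norm 0 L (\<lambda>x. ?v s x - ?v t x)) \<longlongrightarrow> 0) (at t within {T..T + S})"
  proof (cases "T \<le> t")
    case True
    then have "((\<lambda>s. H1_norm 0 L (\<lambda>x. w s x - w (t - T) x)) \<longlongrightarrow> 0) (at (t - T) within {0..S})"
      using w t by (auto simp: C_H1_def)
    moreover have "filterlim (\<lambda>s. s - T) (at (t - T) within {0..S}) (at t within {T..T + S})"
      unfolding filterlim_at
    proof
      show "\<forall>\<^sub>F s in at t within {T..T + S}. s - T \<in> {0..S} \<and> s - T \<noteq> t - T"
        unfolding eventually_at_filter by (rule always_eventually) auto
      show "((\<lambda>s. s - T) \<longlongrightarrow> t - T) (at t within {T..T + S})" by (intro tendsto_intros)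
    qed
    ultimately have "((\<lambda>s. H1_norm 0 L (\<lambda>x. w (s - T) x - w (t - T) x)) \<longlongrightarrow> 0) (at t within {T..T + S})"
      by (rule filterlim_compose)
    then show ?thesis
    proof (rule Lim_transform_eventually)
      show "\<forall>\<^sub>F s in at t within {T..T + S}. H1_norm 0 L (\<lambda>x. w (s - T) x - w (t - T) x) = H1_norm 0 L (\<lambda>x. ?v s x - ?v t x)"
        unfolding eventually_at_filter
      proof (rule always_eventually, intro allI impI)
        fix s assume "s \<in> {T..T + S}"
        then have sT: "T \<le> s" by simp
        show "H1_norm 0 L (\<lambda>x. w (s - T) x - w (t - T) x) = H1_norm 0 L (\<lambda>x. ?v s x - ?v t x)"
        proof (intro H1_norm_cong)
          fix x assume x: "x \<in> {0..L}"
          show "w (s - T) x - w (t - T) x = ?v s x - ?v t x"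
            by (simp only: vw[OF sT x] vw[OF True x])
        qed
      qed
    qed
  next
    case False
    then have "\<not> t islimpt {T..T + S}" using closed_limpt closed_atLeastAtMost t by (metis atLeastAtMost_iff)
    then have "at t within {T..T + S} = bot" using trivial_limit_within by blast
    then show ?thesis by simp
  qed
  show "((\<lambda>s. H1_norm 0 L (\<lambda>x. ?v s x - ?v t x)) \<longlongrightarrow> 0) (at t within {0..T + S})"
    unfolding split by (rule Lim_Un[OF left right])
qed

lemma lint_concat:
  fixes h :: "real \<Rightarrow> complex"
  assumes h: "continuous_on {0..T + S} h" and t: "t \<in> {T..T + S}" and T: "T \<ge> 0"
  shows "(LINT s|lebesgue_on {0..t}. h s) = (LINT s|lebesgue_on {0..T}. h s) + (LINT s|lebesgue_on {0..t - T}. h (s + T))"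
proof -
  have ht: "continuous_on {0..t} h" by (rule continuous_on_subset[OF h]) (use t in auto)
  have hs: "continuous_on {0..t - T} (\<lambda>s. h (s + T))"
    by (rule continuous_on_compose2[OF h]) (use t T in \<open>auto intro!: continuous_intros\<close>)
  have hT: "continuous_on {0..T} h" by (rule continuous_on_subset[OF h]) (use t in auto)
  have "integral {0..t} h = integral {0..T} h + integral {T..t} h"
    by (rule Henstock_Kurzweil_Integration.integral_combine[symmetric]) (use t T integrable_continuous_real[OF ht] in auto)
  also have "integral {T..t} h = integral {0..t - T} (\<lambda>s. h (s + T))"
    using integral_shift_real_ivl[of T T t h] by simp
  finally show ?thesis by (simp add: lint_continuous ht hT hs)
qed

text \<open>The mild equation is integrated in time, so beyond T it is the sum of the equation of
  \<open>u\<close> on [0,T] and that of \<open>w\<close>; the intermediate value \<open>u T\<close>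
  telescopes, and the first and second space derivatives add.\<close>

lemma CGL_solution_concat:
  assumes u: "CGL_solution L \<nu> \<alpha> \<kappa> \<beta> \<gamma> p u0 a b T u"
    and w: "CGL_solution L \<nu> \<alpha> \<kappa> \<beta> \<gamma> p (u T) (\<lambda>s. a (s + T)) (\<lambda>s. b (s + T)) S w"
    and TS: "T \<ge> 0" "S \<ge> 0" and L: "L > 0" and p: "p > 0"
    and b: "continuous_on {0..T + S} b"
  shows "CGL_solution L \<nu> \<alpha> \<kappa> \<beta> \<gamma> p u0 a b (T + S) (\<lambda>t. if t \<le> T then u t else w (t - T))"
proof -
  define v where "v = (\<lambda>t. if t \<le> T then u t else w (t - T))"
  define N where "N z = - (of_real \<kappa> + \<i> * of_real \<beta>) * of_real (cmod z powr p) * z" for z :: complex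
  note u' = u[unfolded CGL_solution_def linear_mild_solution_def Let_def, folded N_def]
  note w' = w[unfolded CGL_solution_def linear_mild_solution_def Let_def, folded N_def]
  have uC: "u \<in> C_H1 T L" and wC: "w \<in> C_H1 S L" using u' w' by auto
  have w0: "w 0 x = u T x" if "x \<in> {0..L}" for x using w' that by auto
  have vC: "v \<in> C_H1 (T + S) L" unfolding v_def by (rule C_H1_concat[OF uC wC TS w0])
  have vw: "v (s + T) x = w s x" if "0 \<le> s" "x \<in> {0..L}" for s x
    using that w0 by (cases "s = 0") (auto simp: v_def)
  have vc: "continuous_on {0..T + S} (\<lambda>s. v s x)" if "x \<in> {0..L}" for x
    by (rule C_H1_continuous[OF vC L that])
  have Nc: "continuous_on UNIV N"
    unfolding N_def[abs_def] using p by (intro continuous_intros continuous_on_powr') auto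
  have Nvc: "continuous_on {0..T + S} (\<lambda>s. N (v s x))" if "x \<in> {0..L}" for x
    by (rule continuous_on_compose2[OF Nc vc[OF that]]) auto
  have mild: "\<exists>V W. weak_derivative 0 L (\<lambda>x. LINT s|lebesgue_on {0..t}. v s x) V \<and> weak_derivative 0 L V W \<and> V \<in> H1 0 L \<and>
          V L = (LINT s|lebesgue_on {0..t}. b s) \<and>
          (AE x in lebesgue_on {0..L}.
             v t x - u0 x - (of_real \<nu> + \<i> * of_real \<alpha>) * W x - of_real \<gamma> * (LINT s|lebesgue_on {0..t}. v s x) =
             (LINT s|lebesgue_on {0..t}. N (v s x)))" if t: "t \<in> {0..T + S}" for t
  proof (cases "t \<le> T")
    case True
    have 1: "(LINT s|lebesgue_on {0..t}. v s x) = (LINT s|lebesgue_on {0..t}. u s x)" for x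
      by (rule Bochner_Integration.integral_cong) (use True in \<open>auto simp: v_def\<close>)
    have 2: "(LINT s|lebesgue_on {0..t}. N (v s x)) = (LINT s|lebesgue_on {0..t}. N (u s x))" for x
      by (rule Bochner_Integration.integral_cong) (use True in \<open>auto simp: v_def\<close>)
    have "t \<in> {0..T}" using t True by simp
    then show ?thesis unfolding 1 2 using u' True by (simp add: v_def)
  next
    case False
    then have t': "t \<in> {T..T + S}" "t - T \<in> {0..S}" using t by auto
    have "T \<in> {0..T}" using TS by simp
    then obtain V1 W1 where 1: "weak_derivative 0 L (\<lambda>x. LINT s|lebesgue_on {0..T}. u s x) V1" "weak_derivative 0 L V1 W1"
      "V1 \<in> H1 0 L" "V1 L = (LINT s|lebesgue_on {0..T}. b s)"
      "AE x in lebesgue_on {0..L}.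
             u T x - u0 x - (of_real \<nu> + \<i> * of_real \<alpha>) * W1 x - of_real \<gamma> * (LINT s|lebesgue_on {0..T}. u s x) =
             (LINT s|lebesgue_on {0..T}. N (u s x))"
      using u' by blast
    obtain V2 W2 where 2: "weak_derivative 0 L (\<lambda>x. LINT s|lebesgue_on {0..t - T}. w s x) V2" "weak_derivative 0 L V2 W2"
      "V2 \<in> H1 0 L" "V2 L = (LINT s|lebesgue_on {0..t - T}. b (s + T))"
      "AE x in lebesgue_on {0..L}.
             w (t - T) x - u T x - (of_real \<nu> + \<i> * of_real \<alpha>) * W2 x - of_real \<gamma> * (LINT s|lebesgue_on {0..t - T}. w s x) =
             (LINT s|lebesgue_on {0..t - T}. N (w s x))"
      using w' t'(2) by blast
    have I: "(LINT s|lebesgue_on {0..t}. v s x) = (LINT s|lebesgue_on {0..T}. u s x) + (LINT s|lebesgue_on {0..t - T}. w s x)" if x: "x \<in> {0..L}" for x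
    proof -
      have "(LINT s|lebesgue_on {0..T}. v s x) = (LINT s|lebesgue_on {0..T}. u s x)"
        by (rule Bochner_Integration.integral_cong) (auto simp: v_def)
      moreover have "(LINT s|lebesgue_on {0..t - T}. v (s + T) x) = (LINT s|lebesgue_on {0..t - T}. w s x)"
        by (rule Bochner_Integration.integral_cong) (use x vw in auto)
      ultimately show ?thesis using lint_concat[OF vc[OF x] t'(1) TS(1)] by simp
    qed
    have IN: "(LINT s|lebesgue_on {0..t}. N (v s x)) = (LINT s|lebesgue_on {0..T}. N (u s x)) + (LINT s|lebesgue_on {0..t - T}. N (w s x))" if x: "x \<in> {0..L}" for x
    proof -
      have "(LINT s|lebesgue_on {0..T}. N (v s x)) = (LINT s|lebesgue_on {0..T}. N (u s x))"
        by (rule Bochner_Integration.integral_cong) (auto simp: v_def)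
      moreover have "(LINT s|lebesgue_on {0..t - T}. N (v (s + T) x)) = (LINT s|lebesgue_on {0..t - T}. N (w s x))"
        by (rule Bochner_Integration.integral_cong) (use x vw in auto)
      ultimately show ?thesis using lint_concat[OF Nvc[OF x] t'(1) TS(1)] by simp
    qed
    show ?thesis
    proof (intro exI conjI)
      show "weak_derivative 0 L (\<lambda>x. LINT s|lebesgue_on {0..t}. v s x) (\<lambda>x. V1 x + V2 x)"
        using weak_derivative_add[OF 1(1) 2(1)] by (subst weak_derivative_cong[OF I refl]) auto
      show "weak_derivative 0 L (\<lambda>x. V1 x + V2 x) (\<lambda>x. W1 x + W2 x)" by (rule weak_derivative_add[OF 1(2) 2(2)])
      show "(\<lambda>x. V1 x + V2 x) \<in> H1 0 L" by (rule H1_add[OF 1(3) 2(3)])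
      show "V1 L + V2 L = (LINT s|lebesgue_on {0..t}. b s)"
        using lint_concat[OF b t'(1) TS(1)] 1(4) 2(4) by simp
      show "AE x in lebesgue_on {0..L}.
             v t x - u0 x - (of_real \<nu> + \<i> * of_real \<alpha>) * (W1 x + W2 x) - of_real \<gamma> * (LINT s|lebesgue_on {0..t}. v s x) =
             (LINT s|lebesgue_on {0..t}. N (v s x))"
        using 1(5) 2(5) AE_space
      proof eventually_elim
        case (elim x)
        then have x: "x \<in> {0..L}" by simp
        have "v t x = w (t - T) x" using False by (simp add: v_def)
        then have "v t x - u0 x - (of_real \<nu> + \<i> * of_real \<alpha>) * (W1 x + W2 x) - of_real \<gamma> * (LINT s|lebesgue_on {0..t}. v s x)
          = (u T x - u0 x - (of_real \<nu> + \<i> * of_real \<alpha>) * W1 x - of_real \<gamma> * (LINT s|lebesgue_on {0..T}. u s x))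
          + (w (t - T) x - u T x - (of_real \<nu> + \<i> * of_real \<alpha>) * W2 x - of_real \<gamma> * (LINT s|lebesgue_on {0..t - T}. w s x))"
          unfolding I[OF x] by (simp add: algebra_simps)
        also have "\<dots> = (LINT s|lebesgue_on {0..t}. N (v s x))" unfolding elim(1) elim(2) IN[OF x] ..
        finally show ?case .
      qed
    qed
  qed
  have init: "v 0 x = u0 x" if "x \<in> {0..L}" for x using u' TS that by (auto simp: v_def)
  have bdry: "v t 0 = a t" if "t \<in> {0..T + S}" for t
    using u' w' that by (cases "t \<le> T") (auto simp: v_def)
  have "CGL_solution L \<nu> \<alpha> \<kappa> \<beta> \<gamma> p u0 a b (T + S) v"
    unfolding CGL_solution_def linear_mild_solution_def Let_def N_def[symmetric]
    using vC init bdry mild by blast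
  then show ?thesis by (simp only: v_def)
qed

section \<open>From local to global solutions\<close>

lemma H1_loc_holder:
  assumes a: "a \<in> H1_loc" and R: "R > 0"
  obtains H where "H \<ge> 0" "\<And>s t. s \<in> {0..R} \<Longrightarrow> t \<in> {0..R} \<Longrightarrow> (cmod (a t - a s))\<^sup>2 \<le> H * \<bar>t - s\<bar>"
proof -
  obtain g where g: "weak_derivative 0 R a g" and c: "continuous_on {0..R} a"
    using a R by (auto simp: H1_loc_def H1_def)
  show thesis
  proof (rule that)
    show "0 \<le> (LINT s|lebesgue_on {0..R}. (cmod (g s))\<^sup>2)" by (rule Bochner_Integration.integral_nonneg) simp
    show "(cmod (a t - a s))\<^sup>2 \<le> (LINT s|lebesgue_on {0..R}. (cmod (g s))\<^sup>2) * \<bar>t - s\<bar>" if "s \<in> {0..R}" "t \<in> {0..R}" for s t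
      using weak_derivative_holder[OF g c that(2,1)] by (simp add: mult.commute)
  qed
qed

text \<open>The gain in time is 1 whatever the size of \<open>u T\<close>, so iteration cannot stall
  before a finite time.\<close>

lemma CGL_extend:
  fixes L \<nu> \<kappa> \<alpha> \<beta> \<gamma> p T :: real
  assumes pars: "L > 0" "\<nu> > 0" "\<kappa> > 0" "\<gamma> \<ge> 0" "0 < p" "p \<le> 2"
    and a: "a \<in> H1_loc" and b: "b \<in> H1_loc" and T: "T \<ge> 0"
    and u: "CGL_solution L \<nu> \<alpha> \<kappa> \<beta> \<gamma> p u0 a b T u"
  obtains v where "\<And>t. t \<le> T \<Longrightarrow> v t = u t" "CGL_solution L \<nu> \<alpha> \<kappa> \<beta> \<gamma> p u0 a b (T + 1) v"
proof -
  have T1: "T + 1 > 0" using T by simp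
  obtain Ha where Ha: "Ha \<ge> 0" "\<And>s t. s \<in> {0..T+1} \<Longrightarrow> t \<in> {0..T+1} \<Longrightarrow> (cmod (a t - a s))\<^sup>2 \<le> Ha * \<bar>t - s\<bar>"
    using H1_loc_holder[OF a T1] by blast
  obtain Hb where Hb: "Hb \<ge> 0" "\<And>s t. s \<in> {0..T+1} \<Longrightarrow> t \<in> {0..T+1} \<Longrightarrow> (cmod (b t - b s))\<^sup>2 \<le> Hb * \<bar>t - s\<bar>"
    using H1_loc_holder[OF b T1] by blast
  have acT: "continuous_on {0..T + 1} a" and bcT: "continuous_on {0..T + 1} b"
    using a b T1 by (auto simp: H1_loc_def H1_def)
  have TT: "T \<in> {0..T}" using T by simp
  interpret cgl_data L \<nu> \<alpha> \<kappa> \<beta> \<gamma> p "u T" "\<lambda>s. a (s + T)" "\<lambda>s. b (s + T)" "Ha + Hb"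
  proof unfold_locales
    show "u T \<in> H1 0 L" using u TT by (auto simp: CGL_solution_def linear_mild_solution_def C_H1_def)
    show "continuous_on {0..1} (\<lambda>s. a (s + T))"
      by (rule continuous_on_compose2[OF acT]) (use T in \<open>auto intro!: continuous_intros\<close>)
    show "continuous_on {0..1} (\<lambda>s. b (s + T))"
      by (rule continuous_on_compose2[OF bcT]) (use T in \<open>auto intro!: continuous_intros\<close>)
    show "(cmod (a (t + T) - a (s + T)))\<^sup>2 \<le> (Ha + Hb) * \<bar>t - s\<bar>" if "s \<in> {0..1}" "t \<in> {0..1}" for s t
    proof -
      have "(cmod (a (t + T) - a (s + T)))\<^sup>2 \<le> Ha * \<bar>t - s\<bar>" using Ha(2)[of "s + T" "t + T"] that T by simp
      also have "\<dots> \<le> (Ha + Hb) * \<bar>t - s\<bar>" using Hb(1) by (intro mult_right_mono) auto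
      finally show ?thesis .
    qed
    show "(cmod (b (t + T) - b (s + T)))\<^sup>2 \<le> (Ha + Hb) * \<bar>t - s\<bar>" if "s \<in> {0..1}" "t \<in> {0..1}" for s t
    proof -
      have "(cmod (b (t + T) - b (s + T)))\<^sup>2 \<le> Hb * \<bar>t - s\<bar>" using Hb(2)[of "s + T" "t + T"] that T by simp
      also have "\<dots> \<le> (Ha + Hb) * \<bar>t - s\<bar>" using Ha(1) by (intro mult_right_mono) auto
      finally show ?thesis .
    qed
    \<comment> \<open>Compatibility at the restart is the boundary condition of \<open>u\<close> at
      time T.\<close>
    show "u T 0 = a (0 + T)" using u TT by (auto simp: CGL_solution_def linear_mild_solution_def)
  qed (use pars Ha(1) Hb(1) in auto)
  obtain w where w: "CGL_solution L \<nu> \<alpha> \<kappa> \<beta> \<gamma> p (u T) (\<lambda>s. a (s + T)) (\<lambda>s. b (s + T)) 1 w"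
    using solution_exists by blast
  have "CGL_solution L \<nu> \<alpha> \<kappa> \<beta> \<gamma> p u0 a b (T + 1) (\<lambda>t. if t \<le> T then u t else w (t - T))"
    by (rule CGL_solution_concat[OF u w T _ pars(1) pars(5) bcT]) simp
  then show thesis using that[of "\<lambda>t. if t \<le> T then u t else w (t - T)"] by simp
qed

theorem theorem1p2:
  fixes L \<nu> \<kappa> \<alpha> \<beta> \<gamma> p T :: real
    and u0 a b :: "real \<Rightarrow> complex"
    and u :: "real \<Rightarrow> real \<Rightarrow> complex"
  assumes "L > 0" and "\<nu> > 0" and "\<kappa> > 0" and "\<gamma> \<ge> 0"
    and "u0 \<in> H1 0 L" and "a \<in> H1_loc" and "b \<in> H1_loc"
    and "u0 0 = a 0"
    and "\<beta> \<ge> 0 \<Longrightarrow> 0 < p \<and> p \<le> 2"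
    and "\<beta> < 0 \<Longrightarrow> 0 < p \<and> p < 4 / 5"
    and "T > 0"
    and "CGL_solution L \<nu> \<alpha> \<kappa> \<beta> \<gamma> p u0 a b T u"
  shows "\<exists>v. (\<forall>t\<in>{0..T}. \<forall>x\<in>{0..L}. v t x = u t x) \<and>
             (\<forall>T'>0. CGL_solution L \<nu> \<alpha> \<kappa> \<beta> \<gamma> p u0 a b T' v)"
proof -
  have p: "0 < p" "p \<le> 2" using assms(9,10) by (cases "\<beta> \<ge> 0"; force)+
  define sol where "sol T v \<longleftrightarrow> CGL_solution L \<nu> \<alpha> \<kappa> \<beta> \<gamma> p u0 a b T v" for T v
  \<comment> \<open>Dependent choice of solutions on [0, T + n], each extending its predecessor and
    starting from \<open>u\<close> itself.\<close>
  have "\<exists>U. \<forall>n. (sol (T + real n) (U n) \<and> (n = 0 \<longrightarrow> U n = u)) \<and> (\<forall>t\<le>T + real n. U (Suc n) t = U n t)"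
  proof (rule dependent_nat_choice)
    show "\<exists>v. sol (T + real 0) v \<and> (0 = (0::nat) \<longrightarrow> v = u)" using assms(12) by (auto simp: sol_def)
    fix v n assume "sol (T + real n) v \<and> (n = 0 \<longrightarrow> v = u)"
    then have v: "CGL_solution L \<nu> \<alpha> \<kappa> \<beta> \<gamma> p u0 a b (T + real n) v" by (simp add: sol_def)
    have "T + real n \<ge> 0" using assms(11) by simp
    from CGL_extend[OF assms(1-4) p assms(6,7) this v]
    obtain w where "\<And>t. t \<le> T + real n \<Longrightarrow> w t = v t" "CGL_solution L \<nu> \<alpha> \<kappa> \<beta> \<gamma> p u0 a b (T + real n + 1) w" by blast
    then show "\<exists>w. (sol (T + real (Suc n)) w \<and> (Suc n = 0 \<longrightarrow> w = u)) \<and> (\<forall>t\<le>T + real n. w t = v t)"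
      by (auto simp: sol_def add_ac)
  qed
  then obtain U where U: "\<And>n. sol (T + real n) (U n)" "U 0 = u" "\<And>n t. t \<le> T + real n \<Longrightarrow> U (Suc n) t = U n t"
    by blast
  have Umono: "U (n + k) t = U n t" if "t \<le> T + real n" for n k t
    by (induction k) (use that U(3) in auto)
  \<comment> \<open>Any index whose interval contains t gives the same value; this one does, as t <=
    T + nat (ceiling t).\<close>
  define v where "v t = U (nat \<lceil>t\<rceil>) t" for t
  have vU: "v t = U n t" if "t \<le> T + real n" for t n
  proof -
    define m where "m = nat \<lceil>t\<rceil>"
    have m: "t \<le> T + real m" using assms(11) real_nat_ceiling_ge[of t] unfolding m_def by linarith
    show ?thesis
      using Umono[OF m, of "n - m"] Umono[OF that, of "m - n"] unfolding v_def m_def[symmetric]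
      by (cases "m \<le> n") auto
  qed
  show ?thesis
  proof (intro exI[of _ v] conjI ballI allI impI)
    show "v t x = u t x" if "t \<in> {0..T}" for t x using vU[of t 0] that U(2) by simp
    fix T' :: real assume "T' > 0"
    define n where "n = nat \<lceil>T'\<rceil>"
    have n: "T' \<le> T + real n" using assms(11) real_nat_ceiling_ge[of T'] unfolding n_def by linarith
    have "CGL_solution L \<nu> \<alpha> \<kappa> \<beta> \<gamma> p u0 a b (T + real n) v"
      by (rule CGL_solution_cong[OF U(1)[unfolded sol_def]]) (use vU assms(11) in auto)
    then show "CGL_solution L \<nu> \<alpha> \<kappa> \<beta> \<gamma> p u0 a b T' v" by (rule CGL_solution_mono[OF _ n])
  qed
qed

end
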